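(* For each $N$ let $X_N(\sigma)=\sum_{1\le i,j\le N} g_{ij}\sigma_i\sigma_j$, $\sigma\in\{-1,1\}^N$, where $(g_{ij})_{1\le i,j\le N}$ are i.i.d. standard Gaussian random variables, and let $M_N:=\max_{\sigma\in\{-1,1\}^N}X_N(\sigma)$. Then there are constants $r_N\to\infty$, $\gamma_N\to0$, $\epsilon_N\to0$ and $\delta_N\to0$ such that for every $N\ge 2$, with probability at least $1-\gamma_N$, there is a set $A\subseteq\{-1,1\}^N$ satisfying (a) $|A|\ge r_N$; (b) $R_{\sigma^1,\sigma^2}^2\le\epsilon_N$ for all $\sigma^1,\sigma^2\in A$ with $\sigma^1\ne\sigma^2$; and (c) $X_N(\sigma)\ge(1-\delta_N)M_N$ for all $\sigma\in A$. Quantitatively, one can take $r_N=(\log N)^{1/8}$, $\delta_N=(\log N)^{-1/8}$, $\epsilon_N=e^{-(\log N)^{1/8}}$ and $\gamma_N=C(\log N)^{-1/12}$, where $C$ is an absolute constant.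
   Context: For $\sigma^1,\sigma^2\in\{-1,1\}^N$ the overlap is $R_{\sigma^1,\sigma^2}:=\frac1N\sum_{i=1}^N\sigma^1_i\sigma^2_i$. *)

theory Defs
  imports "HOL-Probability.Probability"
begin

(* Configurations are extensional functions on {1..N}, so that distinct elements of the cube
   differ at some site in {1..N}. *)
definition cube :: "nat \<Rightarrow> (nat \<Rightarrow> real) set" where
  "cube N = {1..N} \<rightarrow>\<^sub>E {-1, 1}"

definition overlap :: "nat \<Rightarrow> (nat \<Rightarrow> real) \<Rightarrow> (nat \<Rightarrow> real) \<Rightarrow> real" where
  "overlap N \<sigma> \<tau> = (\<Sum>i=1..N. \<sigma> i * \<tau> i) / real N"

definition X :: "nat \<Rightarrow> (nat \<times> nat \<Rightarrow> real) \<Rightarrow> (nat \<Rightarrow> real) \<Rightarrow> real" where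
  "X N g \<sigma> = (\<Sum>i=1..N. \<Sum>j=1..N. g (i, j) * \<sigma> i * \<sigma> j)"

definition max_X :: "nat \<Rightarrow> (nat \<times> nat \<Rightarrow> real) \<Rightarrow> real" where
  "max_X N g = Max (X N g ` cube N)"

definition multiple_peaks ::
    "nat \<Rightarrow> real \<Rightarrow> real \<Rightarrow> real \<Rightarrow> (nat \<times> nat \<Rightarrow> real) \<Rightarrow> bool" where
  "multiple_peaks N r \<epsilon> \<delta> g \<longleftrightarrow>
     (\<exists>A \<subseteq> cube N.
        real (card A) \<ge> r \<and>
        (\<forall>\<sigma>\<in>A. \<forall>\<tau>\<in>A. \<sigma> \<noteq> \<tau> \<longrightarrow> (overlap N \<sigma> \<tau>)\<^sup>2 \<le> \<epsilon>) \<and>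
        (\<forall>\<sigma>\<in>A. X N g \<sigma> \<ge> (1 - \<delta>) * max_X N g))"

abbreviation std_gaussian :: "real measure" where
  "std_gaussian \<equiv> density lborel (\<lambda>x. ennreal (std_normal_density x))"

(* The joint law of the disorder (g (i, j)): i.i.d. standard Gaussians, realised as the coordinates
   of a product space. By prob_multiple_peaks_iid below, the probability of the event is the same
   for i.i.d. standard Gaussians on any probability space; fixing the law keeps the constants
   of the theorem independent of the type of the sample space. *)
definition gaussian_disorder :: "nat \<Rightarrow> (nat \<times> nat \<Rightarrow> real) measure" where
  "gaussian_disorder N = (\<Pi>\<^sub>M ij \<in> {1..N} \<times> {1..N}. std_gaussian)"

lemma finite_cube: "finite (cube N)"
  unfolding cube_def by (intro finite_PiE) auto

lemma cube_nonempty: "cube N \<noteq> {}"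
  unfolding cube_def by (simp add: PiE_eq_empty_iff)

lemma sets_gaussian_disorder [measurable_cong]:
  "sets (gaussian_disorder N) = sets (\<Pi>\<^sub>M ij \<in> {1..N} \<times> {1..N}. borel)"
  unfolding gaussian_disorder_def by (intro sets_PiM_cong) auto

lemma prob_space_gaussian_disorder: "prob_space (gaussian_disorder N)"
  unfolding gaussian_disorder_def
  by (intro prob_space_PiM prob_space_normal_density) simp

lemma measurable_X [measurable]:
  "(\<lambda>g. X N g \<sigma>) \<in> borel_measurable (\<Pi>\<^sub>M ij \<in> {1..N} \<times> {1..N}. borel)"
  unfolding X_def
  by (intro borel_measurable_sum borel_measurable_times measurable_component_singleton
        borel_measurable_const) auto

lemma measurable_max_X [measurable]:
  "max_X N \<in> borel_measurable (\<Pi>\<^sub>M ij \<in> {1..N} \<times> {1..N}. borel)"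
proof -
  have "(\<lambda>g. Max ((\<lambda>\<sigma>. X N g \<sigma>) ` cube N)) \<in>
          borel_measurable (\<Pi>\<^sub>M ij \<in> {1..N} \<times> {1..N}. borel)"
    by (intro borel_measurable_Max finite_cube measurable_X)
  then show ?thesis unfolding max_X_def[abs_def] by simp
qed

lemma measurable_multiple_peaks [measurable]:
  "Measurable.pred (\<Pi>\<^sub>M ij \<in> {1..N} \<times> {1..N}. borel) (multiple_peaks N r \<epsilon> \<delta>)"
proof -
  have fin: "finite A" if "A \<in> Pow (cube N)" for A
    using that finite_cube finite_subset by auto
  have le: "Measurable.pred (\<Pi>\<^sub>M ij \<in> {1..N} \<times> {1..N}. borel)
      (\<lambda>g. (1 - \<delta>) * max_X N g \<le> X N g \<sigma>)" for \<sigma>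
    using measurable_X[of N \<sigma>] measurable_max_X[of N] unfolding pred_def
    by (intro borel_measurable_le borel_measurable_times borel_measurable_const)
  have "Measurable.pred (\<Pi>\<^sub>M ij \<in> {1..N} \<times> {1..N}. borel)
     (\<lambda>g. \<exists>A \<in> Pow (cube N).
        real (card A) \<ge> r \<and>
        (\<forall>\<sigma>\<in>A. \<forall>\<tau>\<in>A. \<sigma> \<noteq> \<tau> \<longrightarrow> (overlap N \<sigma> \<tau>)\<^sup>2 \<le> \<epsilon>) \<and>
        (\<forall>\<sigma>\<in>A. X N g \<sigma> \<ge> (1 - \<delta>) * max_X N g))"
    by (intro pred_intros_finite pred_intros_logic fin le) (auto simp: finite_cube)
  then show ?thesis unfolding multiple_peaks_def[abs_def] Pow_def by (simp add: Bex_def)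
qed

lemma multiple_peaks_restrict:
  "multiple_peaks N r \<epsilon> \<delta> (restrict g ({1..N} \<times> {1..N})) = multiple_peaks N r \<epsilon> \<delta> g"
proof -
  have "X N (restrict g ({1..N} \<times> {1..N})) = X N g"
    unfolding X_def by (intro ext sum.cong) auto
  then show ?thesis unfolding multiple_peaks_def max_X_def by simp
qed

lemma prob_multiple_peaks_iid:
  fixes g :: "nat \<times> nat \<Rightarrow> 'w \<Rightarrow> real"
  assumes "prob_space M" and "N \<ge> 1"
    and indep: "prob_space.indep_vars M (\<lambda>_. borel) g ({1..N} \<times> {1..N})"
    and distr: "\<And>ij. ij \<in> {1..N} \<times> {1..N} \<Longrightarrow> distributed M lborel (g ij) std_normal_density"
  shows "measure M {w \<in> space M. multiple_peaks N r \<epsilon> \<delta> (\<lambda>ij. g ij w)} =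
         measure (gaussian_disorder N) {h \<in> space (gaussian_disorder N). multiple_peaks N r \<epsilon> \<delta> h}"
proof -
  interpret prob_space M by fact
  let ?I = "{1..N} \<times> {1..N}"
  let ?P = "\<Pi>\<^sub>M ij \<in> ?I. (borel :: real measure)"
  let ?G = "\<lambda>w. \<lambda>ij\<in>?I. g ij w"
  have rv: "g ij \<in> borel_measurable M" if "ij \<in> ?I" for ij
    using distributed_measurable[OF distr[OF that]] by simp
  have law: "distr M borel (g ij) = std_gaussian" if "ij \<in> ?I" for ij
  proof -
    have "distr M borel (g ij) = distr M lborel (g ij)" by (intro distr_cong) auto
    then show ?thesis using distributed_distr_eq_density[OF distr[OF that]] by simp
  qed
  have "distr M ?P ?G = (\<Pi>\<^sub>M ij\<in>?I. distr M borel (g ij))"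
    using indep_vars_iff_distr_eq_PiM'[where I = ?I and M' = "\<lambda>_. borel" and X = g] rv indep \<open>N \<ge> 1\<close> by auto
  also have "\<dots> = gaussian_disorder N"
    unfolding gaussian_disorder_def by (intro PiM_cong law) auto
  finally have eq: "distr M ?P ?G = gaussian_disorder N" .
  have meas: "?G \<in> measurable M ?P" using rv by (intro measurable_restrict) auto
  have sp: "space (gaussian_disorder N) = space ?P" using eq by (metis space_distr)
  have S: "{h \<in> space ?P. multiple_peaks N r \<epsilon> \<delta> h} \<in> sets ?P" by measurable
  have "measure (gaussian_disorder N) {h \<in> space ?P. multiple_peaks N r \<epsilon> \<delta> h} =
        measure M (?G -` {h \<in> space ?P. multiple_peaks N r \<epsilon> \<delta> h} \<inter> space M)"
    unfolding eq[symmetric] by (rule measure_distr[OF meas S])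
  also have "?G -` {h \<in> space ?P. multiple_peaks N r \<epsilon> \<delta> h} \<inter> space M =
      {w \<in> space M. multiple_peaks N r \<epsilon> \<delta> (\<lambda>ij. g ij w)}"
    using measurable_space[OF meas] multiple_peaks_restrict[of N r \<epsilon> \<delta>] by auto
  finally show ?thesis by (simp add: sp)
qed

end

theory Submission
  imports Defs "HOL-Real_Asymp.Real_Asymp"
begin

text \<open>Let \<open>p\<close> be the Gibbs weights of the field at inverse temperature \<open>b\<close>, and let \<open>T k\<close> be the
  Ornstein-Uhlenbeck operator \<open>f \<mapsto> E f (k g + sqrt (1 - k\<^sup>2) y)\<close>. Given the disorder \<open>g\<close>, configurations
  are drawn independently from the weights \<open>T k p g\<close> with \<open>k\<close> close to 1. By self-adjointness of \<open>T k\<close> and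
  linearity of the field, the mean energy of such a sample is exactly \<open>k\<close> times the mean Gibbs energy, hence
  nearly maximal. The mean squared overlap of two samples is \<open>E R\<^sup>2\<close> for the Gibbs measures of two disorders with
  correlation \<open>r = k\<^sup>2\<close>. By the Cauchy-Schwarz inequality and the semigroup property this quantity at correlation
  \<open>r\<close> is at most its square root at correlation \<open>r\<^sup>2\<close>, so iteration leads to a correlation of order
  \<open>1 / (b\<^sup>2 N)\<close>. There the exponential moment of \<open>N R\<^sup>2\<close> is bounded by interpolating from independent disorders:
  raising the correlation from \<open>r\<close> to \<open>r + h\<close> is paid for by raising the exponent from \<open>c\<close> to
  \<open>c + 2 b\<^sup>2 h\<close>, up to an error of order \<open>h powr (3/2)\<close>. Finally, a second moment estimate bounds the maximum
  from below.\<close>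

section \<open>Rotation invariance of Gaussian vectors\<close>

text \<open>A Gibbs measure at low temperature may sit on few peaks, so nothing direct bounds the
  overlap of two of its replicas; \<open>T k\<close> replaces it by a mixture of the Gibbs measures
  of slightly perturbed disorders, whose replicas do decorrelate. The obstacle is the range of the
  correlation: the interpolation is effective only while \<open>b\<^sup>2 * N * r\<close> is
  bounded, whereas a small energy loss needs \<open>r\<close> near 1 and \<open>b\<close> much
  larger than \<open>1 / sqrt N\<close>. Squaring the correlation \<open>m\<close> times bridges the
  gap at the price of a root of order \<open>q = 2 ^ m\<close>. With \<open>L = ln N\<close>, the
  choice \<open>b\<^sup>2 * N = L\<close> and \<open>q\<close> of order \<open>L powr (3/4)\<close>
  balances the two: in units of \<open>N * sqrt N\<close> the energy loss is of order
  \<open>ln L * L powr (-3/4)\<close> from smoothing and \<open>L powr (-1/2)\<close> from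
  temperature, while the mean squared overlap is at most \<open>(12 / N) powr (1 / q)\<close>,
  roughly \<open>exp (- L powr (1/4) / 2)\<close> at worst. Both survive a first moment argument
  over about \<open>L powr (1/8)\<close> draws. The lower bound on the maximum is run at
  \<open>a\<^sup>2 * N = L powr (-1/12)\<close>, and its failure probability is what fixes
  \<gamma>.\<close>

lemma nn_integral_lborel_shear1:
  fixes f :: "real \<times> real \<Rightarrow> ennreal"
  assumes [measurable]: "f \<in> borel_measurable (borel \<Otimes>\<^sub>M borel)"
  shows "(\<integral>\<^sup>+p. f (fst p + a * snd p, snd p) \<partial>(lborel \<Otimes>\<^sub>M lborel)) = (\<integral>\<^sup>+p. f p \<partial>(lborel \<Otimes>\<^sub>M lborel))"
proof -
  have "(\<integral>\<^sup>+p. f (fst p + a * snd p, snd p) \<partial>(lborel \<Otimes>\<^sub>M lborel))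
      = (\<integral>\<^sup>+y. \<integral>\<^sup>+x. f (x + a * y, y) \<partial>lborel \<partial>lborel)"
    by (subst lborel_pair.nn_integral_snd[symmetric]) auto
  also have "\<dots> = (\<integral>\<^sup>+y. \<integral>\<^sup>+x. f (x, y) \<partial>lborel \<partial>lborel)"
  proof (rule nn_integral_cong)
    fix y :: real
    show "(\<integral>\<^sup>+x. f (x + a * y, y) \<partial>lborel) = (\<integral>\<^sup>+x. f (x, y) \<partial>lborel)"
      using nn_integral_real_affine[of "\<lambda>x. f (x, y)" 1 "a * y"] by (simp add: add.commute)
  qed
  also have "\<dots> = (\<integral>\<^sup>+p. f p \<partial>(lborel \<Otimes>\<^sub>M lborel))"
    by (subst lborel_pair.nn_integral_snd[symmetric]) auto
  finally show ?thesis .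
qed

lemma nn_integral_lborel_shear2:
  fixes f :: "real \<times> real \<Rightarrow> ennreal"
  assumes [measurable]: "f \<in> borel_measurable (borel \<Otimes>\<^sub>M borel)"
  shows "(\<integral>\<^sup>+p. f (fst p, snd p + a * fst p) \<partial>(lborel \<Otimes>\<^sub>M lborel)) = (\<integral>\<^sup>+p. f p \<partial>(lborel \<Otimes>\<^sub>M lborel))"
proof -
  have "(\<integral>\<^sup>+p. f (fst p, snd p + a * fst p) \<partial>(lborel \<Otimes>\<^sub>M lborel))
      = (\<integral>\<^sup>+x. \<integral>\<^sup>+y. f (x, y + a * x) \<partial>lborel \<partial>lborel)"
    by (subst lborel.nn_integral_fst[symmetric]) auto
  also have "\<dots> = (\<integral>\<^sup>+x. \<integral>\<^sup>+y. f (x, y) \<partial>lborel \<partial>lborel)"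
  proof (rule nn_integral_cong)
    fix x :: real
    show "(\<integral>\<^sup>+y. f (x, y + a * x) \<partial>lborel) = (\<integral>\<^sup>+y. f (x, y) \<partial>lborel)"
      using nn_integral_real_affine[of "\<lambda>y. f (x, y)" 1 "a * x"] by (simp add: add.commute)
  qed
  also have "\<dots> = (\<integral>\<^sup>+p. f p \<partial>(lborel \<Otimes>\<^sub>M lborel))"
    by (subst lborel.nn_integral_fst[symmetric]) auto
  finally show ?thesis .
qed

definition rot2 :: "real \<Rightarrow> real \<Rightarrow> real \<times> real \<Rightarrow> real \<times> real" where
  "rot2 c s p = (c * fst p - s * snd p, s * fst p + c * snd p)"

lemma rot2_measurable [measurable]: "rot2 c s \<in> borel \<Otimes>\<^sub>M borel \<rightarrow>\<^sub>M borel \<Otimes>\<^sub>M borel"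
  unfolding rot2_def[abs_def] by measurable

text \<open>A rotation with \<open>s \<noteq> 0\<close> is a product of three shears; a half turn is a product of two quarter turns.\<close>

lemma nn_integral_lborel_rot2:
  fixes f :: "real \<times> real \<Rightarrow> ennreal"
  assumes f [measurable]: "f \<in> borel_measurable (borel \<Otimes>\<^sub>M borel)" and cs: "c\<^sup>2 + s\<^sup>2 = 1"
  shows "(\<integral>\<^sup>+p. f (rot2 c s p) \<partial>(lborel \<Otimes>\<^sub>M lborel)) = (\<integral>\<^sup>+p. f p \<partial>(lborel \<Otimes>\<^sub>M lborel))"
proof -
  have main: "(\<integral>\<^sup>+p. f (rot2 c s p) \<partial>(lborel \<Otimes>\<^sub>M lborel)) = (\<integral>\<^sup>+p. f p \<partial>(lborel \<Otimes>\<^sub>M lborel))"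
    if cs: "c\<^sup>2 + s\<^sup>2 = 1" and s: "s \<noteq> 0" and f [measurable]: "f \<in> borel_measurable (borel \<Otimes>\<^sub>M borel)"
    for c s and f :: "real \<times> real \<Rightarrow> ennreal"
  proof -
    \<comment> \<open>If \<open>c\<close> and \<open>s\<close> are the cosine and sine of an angle,
      \<open>a\<close> is minus the tangent of half of it. The two horizontal shears use
      \<open>a\<close>, the vertical one between them uses \<open>s\<close>.\<close>
    define a where "a = (c - 1) / s"
    define f1 where "f1 p = f (fst p + a * snd p, snd p)" for p
    define f2 where "f2 p = f1 (fst p, snd p + s * fst p)" for p
    have [measurable]: "f1 \<in> borel_measurable (borel \<Otimes>\<^sub>M borel)"
      unfolding f1_def by measurable
    have [measurable]: "f2 \<in> borel_measurable (borel \<Otimes>\<^sub>M borel)"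
      unfolding f2_def by measurable
    have as: "a * s = c - 1" using s by (simp add: a_def)
    have "a * (c + 1) = - s"
      using s cs by (simp add: a_def field_simps power2_eq_square)
    then have ac: "a + a * c = - s" by (simp add: algebra_simps)
    have "f (rot2 c s p) = f2 (fst p + a * snd p, snd p)" for p
    proof -
      have "fst p + a * snd p + a * (snd p + s * (fst p + a * snd p)) 
          = fst p * (1 + a * s) + snd p * (a + a * (1 + a * s))" by (simp add: algebra_simps)
      also have "\<dots> = c * fst p - s * snd p" using ac as by (simp add: algebra_simps)
      finally have 1: "fst p + a * snd p + a * (snd p + s * (fst p + a * snd p)) = c * fst p - s * snd p" .
      have "snd p + s * (fst p + a * snd p) = s * fst p + (1 + a * s) * snd p" by (simp add: algebra_simps)
      also have "\<dots> = s * fst p + c * snd p" using as by simp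
      finally have 2: "snd p + s * (fst p + a * snd p) = s * fst p + c * snd p" .
      show ?thesis unfolding f2_def f1_def rot2_def using 1 2 by simp
    qed
    then have "(\<integral>\<^sup>+p. f (rot2 c s p) \<partial>(lborel \<Otimes>\<^sub>M lborel)) = (\<integral>\<^sup>+p. f2 (fst p + a * snd p, snd p) \<partial>(lborel \<Otimes>\<^sub>M lborel))"
      by simp
    also have "\<dots> = (\<integral>\<^sup>+p. f2 p \<partial>(lborel \<Otimes>\<^sub>M lborel))" by (rule nn_integral_lborel_shear1) measurable
    also have "\<dots> = (\<integral>\<^sup>+p. f1 p \<partial>(lborel \<Otimes>\<^sub>M lborel))" unfolding f2_def by (rule nn_integral_lborel_shear2) measurable
    also have "\<dots> = (\<integral>\<^sup>+p. f p \<partial>(lborel \<Otimes>\<^sub>M lborel))" unfolding f1_def by (rule nn_integral_lborel_shear1) measurable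
    finally show ?thesis .
  qed
  show ?thesis
  proof (cases "s = 0")
    case False
    then show ?thesis using main[OF cs False f] by simp
  next
    case True
    with cs have "c = 1 \<or> c = -1" by (simp add: power2_eq_1_iff)
    then have "f (rot2 c s p) = f p \<or> c = -1" for p using True by (auto simp: rot2_def)
    moreover have "rot2 c s p = rot2 0 1 (rot2 0 1 p)" if "c = -1" for p using True that by (simp add: rot2_def)
    moreover have "(\<integral>\<^sup>+p. f (rot2 0 1 (rot2 0 1 p)) \<partial>(lborel \<Otimes>\<^sub>M lborel)) = (\<integral>\<^sup>+p. f p \<partial>(lborel \<Otimes>\<^sub>M lborel))"
      by (subst main[where f = "\<lambda>p. f (rot2 0 1 p)"]) (simp_all add: main)
    ultimately show ?thesis using \<open>c = 1 \<or> c = -1\<close> by (cases "c = -1") auto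
  qed
qed

lemma std_gaussian_pair:
  "std_gaussian \<Otimes>\<^sub>M std_gaussian =
   density (lborel \<Otimes>\<^sub>M lborel) (\<lambda>p. ennreal (std_normal_density (fst p) * std_normal_density (snd p)))"
  by (subst pair_measure_density)
    (auto simp: prob_space_normal_density prob_space_imp_sigma_finite lborel.sigma_finite_measure_axioms
      split_beta ennreal_mult intro!: density_cong)

text \<open>The joint density depends only on the Euclidean norm, and a rotation preserves both the
  norm and Lebesgue measure.\<close>

lemma distr_std_gaussian_rot2:
  assumes cs: "c\<^sup>2 + s\<^sup>2 = 1"
  shows "distr (std_gaussian \<Otimes>\<^sub>M std_gaussian) (std_gaussian \<Otimes>\<^sub>M std_gaussian) (rot2 c s) = std_gaussian \<Otimes>\<^sub>M std_gaussian"
proof (rule measure_eqI)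
  let ?G = "std_gaussian \<Otimes>\<^sub>M std_gaussian" and ?L = "lborel \<Otimes>\<^sub>M lborel :: (real \<times> real) measure"
  let ?d = "\<lambda>p. ennreal (std_normal_density (fst p) * std_normal_density (snd p))"
  have sets: "sets ?G = sets (borel \<Otimes>\<^sub>M borel)"
    by (intro sets_pair_measure_cong) auto
  have m: "rot2 c s \<in> ?G \<rightarrow>\<^sub>M ?G"
    using rot2_measurable[of c s] measurable_cong_sets[OF sets sets] by simp
  have inv: "?d (rot2 c s p) = ?d p" for p
  proof -
    have "(c * fst p - s * snd p)\<^sup>2 + (s * fst p + c * snd p)\<^sup>2 = (c\<^sup>2 + s\<^sup>2) * ((fst p)\<^sup>2 + (snd p)\<^sup>2)"
      by algebra
    then have "- (c * fst p - s * snd p)\<^sup>2 / 2 + - (s * fst p + c * snd p)\<^sup>2 / 2 = - (fst p)\<^sup>2 / 2 + - (snd p)\<^sup>2 / 2"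
      using cs by (simp add: field_simps)
    then have "exp (- (c * fst p - s * snd p)\<^sup>2 / 2) * exp (- (s * fst p + c * snd p)\<^sup>2 / 2) = exp (- (fst p)\<^sup>2 / 2) * exp (- (snd p)\<^sup>2 / 2)"
      by (metis exp_add)
    then show ?thesis by (simp add: rot2_def std_normal_density_def)
  qed
  fix A assume A0: "A \<in> sets (distr ?G ?G (rot2 c s))"
  then have A [measurable]: "A \<in> sets (borel \<Otimes>\<^sub>M borel)" using sets by simp
  have AL: "A \<in> sets ?L" using A0 by (simp add: std_gaussian_pair)
  have "emeasure (distr ?G ?G (rot2 c s)) A = (\<integral>\<^sup>+p. indicator A (rot2 c s p) \<partial>?G)"
    using A0 nn_integral_distr[OF m, of "indicator A"] by simp
  also have "\<dots> = (\<integral>\<^sup>+p. ?d p * indicator A (rot2 c s p) \<partial>?L)"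
    unfolding std_gaussian_pair by (subst nn_integral_density) auto
  also have "\<dots> = (\<integral>\<^sup>+p. (\<lambda>q. ?d q * indicator A q) (rot2 c s p) \<partial>?L)"
    using inv by simp
  also have "\<dots> = (\<integral>\<^sup>+p. ?d p * indicator A p \<partial>?L)"
    by (rule nn_integral_lborel_rot2[OF _ cs]) measurable
  also have "\<dots> = emeasure ?G A"
    unfolding std_gaussian_pair using AL by (subst emeasure_density) auto
  finally show "emeasure (distr ?G ?G (rot2 c s)) A = emeasure ?G A" .
qed simp

lemma measurable_rot2_std_gaussian:
  "rot2 c s \<in> std_gaussian \<Otimes>\<^sub>M std_gaussian \<rightarrow>\<^sub>M std_gaussian \<Otimes>\<^sub>M std_gaussian"
proof -
  have sets: "sets (std_gaussian \<Otimes>\<^sub>M std_gaussian) = sets (borel \<Otimes>\<^sub>M borel)"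
    by (intro sets_pair_measure_cong) auto
  show ?thesis using rot2_measurable[of c s] measurable_cong_sets[OF sets sets] by simp
qed

locale gaussian_vector =
  fixes I :: "'i set"
  assumes fin: "finite I"
begin

abbreviation G :: "('i \<Rightarrow> real) measure" where
  "G \<equiv> (\<Pi>\<^sub>M i\<in>I. std_gaussian)"

sublocale std: prob_space std_gaussian
  by (rule prob_space_normal_density) simp

sublocale G: prob_space G
  by (rule prob_space_PiM) (rule std.prob_space_axioms)

sublocale PiG: product_prob_space "\<lambda>_::'i. std_gaussian" I
  by unfold_locales

sublocale PiG2: product_prob_space "\<lambda>_::'i. std_gaussian \<Otimes>\<^sub>M std_gaussian" I
proof -
  interpret p: pair_prob_space std_gaussian std_gaussian ..
  show "product_prob_space (\<lambda>_::'i. std_gaussian \<Otimes>\<^sub>M std_gaussian)" by unfold_locales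
qed

sublocale GG: pair_prob_space G G ..

lemma sets_G [measurable_cong]: "sets G = sets (\<Pi>\<^sub>M i\<in>I. borel)"
  by (intro sets_PiM_cong) auto

text \<open>A pair of independent vectors is a vector of independent pairs. In the second form a
  rotation acts coordinate by coordinate, where the planar invariance applies.\<close>

lemma distr_zip:
  "distr (G \<Otimes>\<^sub>M G) (\<Pi>\<^sub>M i\<in>I. std_gaussian \<Otimes>\<^sub>M std_gaussian) (\<lambda>w. \<lambda>i\<in>I. (fst w i, snd w i))
   = (\<Pi>\<^sub>M i\<in>I. std_gaussian \<Otimes>\<^sub>M std_gaussian)"
  (is "distr _ ?P ?z = _")
proof (rule PiG2.PiM_eqI[OF fin])
  fix A assume A: "\<And>i. i \<in> I \<Longrightarrow> A i \<in> sets (std_gaussian \<Otimes>\<^sub>M std_gaussian)"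
  have m: "?z \<in> G \<Otimes>\<^sub>M G \<rightarrow>\<^sub>M ?P"
    by (intro measurable_restrict measurable_Pair) measurable
  have im: "(\<lambda>y. indicator (A i) (x, y) :: ennreal) \<in> borel_measurable std_gaussian" if "i \<in> I" for i and x :: real
    using A[OF that] by measurable
  have im2: "(\<lambda>x. \<integral>\<^sup>+y. indicator (A i) (x, y) \<partial>std_gaussian :: ennreal) \<in> borel_measurable std_gaussian" if "i \<in> I" for i
    using A[OF that] by measurable
  have "emeasure (distr (G \<Otimes>\<^sub>M G) ?P ?z) (Pi\<^sub>E I A) = (\<integral>\<^sup>+w. indicator (Pi\<^sub>E I A) (?z w) \<partial>(G \<Otimes>\<^sub>M G))"
    using nn_integral_distr[OF m, of "indicator (Pi\<^sub>E I A)"] A fin by simp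
  also have "\<dots> = (\<integral>\<^sup>+w. (\<Prod>i\<in>I. indicator (A i) (fst w i, snd w i)) \<partial>(G \<Otimes>\<^sub>M G))"
    using fin by (intro nn_integral_cong) (auto simp: indicator_def PiE_def Pi_def prod_zero_iff)
  also have "\<dots> = (\<integral>\<^sup>+z. \<integral>\<^sup>+y. (\<Prod>i\<in>I. indicator (A i) (z i, y i)) \<partial>G \<partial>G)"
  proof (subst G.nn_integral_fst[symmetric])
    show "(\<lambda>w. \<Prod>i\<in>I. indicator (A i) (fst w i, snd w i) :: ennreal) \<in> borel_measurable (G \<Otimes>\<^sub>M G)"
      by (intro borel_measurable_prod_ennreal measurable_compose[OF _ borel_measurable_indicator[OF A]] measurable_Pair)
        measurable
  qed simp
  also have "\<dots> = (\<integral>\<^sup>+z. (\<Prod>i\<in>I. \<integral>\<^sup>+y. indicator (A i) (z i, y) \<partial>std_gaussian) \<partial>G)"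
    by (intro nn_integral_cong PiG.product_nn_integral_prod[OF fin]) (use im in auto)
  also have "\<dots> = (\<Prod>i\<in>I. \<integral>\<^sup>+x. \<integral>\<^sup>+y. indicator (A i) (x, y) \<partial>std_gaussian \<partial>std_gaussian)"
    by (intro PiG.product_nn_integral_prod[OF fin] im2)
  also have "\<dots> = (\<Prod>i\<in>I. emeasure (std_gaussian \<Otimes>\<^sub>M std_gaussian) (A i))"
    using A by (intro prod.cong refl) (simp add: std.emeasure_pair_measure)
  finally show "emeasure (distr (G \<Otimes>\<^sub>M G) ?P ?z) (Pi\<^sub>E I A) = (\<Prod>i\<in>I. emeasure (std_gaussian \<Otimes>\<^sub>M std_gaussian) (A i))" .
qed simp

lemma distr_rot:
  assumes cs: "c\<^sup>2 + s\<^sup>2 = 1"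
  shows "distr (G \<Otimes>\<^sub>M G) (G \<Otimes>\<^sub>M G)
    (\<lambda>w. (\<lambda>i\<in>I. c * fst w i - s * snd w i, \<lambda>i\<in>I. s * fst w i + c * snd w i)) = G \<Otimes>\<^sub>M G"
proof -
  let ?Q = "\<Pi>\<^sub>M i\<in>I. std_gaussian \<Otimes>\<^sub>M std_gaussian"
  let ?z = "\<lambda>w. \<lambda>i\<in>I. (fst w i, snd w i)"
  let ?u = "\<lambda>v. (\<lambda>i\<in>I. fst (v i), \<lambda>i\<in>I. snd (v i))"
  let ?r = "compose I (rot2 c s)"
  have z: "?z \<in> G \<Otimes>\<^sub>M G \<rightarrow>\<^sub>M ?Q" by (intro measurable_restrict measurable_Pair) measurable
  have u: "?u \<in> ?Q \<rightarrow>\<^sub>M G \<Otimes>\<^sub>M G" by (intro measurable_restrict measurable_Pair) measurable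
  have r: "?r \<in> ?Q \<rightarrow>\<^sub>M ?Q"
    unfolding compose_def
    by (intro measurable_restrict measurable_compose[OF _ measurable_rot2_std_gaussian] measurable_component_singleton)
  have rQ: "distr ?Q ?Q ?r = ?Q"
    by (subst distr_PiM_finite_prob_space'[OF fin])
      (auto simp: distr_std_gaussian_rot2[OF cs] measurable_rot2_std_gaussian PiG2.prob_space)
  have id: "distr (G \<Otimes>\<^sub>M G) (G \<Otimes>\<^sub>M G) (?u \<circ> ?z) = G \<Otimes>\<^sub>M G"
  proof -
    have "distr (G \<Otimes>\<^sub>M G) (G \<Otimes>\<^sub>M G) (?u \<circ> ?z) = distr (G \<Otimes>\<^sub>M G) (G \<Otimes>\<^sub>M G) (\<lambda>w. w)"
      by (intro distr_cong) (auto simp: space_pair_measure space_PiM PiE_def extensional_def fun_eq_iff restrict_def)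
    then show ?thesis by simp
  qed
  have "distr (G \<Otimes>\<^sub>M G) (G \<Otimes>\<^sub>M G)
    (\<lambda>w. (\<lambda>i\<in>I. c * fst w i - s * snd w i, \<lambda>i\<in>I. s * fst w i + c * snd w i))
     = distr (G \<Otimes>\<^sub>M G) (G \<Otimes>\<^sub>M G) (?u \<circ> (?r \<circ> ?z))"
    by (intro distr_cong) (auto simp: compose_def rot2_def fun_eq_iff restrict_def)
  also have "\<dots> = distr (distr (distr (G \<Otimes>\<^sub>M G) ?Q ?z) ?Q ?r) (G \<Otimes>\<^sub>M G) ?u"
    using z u r by (simp add: distr_distr comp_assoc)
  also have "\<dots> = distr (distr (G \<Otimes>\<^sub>M G) ?Q ?z) (G \<Otimes>\<^sub>M G) ?u"
    unfolding distr_zip rQ ..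
  also have "\<dots> = G \<Otimes>\<^sub>M G"
    using z u id by (simp add: distr_distr)
  finally show ?thesis .
qed

end

section \<open>The Ornstein-Uhlenbeck semigroup\<close>

context gaussian_vector
begin

text \<open>The points of \<open>space G\<close> are extensional, but linear combinations such as \<open>\<lambda>i. g i + a * y i\<close> need not be;
  functions that ignore the coordinates outside \<open>I\<close> can be evaluated on them directly.\<close>

definition obs :: "(('i \<Rightarrow> real) \<Rightarrow> real) \<Rightarrow> bool" where
  "obs f \<longleftrightarrow> f \<in> borel_measurable (\<Pi>\<^sub>M i\<in>I. borel) \<and> (\<forall>g. f (restrict g I) = f g)"

definition bobs :: "(('i \<Rightarrow> real) \<Rightarrow> real) \<Rightarrow> bool" where
  "bobs f \<longleftrightarrow> obs f \<and> (\<exists>B. \<forall>g. \<bar>f g\<bar> \<le> B)"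

lemma bobs_obs: "bobs f \<Longrightarrow> obs f"
  by (simp add: bobs_def)

lemma bobs_bound: assumes "bobs f" obtains B where "B \<ge> 0" "\<And>g. \<bar>f g\<bar> \<le> B"
  using assms unfolding bobs_def by (meson abs_ge_zero order_trans)

lemma obs_comp:
  assumes f: "obs f" and U: "\<And>i. i \<in> I \<Longrightarrow> (\<lambda>w. U w i) \<in> borel_measurable M"
  shows "(\<lambda>w. f (U w)) \<in> borel_measurable M"
proof -
  have "(\<lambda>w. f (\<lambda>i\<in>I. U w i)) \<in> borel_measurable M"
    using f U by (intro measurable_compose[OF measurable_restrict[where M = "\<lambda>_. borel"]]) (auto simp: obs_def)
  then show ?thesis using f by (simp add: obs_def)
qed

lemma obs_cong:
  assumes "obs f" "\<And>i. i \<in> I \<Longrightarrow> g i = h i"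
  shows "f g = f h"
proof -
  have "restrict g I = restrict h I" using assms(2) by (auto simp: restrict_def)
  then show ?thesis using assms(1) unfolding obs_def by metis
qed

lemma component_measurable:
  "i \<in> I \<Longrightarrow> (\<lambda>z. z i) \<in> borel_measurable G"
  "i \<in> I \<Longrightarrow> (\<lambda>w. fst w i) \<in> borel_measurable (G \<Otimes>\<^sub>M N)"
  "i \<in> I \<Longrightarrow> (\<lambda>w. snd w i) \<in> borel_measurable (N \<Otimes>\<^sub>M G)"
  by measurable

lemma obs_measurable: "obs f \<Longrightarrow> f \<in> borel_measurable G"
  by (rule obs_comp[where U = "\<lambda>w. w"]) (auto intro: component_measurable)

lemma bobs_integrable:
  assumes "prob_space M" "bobs f" "\<And>i. i \<in> I \<Longrightarrow> (\<lambda>w. U w i) \<in> borel_measurable M"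
  shows "integrable M (\<lambda>w. f (U w))"
proof -
  interpret prob_space M by fact
  obtain B where B: "\<And>g. \<bar>f g\<bar> \<le> B" using assms(2) bobs_bound by blast
  show ?thesis
    by (rule integrable_const_bound[of _ B]) (use B obs_comp[OF bobs_obs[OF assms(2)] assms(3)] in auto)
qed

lemma bobs_integrable_G: "bobs f \<Longrightarrow> integrable G f"
  using bobs_integrable[OF G.prob_space_axioms, of f "\<lambda>w. w"] component_measurable by blast

lemma bobs_integrable_shift: "bobs f \<Longrightarrow> integrable G (\<lambda>y. f (\<lambda>i. u i + e * y i))"
  by (rule bobs_integrable[OF G.prob_space_axioms])
    (auto intro!: borel_measurable_add borel_measurable_times component_measurable)

text \<open>The hypothesis \<open>inv\<close> allows the rotated vectors to appear without their
  restriction to \<open>I\<close>, so that later rotations are plain algebra on linear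
  combinations.\<close>

lemma integral_rot:
  fixes \<Phi> :: "('i \<Rightarrow> real) \<Rightarrow> ('i \<Rightarrow> real) \<Rightarrow> real"
  assumes cs: "c\<^sup>2 + s\<^sup>2 = 1"
    and m: "(\<lambda>w. \<Phi> (fst w) (snd w)) \<in> borel_measurable (G \<Otimes>\<^sub>M G)"
    and inv: "\<And>z y. \<Phi> (restrict z I) (restrict y I) = \<Phi> z y"
  shows "(\<integral>w. \<Phi> (\<lambda>i. c * fst w i - s * snd w i) (\<lambda>i. s * fst w i + c * snd w i) \<partial>(G \<Otimes>\<^sub>M G))
    = (\<integral>w. \<Phi> (fst w) (snd w) \<partial>(G \<Otimes>\<^sub>M G))" (is "?L = ?R")
proof -
  let ?r = "\<lambda>w. (\<lambda>i\<in>I. c * fst w i - s * snd w i, \<lambda>i\<in>I. s * fst w i + c * snd w i)"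
  have r: "?r \<in> G \<Otimes>\<^sub>M G \<rightarrow>\<^sub>M G \<Otimes>\<^sub>M G"
    by (intro measurable_Pair measurable_restrict) measurable
  have "?R = (\<integral>w. \<Phi> (fst w) (snd w) \<partial>distr (G \<Otimes>\<^sub>M G) (G \<Otimes>\<^sub>M G) ?r)"
    by (simp add: distr_rot[OF cs])
  also have "\<dots> = (\<integral>w. \<Phi> (fst (?r w)) (snd (?r w)) \<partial>(G \<Otimes>\<^sub>M G))"
    by (subst integral_distr[OF r]) (use m in auto)
  also have "\<dots> = ?L" using inv by simp
  finally show ?thesis ..
qed

lemma integral_fst_only:
  fixes f :: "('i \<Rightarrow> real) \<Rightarrow> real"
  assumes "integrable G f"
  shows "(\<integral>w. f (fst w) \<partial>(G \<Otimes>\<^sub>M G)) = integral\<^sup>L G f" "integrable (G \<Otimes>\<^sub>M G) (\<lambda>w. f (fst w))"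
proof -
  have [measurable]: "f \<in> borel_measurable G" using assms by auto
  have d: "distr (G \<Otimes>\<^sub>M G) G fst = G"
    by (rule G.distr_pair_fst)
  show "(\<integral>w. f (fst w) \<partial>(G \<Otimes>\<^sub>M G)) = integral\<^sup>L G f"
    using integral_distr[of fst "G \<Otimes>\<^sub>M G" G f] d by simp
  show "integrable (G \<Otimes>\<^sub>M G) (\<lambda>w. f (fst w))"
    using integrable_distr_eq[of fst "G \<Otimes>\<^sub>M G" G f] d assms by simp
qed

text \<open>Gaussian convolution with standard deviation \<open>a\<close>. It is kept apart from the
  scaling in \<open>T\<close> because successive convolutions simply add variances.\<close>

definition S :: "real \<Rightarrow> (('i \<Rightarrow> real) \<Rightarrow> real) \<Rightarrow> ('i \<Rightarrow> real) \<Rightarrow> real" where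
  "S a f g = (\<integral>y. f (\<lambda>i. g i + a * y i) \<partial>G)"

definition T :: "real \<Rightarrow> (('i \<Rightarrow> real) \<Rightarrow> real) \<Rightarrow> ('i \<Rightarrow> real) \<Rightarrow> real" where
  "T k f g = S (sqrt (1 - k\<^sup>2)) f (\<lambda>i. k * g i)"

lemma bobs_S: assumes f: "bobs f" shows "bobs (S a f)"
proof -
  obtain B where B: "\<And>g. \<bar>f g\<bar> \<le> B" using f bobs_bound by blast
  have ff: "obs f" using f bobs_obs by auto
  have "(\<lambda>w. f (\<lambda>i. fst w i + a * snd w i)) \<in> borel_measurable ((\<Pi>\<^sub>M i\<in>I. borel) \<Otimes>\<^sub>M G)"
    by (rule obs_comp[OF ff]) measurable
  then have "S a f \<in> borel_measurable (\<Pi>\<^sub>M i\<in>I. borel)"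
    unfolding S_def by (intro G.borel_measurable_lebesgue_integral) (simp add: case_prod_beta')
  moreover have "S a f (restrict g I) = S a f g" for g
    unfolding S_def by (intro Bochner_Integration.integral_cong obs_cong[OF ff]) auto
  moreover have "\<bar>S a f g\<bar> \<le> B" for g
  proof -
    have "norm (S a f g) \<le> (\<integral>y. norm (f (\<lambda>i. g i + a * y i)) \<partial>G)" unfolding S_def by simp
    also have "\<dots> \<le> (\<integral>y. B \<partial>G)"
      using B by (intro integral_mono integrable_norm bobs_integrable[OF G.prob_space_axioms f])
        (auto intro!: borel_measurable_add borel_measurable_times component_measurable)
    finally show ?thesis by (simp add: G.prob_space)
  qed
  ultimately show ?thesis unfolding bobs_def obs_def by blast
qed

lemma bobs_scale: assumes f: "bobs f" shows "bobs (\<lambda>g. f (\<lambda>i. k * g i))"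
proof -
  have "(\<lambda>g. f (\<lambda>i. k * g i)) \<in> borel_measurable (\<Pi>\<^sub>M i\<in>I. borel)"
    by (rule obs_comp[OF bobs_obs[OF f]]) measurable
  moreover have "f (\<lambda>i. k * restrict g I i) = f (\<lambda>i. k * g i)" for g
    by (rule obs_cong[OF bobs_obs[OF f]]) simp
  ultimately show ?thesis using f unfolding bobs_def obs_def by auto
qed

lemma bobs_T: "bobs f \<Longrightarrow> bobs (T k f)"
  unfolding T_def[abs_def] by (intro bobs_scale bobs_S)

lemma bobs_mult: assumes "bobs f" "bobs h" shows "bobs (\<lambda>g. f g * h g)"
proof -
  obtain B where B: "\<And>g. \<bar>f g\<bar> \<le> B" "B \<ge> 0" using assms(1) bobs_bound by blast
  obtain C where C: "\<And>g. \<bar>h g\<bar> \<le> C" using assms(2) bobs_bound by blast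
  have "\<bar>f g * h g\<bar> \<le> B * C" for g
    unfolding abs_mult using B C by (intro mult_mono) auto
  then show ?thesis using assms unfolding bobs_def obs_def by auto
qed

text \<open>The rotation with cosine \<open>a / r\<close> and sine \<open>- b / r\<close> exhibits
  \<open>a * z + b * y\<close> as \<open>r\<close> times its first coordinate, which is again a
  standard Gaussian vector. The case \<open>r = 0\<close> is separate because of the
  division.\<close>

lemma S_S:
  assumes f: "bobs f"
  shows "S a (S b f) g = S (sqrt (a\<^sup>2 + b\<^sup>2)) f g"
proof (cases "a = 0 \<and> b = 0")
  case True
  then show ?thesis by (simp add: S_def G.prob_space)
next
  case False
  define r where "r = sqrt (a\<^sup>2 + b\<^sup>2)"
  have r: "r\<^sup>2 = a\<^sup>2 + b\<^sup>2" "r \<noteq> 0"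
    using False by (auto simp: r_def sum_power2_eq_zero_iff)
  have "(a\<^sup>2 + b\<^sup>2) / r\<^sup>2 = 1" using r(2) by (simp only: r(1)[symmetric]) simp
  then have cs: "(a / r)\<^sup>2 + (- b / r)\<^sup>2 = 1"
    by (simp only: power_divide add_divide_distrib power2_minus)
  let ?\<Phi> = "\<lambda>z (y :: 'i \<Rightarrow> real). f (\<lambda>i. g i + r * z i)"
  have "S a (S b f) g = (\<integral>z. \<integral>y. f (\<lambda>i. g i + a * z i + b * y i) \<partial>G \<partial>G)"
    by (simp add: S_def)
  also have "\<dots> = (\<integral>w. f (\<lambda>i. g i + a * fst w i + b * snd w i) \<partial>(G \<Otimes>\<^sub>M G))"
    by (subst GG.integral_fst'[symmetric]) (auto intro!: bobs_integrable[OF GG.prob_space_axioms f])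
  also have "\<dots> = (\<integral>w. ?\<Phi> (\<lambda>i. a / r * fst w i - (- b / r) * snd w i) (\<lambda>i. (- b / r) * fst w i + a / r * snd w i) \<partial>(G \<Otimes>\<^sub>M G))"
    using r by (simp add: algebra_simps)
  also have "\<dots> = (\<integral>w. ?\<Phi> (fst w) (snd w) \<partial>(G \<Otimes>\<^sub>M G))"
    by (rule integral_rot[OF cs])
      (auto intro!: obs_comp[OF bobs_obs[OF f]] obs_cong[OF bobs_obs[OF f]])
  also have "\<dots> = S r f g"
    unfolding S_def
    by (rule integral_fst_only(1)) (auto intro!: bobs_integrable[OF G.prob_space_axioms f]
        borel_measurable_add borel_measurable_times component_measurable)
  finally show ?thesis by (simp add: r_def)
qed

text \<open>The rotation with cosine \<open>k\<close> turns \<open>k * z + s * y\<close> into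
  \<open>z\<close> and \<open>L z\<close> into \<open>k * L z - s * L y\<close>. The second term is
  independent of \<open>f z\<close> and has mean zero, so only the factor \<open>k\<close>
  remains.\<close>

lemma integral_linear_T:
  assumes f: "bobs f" and L: "obs L" "integrable G L" "(\<integral>g. L g \<partial>G) = 0"
    and lin: "\<And>a b u v. L (\<lambda>i. a * u i + b * v i) = a * L u + b * L v"
    and k: "0 \<le> k" "k \<le> 1"
  shows "(\<integral>g. L g * T k f g \<partial>G) = k * (\<integral>g. L g * f g \<partial>G)"
proof -
  define s where "s = sqrt (1 - k\<^sup>2)"
  have cs: "k\<^sup>2 + s\<^sup>2 = 1" using k by (simp add: s_def power_le_one)
  obtain B where B: "\<And>g. \<bar>f g\<bar> \<le> B" "B \<ge> 0" using f bobs_bound by blast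
  note fo = bobs_obs[OF f]
  note [measurable] = obs_measurable[OF fo] obs_measurable[OF L(1)]
  have fm: "(\<lambda>w. f (\<lambda>i. k * fst w i + s * snd w i)) \<in> borel_measurable (G \<Otimes>\<^sub>M G)"
    by (rule obs_comp[OF fo]) measurable
  have Lm: "(\<lambda>w. L (fst w)) \<in> borel_measurable (G \<Otimes>\<^sub>M G)"
    by (rule obs_comp[OF L(1)]) measurable
  have lin': "L (\<lambda>i. a * u i - b * v i) = a * L u - b * L v" for a b u v
    using lin[of a u "-b" v] by simp
  have i1: "integrable (G \<Otimes>\<^sub>M G) (\<lambda>w. L (fst w) * f (\<lambda>i. k * fst w i + s * snd w i))"
  proof (rule Bochner_Integration.integrable_bound)
    show "integrable (G \<Otimes>\<^sub>M G) (\<lambda>w. B * L (fst w))"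
      using integral_fst_only(2)[OF L(2)] by simp
    show "AE w in G \<Otimes>\<^sub>M G. norm (L (fst w) * f (\<lambda>i. k * fst w i + s * snd w i)) \<le> norm (B * L (fst w))"
      using B by (intro AE_I2) (auto simp: abs_mult mult.commute[of B] intro!: mult_left_mono)
  qed (use fm Lm in measurable)
  have Lf: "integrable G (\<lambda>u. L u * f u)"
  proof (rule Bochner_Integration.integrable_bound)
    show "integrable G (\<lambda>w. B * L w)" using L(2) by simp
    show "AE w in G. norm (L w * f w) \<le> norm (B * L w)"
      using B by (intro AE_I2) (auto simp: abs_mult mult.commute[of B] intro!: mult_left_mono)
  qed (use fo L(1) in measurable)
  have i2: "integrable (G \<Otimes>\<^sub>M G) (\<lambda>w. f (fst w) * L (snd w))"
  proof (rule GG.Fubini_integrable)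
    show "(\<lambda>w. f (fst w) * L (snd w)) \<in> borel_measurable (G \<Otimes>\<^sub>M G)"
      by (intro borel_measurable_times obs_comp[OF fo] obs_comp[OF L(1)]) measurable
  qed (use L(2) fo bobs_integrable_G[OF f] in \<open>auto simp: abs_mult\<close>)
  have i3: "integrable (G \<Otimes>\<^sub>M G) (\<lambda>w. L (fst w) * f (fst w))"
    using integral_fst_only(2)[OF Lf] .
  let ?\<Phi> = "\<lambda>z y. L z * f (\<lambda>i. k * z i + s * y i)"
  have "(\<integral>g. L g * T k f g \<partial>G) = (\<integral>g. \<integral>y. L g * f (\<lambda>i. k * g i + s * y i) \<partial>G \<partial>G)"
    by (simp add: T_def S_def s_def)
  also have "\<dots> = (\<integral>w. ?\<Phi> (fst w) (snd w) \<partial>(G \<Otimes>\<^sub>M G))"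
    using i1 by (subst GG.integral_fst'[symmetric]) auto
  also have "\<dots> = (\<integral>w. ?\<Phi> (\<lambda>i. k * fst w i - s * snd w i) (\<lambda>i. s * fst w i + k * snd w i) \<partial>(G \<Otimes>\<^sub>M G))"
  proof (rule integral_rot[OF cs, symmetric])
    show "(\<lambda>w. ?\<Phi> (fst w) (snd w)) \<in> borel_measurable (G \<Otimes>\<^sub>M G)" using fm Lm by measurable
    show "?\<Phi> (restrict z I) (restrict y I) = ?\<Phi> z y" for z y
      by (intro arg_cong2[where f = "(*)"] obs_cong[OF L(1)] obs_cong[OF fo]) auto
  qed
  also have "\<dots> = (\<integral>w. k * (L (fst w) * f (fst w)) - s * (f (fst w) * L (snd w)) \<partial>(G \<Otimes>\<^sub>M G))"
  proof (intro Bochner_Integration.integral_cong refl)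
    fix w :: "('i \<Rightarrow> real) \<times> ('i \<Rightarrow> real)"
    have "k * (k * fst w i - s * snd w i) + s * (s * fst w i + k * snd w i) = (k\<^sup>2 + s\<^sup>2) * fst w i" for i by algebra
    then show "?\<Phi> (\<lambda>i. k * fst w i - s * snd w i) (\<lambda>i. s * fst w i + k * snd w i)
      = k * (L (fst w) * f (fst w)) - s * (f (fst w) * L (snd w))"
      using cs by (simp add: lin' algebra_simps)
  qed
  also have "\<dots> = k * (\<integral>w. L (fst w) * f (fst w) \<partial>(G \<Otimes>\<^sub>M G)) - s * (\<integral>w. f (fst w) * L (snd w) \<partial>(G \<Otimes>\<^sub>M G))"
    using i2 i3 by simp
  also have "(\<integral>w. L (fst w) * f (fst w) \<partial>(G \<Otimes>\<^sub>M G)) = (\<integral>g. L g * f g \<partial>G)"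
    using integral_fst_only(1)[OF Lf] .
  also have "(\<integral>w. f (fst w) * L (snd w) \<partial>(G \<Otimes>\<^sub>M G)) = 0"
    using L(3) i2 by (subst GG.integral_fst'[symmetric]) auto
  finally show ?thesis by simp
qed

text \<open>Self-adjointness and the semigroup law at once. The rotation with cosine
  \<open>k\<close> turns the argument of \<open>f\<close> into \<open>z\<close> and the argument of
  \<open>T k h\<close> into \<open>k * z - s * y\<close>; integrating out \<open>y\<close> adds
  variance \<open>(k * s)\<^sup>2\<close> to the \<open>s\<^sup>2\<close> already in
  \<open>T k h\<close>, and the total is \<open>1 - k ^ 4\<close>.\<close>

lemma integral_T_T:
  assumes f: "bobs f" and h: "bobs h" and k: "0 \<le> k" "k \<le> 1"
  shows "(\<integral>g. T k f g * T k h g \<partial>G) = (\<integral>g. f g * T (k\<^sup>2) h g \<partial>G)"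
proof -
  define s where "s = sqrt (1 - k\<^sup>2)"
  have cs: "k\<^sup>2 + s\<^sup>2 = 1" using k by (simp add: s_def power_le_one)
  let ?\<Phi> = "\<lambda>z y. f (\<lambda>i. k * z i + s * y i) * T k h z"
  have Th: "bobs (T k h)" using h by (rule bobs_T)
  note fo = bobs_obs[OF f] and ho = bobs_obs[OF Th] and So = bobs_S[OF h, of s]
  obtain B where B: "\<And>g. \<bar>f g\<bar> \<le> B" "B \<ge> 0" using f bobs_bound by blast
  obtain C where C: "\<And>g. \<bar>T k h g\<bar> \<le> C" using Th bobs_bound by blast
  obtain D where D: "\<And>g. \<bar>S s h g\<bar> \<le> D" using So bobs_bound by blast
  have m: "(\<lambda>w. ?\<Phi> (fst w) (snd w)) \<in> borel_measurable (G \<Otimes>\<^sub>M G)"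
    by (intro borel_measurable_times obs_comp[OF fo] obs_comp[OF ho]) measurable
  have i1: "integrable (G \<Otimes>\<^sub>M G) (\<lambda>w. ?\<Phi> (fst w) (snd w))"
    by (rule GG.integrable_const_bound[of _ "B * C"]) (use B C m in \<open>auto simp: abs_mult intro!: mult_mono\<close>)
  have "(\<integral>g. T k f g * T k h g \<partial>G) = (\<integral>g. \<integral>y. ?\<Phi> g y \<partial>G \<partial>G)"
    by (simp add: T_def[of k f] S_def s_def)
  also have "\<dots> = (\<integral>w. ?\<Phi> (fst w) (snd w) \<partial>(G \<Otimes>\<^sub>M G))"
    using i1 by (subst GG.integral_fst'[symmetric]) auto
  also have "\<dots> = (\<integral>w. ?\<Phi> (\<lambda>i. k * fst w i - s * snd w i) (\<lambda>i. s * fst w i + k * snd w i) \<partial>(G \<Otimes>\<^sub>M G))"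
  proof (rule integral_rot[OF cs, symmetric])
    show "?\<Phi> (restrict z I) (restrict y I) = ?\<Phi> z y" for z y
      by (intro arg_cong2[where f = "(*)"] obs_cong[OF ho] obs_cong[OF fo]) auto
  qed (rule m)
  also have "\<dots> = (\<integral>w. f (fst w) * S s h (\<lambda>i. k\<^sup>2 * fst w i + (- k * s) * snd w i) \<partial>(G \<Otimes>\<^sub>M G))"
  proof (intro Bochner_Integration.integral_cong refl)
    fix w :: "('i \<Rightarrow> real) \<times> ('i \<Rightarrow> real)"
    have *: "k * (k * fst w i - s * snd w i) + s * (s * fst w i + k * snd w i) = (k\<^sup>2 + s\<^sup>2) * fst w i" for i by algebra
    have "k * (k * fst w i - s * snd w i) = k\<^sup>2 * fst w i + (- k * s) * snd w i" for i by algebra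
    then show "?\<Phi> (\<lambda>i. k * fst w i - s * snd w i) (\<lambda>i. s * fst w i + k * snd w i)
      = f (fst w) * S s h (\<lambda>i. k\<^sup>2 * fst w i + (- k * s) * snd w i)"
      using * cs by (simp add: T_def s_def[symmetric])
  qed
  also have "\<dots> = (\<integral>g. \<integral>y. f g * S s h (\<lambda>i. k\<^sup>2 * g i + (- k * s) * y i) \<partial>G \<partial>G)"
  proof (subst GG.integral_fst'[symmetric])
    have "(\<lambda>w. f (fst w) * S s h (\<lambda>i. k\<^sup>2 * fst w i + (- k * s) * snd w i)) \<in> borel_measurable (G \<Otimes>\<^sub>M G)"
      by (intro borel_measurable_times obs_comp[OF fo] obs_comp[OF bobs_obs[OF So]]) measurable
    then show "integrable (G \<Otimes>\<^sub>M G) (\<lambda>w. f (fst w) * S s h (\<lambda>i. k\<^sup>2 * fst w i + (- k * s) * snd w i))"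
      by (intro GG.integrable_const_bound[of _ "B * D"]) (use B D in \<open>auto simp: abs_mult intro!: mult_mono\<close>)
  qed simp
  also have "\<dots> = (\<integral>g. f g * S (- k * s) (S s h) (\<lambda>i. k\<^sup>2 * g i) \<partial>G)"
    unfolding S_def[of "- k * s"] by simp
  also have "\<dots> = (\<integral>g. f g * T (k\<^sup>2) h g \<partial>G)"
  proof -
    have "(- k * s)\<^sup>2 + s\<^sup>2 = 1 - (k\<^sup>2)\<^sup>2" using cs by algebra
    then show ?thesis by (simp only: S_S[OF h] T_def)
  qed
  finally show ?thesis .
qed

text \<open>Cauchy-Schwarz in the additive form with a free \<theta>, which can be summed over
  coordinates before optimising; \<open>integral_T_T\<close> identifies the squared norm of
  \<open>T k f\<close>.\<close>

lemma corr_le_sq: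
  assumes f: "bobs f" and k: "0 \<le> k" "k \<le> 1" and \<theta>: "\<theta> > 0"
  shows "(\<integral>g. f g * T k f g \<partial>G) \<le> (\<theta> * (\<integral>g. (f g)\<^sup>2 \<partial>G) + (\<integral>g. f g * T (k\<^sup>2) f g \<partial>G) / \<theta>) / 2"
proof -
  have Tf: "bobs (T k f)" using f by (rule bobs_T)
  note i = bobs_integrable_G[OF bobs_mult[OF f f]] bobs_integrable_G[OF bobs_mult[OF Tf Tf]] bobs_integrable_G[OF bobs_mult[OF f Tf]]
  have "(\<integral>g. f g * T k f g \<partial>G) \<le> (\<integral>g. (\<theta> * (f g * f g) + (T k f g * T k f g) / \<theta>) / 2 \<partial>G)"
  proof (intro integral_mono)
    fix g
    have "0 \<le> (\<theta> * f g - T k f g)\<^sup>2 / \<theta>" using \<theta> by simp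
    also have "\<dots> = \<theta> * (f g * f g) + T k f g * T k f g / \<theta> - 2 * (f g * T k f g)"
      using \<theta> by (simp add: power2_eq_square field_simps)
    finally show "f g * T k f g \<le> (\<theta> * (f g * f g) + (T k f g * T k f g) / \<theta>) / 2" by simp
  qed (use i in auto)
  also have "\<dots> = (\<theta> * (\<integral>g. f g * f g \<partial>G) + (\<integral>g. T k f g * T k f g \<partial>G) / \<theta>) / 2"
    using i by simp
  finally show ?thesis by (simp only: integral_T_T[OF f f k] power2_eq_square)
qed

sublocale GGG: pair_prob_space G "G \<Otimes>\<^sub>M G" ..

text \<open>Two replicas see disorders with a common part and private parts. At correlation
  \<open>r + e\<close> the noise of variance \<open>e\<close> is common, at correlation
  \<open>r\<close> it is private; the remaining variables \<open>z\<close> (common) and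
  \<open>w\<close> (private) are the same in both formulas. Raising the correlation can thus be
  studied pointwise in \<open>z\<close> and \<open>w\<close>.\<close>

lemma integral_T_split:
  assumes f: "bobs f" and h: "bobs h" and r: "0 \<le> r" and e: "0 \<le> e" and re: "r + e \<le> 1"
    and s: "s = sqrt (1 - r - e)"
  shows "(\<integral>g. T (sqrt (r + e)) f g * T (sqrt (r + e)) h g \<partial>G) =
    (\<integral>z. \<integral>w. \<integral>y. f (\<lambda>i. sqrt r * z i + s * fst w i + sqrt e * y i) *
       h (\<lambda>i. sqrt r * z i + s * snd w i + sqrt e * y i) \<partial>G \<partial>(G \<Otimes>\<^sub>M G) \<partial>G)" (is "_ = ?R1")
   and "(\<integral>g. T (sqrt r) f g * T (sqrt r) h g \<partial>G) =
    (\<integral>z. \<integral>w. S (sqrt e) f (\<lambda>i. sqrt r * z i + s * fst w i) *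
       S (sqrt e) h (\<lambda>i. sqrt r * z i + s * snd w i) \<partial>(G \<Otimes>\<^sub>M G) \<partial>G)" (is "_ = ?R2")
proof -
  have prodS: "S s a u * S s b v = (\<integral>w. a (\<lambda>i. u i + s * fst w i) * b (\<lambda>i. v i + s * snd w i) \<partial>(G \<Otimes>\<^sub>M G))"
    if a: "bobs a" and b: "bobs b" for a b u v
  proof -
    obtain A where A: "\<And>g. \<bar>a g\<bar> \<le> A" "A \<ge> 0" using a bobs_bound by blast
    obtain B where B: "\<And>g. \<bar>b g\<bar> \<le> B" "B \<ge> 0" using b bobs_bound by blast
    have "(\<lambda>w. a (\<lambda>i. u i + s * fst w i) * b (\<lambda>i. v i + s * snd w i)) \<in> borel_measurable (G \<Otimes>\<^sub>M G)"
      by (intro borel_measurable_times obs_comp[OF bobs_obs[OF a]] obs_comp[OF bobs_obs[OF b]]) measurable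
    then have "integrable (G \<Otimes>\<^sub>M G) (\<lambda>w. a (\<lambda>i. u i + s * fst w i) * b (\<lambda>i. v i + s * snd w i))"
      by (intro GG.integrable_const_bound[of _ "A * B"]) (use A B in \<open>auto simp: abs_mult intro!: mult_mono\<close>)
    then show ?thesis by (subst GG.integral_fst'[symmetric]) (auto simp: S_def)
  qed
  have Sf: "bobs (S s f)" "bobs (S s h)" using f h by (auto intro: bobs_S)
  have Sef: "bobs (S (sqrt e) f)" "bobs (S (sqrt e) h)" using f h by (auto intro: bobs_S)
  let ?Q = "\<lambda>g. S s f g * S s h g"
  have Q: "bobs ?Q" using Sf by (rule bobs_mult)
  have "(\<integral>g. T (sqrt (r + e)) f g * T (sqrt (r + e)) h g \<partial>G) = (\<integral>g. ?Q (\<lambda>i. sqrt (r + e) * g i) \<partial>G)"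
    using r e re by (simp add: T_def s diff_diff_eq)
  also have "\<dots> = S (sqrt (r + e)) ?Q (\<lambda>_. 0)" by (simp add: S_def[of _ ?Q])
  also have "\<dots> = S (sqrt r) (S (sqrt e) ?Q) (\<lambda>_. 0)"
    using S_S[OF Q, of "sqrt r" "sqrt e"] r e by simp
  also have "\<dots> = (\<integral>z. \<integral>y. ?Q (\<lambda>i. sqrt r * z i + sqrt e * y i) \<partial>G \<partial>G)"
    by (simp add: S_def[of _ ?Q] S_def[of _ "S _ ?Q"])
  also have "\<dots> = ?R1"
  proof (rule Bochner_Integration.integral_cong[OF refl])
    fix z
    obtain A where A: "\<And>g. \<bar>f g\<bar> \<le> A" "A \<ge> 0" using f bobs_bound by blast
    obtain B where B: "\<And>g. \<bar>h g\<bar> \<le> B" "B \<ge> 0" using h bobs_bound by blast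
    let ?F = "\<lambda>y w. f (\<lambda>i. sqrt r * z i + s * fst w i + sqrt e * y i) * h (\<lambda>i. sqrt r * z i + s * snd w i + sqrt e * y i)"
    have "(\<lambda>v. ?F (fst v) (snd v)) \<in> borel_measurable (G \<Otimes>\<^sub>M (G \<Otimes>\<^sub>M G))"
      by (intro borel_measurable_times obs_comp[OF bobs_obs[OF f]] obs_comp[OF bobs_obs[OF h]]) measurable
    then have int: "integrable (G \<Otimes>\<^sub>M (G \<Otimes>\<^sub>M G)) (\<lambda>v. ?F (fst v) (snd v))"
      by (intro GGG.integrable_const_bound[of _ "A * B"]) (use A B in \<open>auto simp: abs_mult intro!: mult_mono\<close>)
    have "(\<integral>y. ?Q (\<lambda>i. sqrt r * z i + sqrt e * y i) \<partial>G) = (\<integral>y. \<integral>w. ?F y w \<partial>(G \<Otimes>\<^sub>M G) \<partial>G)"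
      by (subst prodS[OF f h]) (simp add: add_ac)
    also have "\<dots> = (\<integral>w. \<integral>y. ?F y w \<partial>G \<partial>(G \<Otimes>\<^sub>M G))"
      using int by (subst GGG.Fubini_integral) (auto simp: case_prod_beta')
    finally show "(\<integral>y. ?Q (\<lambda>i. sqrt r * z i + sqrt e * y i) \<partial>G) = (\<integral>w. \<integral>y. ?F y w \<partial>G \<partial>(G \<Otimes>\<^sub>M G))" .
  qed
  finally show "(\<integral>g. T (sqrt (r + e)) f g * T (sqrt (r + e)) h g \<partial>G) = ?R1" .
  have "T (sqrt r) a z = S s (S (sqrt e) a) (\<lambda>i. sqrt r * z i)" if "bobs a" for a z
    using S_S[OF that, of s "sqrt e"] r e re by (simp add: T_def s)
  then have "(\<integral>g. T (sqrt r) f g * T (sqrt r) h g \<partial>G) =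
     (\<integral>z. S s (S (sqrt e) f) (\<lambda>i. sqrt r * z i) * S s (S (sqrt e) h) (\<lambda>i. sqrt r * z i) \<partial>G)"
    using f h by simp
  also have "\<dots> = ?R2" by (intro Bochner_Integration.integral_cong refl prodS[OF Sef])
  finally show "(\<integral>g. T (sqrt r) f g * T (sqrt r) h g \<partial>G) = ?R2" .
qed

end

section \<open>Gaussian moments\<close>

lemma integral_std_gaussian:
  fixes f :: "real \<Rightarrow> real"
  assumes [measurable]: "f \<in> borel_measurable borel"
  shows "integrable std_gaussian f \<longleftrightarrow> integrable lborel (\<lambda>x. std_normal_density x * f x)"
    and "integral\<^sup>L std_gaussian f = (\<integral>x. std_normal_density x * f x \<partial>lborel)"
  by (simp_all add: integrable_real_density integral_real_density)

lemma std_gaussian_mgf: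
  "integrable std_gaussian (\<lambda>x. exp (a * x))" "(\<integral>x. exp (a * x) \<partial>std_gaussian) = exp (a\<^sup>2 / 2)"
proof -
  have "std_normal_density x * exp (a * x) = exp (a\<^sup>2 / 2) * normal_density a 1 x" for x
  proof -
    have "- x\<^sup>2 / 2 + a * x = a\<^sup>2 / 2 + - (x - a)\<^sup>2 / 2" by (simp add: power2_eq_square field_simps)
    then have "exp (- x\<^sup>2 / 2) * exp (a * x) = exp (a\<^sup>2 / 2) * exp (- (x - a)\<^sup>2 / 2)"
      by (metis exp_add)
    then show ?thesis by (simp add: normal_density_def)
  qed
  then show "integrable std_gaussian (\<lambda>x. exp (a * x))" "(\<integral>x. exp (a * x) \<partial>std_gaussian) = exp (a\<^sup>2 / 2)"
    by (simp_all add: integral_std_gaussian)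
qed

lemma std_gaussian_exp_sq:
  "integrable std_gaussian (\<lambda>x. exp (x\<^sup>2 / 4))" "(\<integral>x. exp (x\<^sup>2 / 4) \<partial>std_gaussian) = sqrt 2"
proof -
  have "std_normal_density x * exp (x\<^sup>2 / 4) = sqrt 2 * normal_density 0 (sqrt 2) x" for x
  proof -
    have "- x\<^sup>2 / 2 + x\<^sup>2 / 4 = - x\<^sup>2 / 4" by simp
    then have "exp (- x\<^sup>2 / 2) * exp (x\<^sup>2 / 4) = exp (- x\<^sup>2 / 4)"
      by (metis exp_add)
    moreover have "1 / sqrt (2 * pi) = sqrt 2 * (1 / sqrt (2 * pi * (sqrt 2)\<^sup>2))"
      by (simp add: real_sqrt_mult field_simps)
    ultimately show ?thesis by (simp add: normal_density_def)
  qed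
  then show "integrable std_gaussian (\<lambda>x. exp (x\<^sup>2 / 4))" "(\<integral>x. exp (x\<^sup>2 / 4) \<partial>std_gaussian) = sqrt 2"
    by (simp_all add: integral_std_gaussian)
qed

lemma std_gaussian_moments:
  "integrable std_gaussian (\<lambda>x. x)" "(\<integral>x. x \<partial>std_gaussian) = 0"
  "integrable std_gaussian (\<lambda>x. x * x)" "(\<integral>x. x * x \<partial>std_gaussian) = 1"
proof -
  show "integrable std_gaussian (\<lambda>x. x)" "(\<integral>x. x \<partial>std_gaussian) = 0"
    using integrable_std_normal_moment[of 1] integral_std_normal_moment_odd[of 0]
    by (simp_all add: integral_std_gaussian)
  show "integrable std_gaussian (\<lambda>x. x * x)" "(\<integral>x. x * x \<partial>std_gaussian) = 1"
    using integrable_std_normal_moment[of 2] integral_std_normal_moment_even[of 1]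
    by (simp_all add: integral_std_gaussian power2_eq_square)
qed

lemma std_gaussian_exp_abs: "integrable std_gaussian (\<lambda>x. exp \<bar>x\<bar>)"
proof (rule Bochner_Integration.integrable_bound)
  show "integrable std_gaussian (\<lambda>x. exp (1 * x) + exp ((-1) * x))"
    by (intro Bochner_Integration.integrable_add std_gaussian_mgf)
  show "AE x in std_gaussian. norm (exp \<bar>x\<bar>) \<le> norm (exp (1 * x) + exp ((-1) * x :: real))"
  proof (rule AE_I2)
    fix x :: real
    show "norm (exp \<bar>x\<bar>) \<le> norm (exp (1 * x) + exp ((-1) * x))"
      using exp_gt_zero[of x] exp_gt_zero[of "-x"] by (cases "x < 0") auto
  qed
qed simp

lemma nn_integral_std_gaussian_uminus:
  assumes [measurable]: "f \<in> borel_measurable borel"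
  shows "(\<integral>\<^sup>+x. f (- x) \<partial>std_gaussian) = (\<integral>\<^sup>+x. f x \<partial>std_gaussian)"
proof -
  have "(\<integral>\<^sup>+x. f x \<partial>std_gaussian) = (\<integral>\<^sup>+x. std_normal_density x * f x \<partial>lborel)"
    by (subst nn_integral_density) auto
  also have "\<dots> = (\<integral>\<^sup>+x. std_normal_density x * f (- x) \<partial>lborel)"
    using nn_integral_real_affine[of "\<lambda>x. std_normal_density x * f x" "-1" 0]
    by (simp add: std_normal_density_def)
  also have "\<dots> = (\<integral>\<^sup>+x. f (- x) \<partial>std_gaussian)"
    by (subst nn_integral_density) auto
  finally show ?thesis ..
qed

text \<open>Crude domination of moments up to order 3, from
  \<open>1 + x / 3 \<le> exp (x / 3)\<close>, whence \<open>27 = 3 ^ 3\<close>.\<close>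

lemma power_le_exp:
  fixes x :: real
  assumes "0 \<le> x" "k \<le> 3"
  shows "x ^ k \<le> 27 * exp x"
proof -
  have "(1 + x / 3) ^ 3 \<le> exp (x / 3) ^ 3"
    using assms by (intro power_mono exp_ge_add_one_self) auto
  also have "\<dots> = exp x" by (simp flip: exp_of_nat_mult)
  finally have "27 * (1 + x / 3) ^ 3 \<le> 27 * exp x" by simp
  moreover have "27 * (1 + x / 3) ^ 3 = (3 + x) ^ 3" by (simp add: power3_eq_cube field_simps)
  ultimately have "(3 + x) ^ 3 \<le> 27 * exp x" by simp
  moreover have "x ^ k \<le> (3 + x) ^ k" using assms by (intro power_mono) auto
  moreover have "(3 + x) ^ k \<le> (3 + x) ^ 3" using assms by (intro power_increasing) auto
  ultimately show ?thesis by linarith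
qed

context gaussian_vector
begin

lemma distr_flip:
  assumes \<eta>: "\<And>i. i \<in> I \<Longrightarrow> \<eta> i = 1 \<or> \<eta> i = -1"
  shows "distr G G (\<lambda>g. \<lambda>i\<in>I. \<eta> i * g i) = G"
proof (rule PiG.PiM_eqI[OF fin])
  fix A assume A: "\<And>i. i \<in> I \<Longrightarrow> A i \<in> sets std_gaussian"
  have Ab: "A i \<in> sets borel" if "i \<in> I" for i using A[OF that] by simp
  let ?r = "\<lambda>g. \<lambda>i\<in>I. \<eta> i * g i"
  have m: "?r \<in> G \<rightarrow>\<^sub>M G" by (intro measurable_restrict) measurable
  have "emeasure (distr G G ?r) (Pi\<^sub>E I A) = (\<integral>\<^sup>+w. indicator (Pi\<^sub>E I A) (?r w) \<partial>G)"
    using nn_integral_distr[OF m, of "indicator (Pi\<^sub>E I A)"] A fin by simp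
  also have "\<dots> = (\<integral>\<^sup>+w. (\<Prod>i\<in>I. indicator (A i) (\<eta> i * w i)) \<partial>G)"
    using fin by (intro nn_integral_cong) (auto simp: indicator_def PiE_def Pi_def prod_zero_iff)
  also have "\<dots> = (\<Prod>i\<in>I. \<integral>\<^sup>+x. indicator (A i) (\<eta> i * x) \<partial>std_gaussian)"
  proof (rule PiG.product_nn_integral_prod[OF fin])
    fix i assume "i \<in> I"
    note [measurable] = Ab[OF this]
    show "(\<lambda>x. indicator (A i) (\<eta> i * x) :: ennreal) \<in> borel_measurable std_gaussian"
      by measurable
  qed
  also have "\<dots> = (\<Prod>i\<in>I. emeasure std_gaussian (A i))"
  proof (intro prod.cong refl)
    fix i assume i: "i \<in> I"
    have "(\<integral>\<^sup>+x. indicator (A i) (\<eta> i * x) \<partial>std_gaussian) = (\<integral>\<^sup>+x. indicator (A i) x \<partial>std_gaussian)"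
      using \<eta>[OF i] nn_integral_std_gaussian_uminus[of "indicator (A i)"] Ab[OF i] by auto
    then show "(\<integral>\<^sup>+x. indicator (A i) (\<eta> i * x) \<partial>std_gaussian) = emeasure std_gaussian (A i)"
      using A[OF i] by simp
  qed
  finally show "emeasure (distr G G ?r) (Pi\<^sub>E I A) = (\<Prod>i\<in>I. emeasure std_gaussian (A i))" .
qed simp

lemma integral_flip:
  assumes \<eta>: "\<And>i. i \<in> I \<Longrightarrow> \<eta> i = 1 \<or> \<eta> i = -1" and f: "obs f"
  shows "(\<integral>g. f (\<lambda>i. \<eta> i * g i) \<partial>G) = (\<integral>g. f g \<partial>G)"
proof -
  let ?r = "\<lambda>g. \<lambda>i\<in>I. \<eta> i * g i"
  have m: "?r \<in> G \<rightarrow>\<^sub>M G" by (intro measurable_restrict) measurable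
  have "(\<integral>g. f g \<partial>G) = (\<integral>g. f g \<partial>distr G G ?r)" by (simp only: distr_flip[of \<eta>, OF \<eta>])
  also have "\<dots> = (\<integral>g. f (?r g) \<partial>G)" by (rule integral_distr[OF m obs_measurable[OF f]])
  also have "\<dots> = (\<integral>g. f (\<lambda>i. \<eta> i * g i) \<partial>G)"
    by (intro Bochner_Integration.integral_cong obs_cong[OF f]) auto
  finally show ?thesis ..
qed

definition lin :: "('i \<Rightarrow> real) \<Rightarrow> ('i \<Rightarrow> real) \<Rightarrow> real" where
  "lin a g = (\<Sum>i\<in>I. a i * g i)"

lemma obs_lin: "obs (lin a)"
  unfolding obs_def lin_def by simp

lemma lin_combine: "lin a (\<lambda>i. c * u i + d * v i) = c * lin a u + d * lin a v"
  unfolding lin_def by (simp add: sum_distrib_left sum.distrib algebra_simps)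

lemma lin_mgf:
  "integrable G (\<lambda>g. exp (lin a g))" "(\<integral>g. exp (lin a g) \<partial>G) = exp ((\<Sum>i\<in>I. (a i)\<^sup>2) / 2)"
proof -
  have e: "exp (lin a g) = (\<Prod>i\<in>I. exp (a i * g i))" for g
    unfolding lin_def using fin by (rule exp_sum)
  show "integrable G (\<lambda>g. exp (lin a g))"
    unfolding e by (intro PiG.product_integrable_prod fin std_gaussian_mgf)
  show "(\<integral>g. exp (lin a g) \<partial>G) = exp ((\<Sum>i\<in>I. (a i)\<^sup>2) / 2)"
    unfolding e using fin
    by (subst PiG.product_integral_prod) (auto simp: std_gaussian_mgf exp_sum sum_divide_distrib)
qed

lemma component_cov:
  assumes "i \<in> I" "j \<in> I"
  shows "integrable G (\<lambda>g. g i * g j)" "(\<integral>g. g i * g j \<partial>G) = (if i = j then 1 else 0)"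
proof -
  \<comment> \<open>Writing the product over all coordinates treats \<open>i = j\<close> and
    \<open>i \<noteq> j\<close> uniformly: a factor is \<open>x\<close>, \<open>x * x\<close> or
    1.\<close>
  let ?f = "\<lambda>k x. (if k = i then x else 1) * (if k = j then x else (1::real))"
  have e: "g i * g j = (\<Prod>k\<in>I. ?f k (g k))" for g
    using assms fin by (simp add: prod.distrib prod.delta)
  have int: "integrable std_gaussian (?f k)" for k
    using std_gaussian_moments by (cases "k = i"; cases "k = j") auto
  have val: "(\<integral>x. ?f k x \<partial>std_gaussian) = (if k = i \<longleftrightarrow> k = j then 1 else 0)" for k
    using std_gaussian_moments by (cases "k = i"; cases "k = j") (auto simp: std.prob_space[simplified])
  show "integrable G (\<lambda>g. g i * g j)"
    unfolding e by (intro PiG.product_integrable_prod fin int)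
  have "(\<integral>g. g i * g j \<partial>G) = (\<Prod>k\<in>I. if k = i \<longleftrightarrow> k = j then 1 else 0)"
    unfolding e by (subst PiG.product_integral_prod[OF fin int]) (simp only: val)
  also have "\<dots> = (if i = j then 1 else 0)"
    using assms fin by (auto simp: prod_zero_iff intro!: prod_zero)
  finally show "(\<integral>g. g i * g j \<partial>G) = (if i = j then 1 else 0)" .
qed

lemma component_mean:
  assumes "i \<in> I"
  shows "integrable G (\<lambda>g. g i)" "(\<integral>g. g i \<partial>G) = 0"
proof -
  let ?f = "\<lambda>k x. (if k = i then x else (1::real))"
  have e: "g i = (\<Prod>k\<in>I. ?f k (g k))" for g :: "'i \<Rightarrow> real"
    using assms fin by (simp add: prod.delta)
  have int: "integrable std_gaussian (?f k)" for k
    using std_gaussian_moments by (cases "k = i") auto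
  have val: "(\<integral>x. ?f k x \<partial>std_gaussian) = (if k = i then 0 else 1)" for k
    using std_gaussian_moments by (cases "k = i") (auto simp: std.prob_space[simplified])
  show "integrable G (\<lambda>g. g i)"
    by (subst e) (intro PiG.product_integrable_prod fin int)
  have "(\<integral>g. g i \<partial>G) = (\<Prod>k\<in>I. if k = i then 0 else 1)"
    by (subst e, subst PiG.product_integral_prod[OF fin int]) (simp only: val)
  also have "\<dots> = 0"
    using assms fin by (auto intro!: prod_zero)
  finally show "(\<integral>g. g i \<partial>G) = 0" .
qed

lemma lin_mean: "integrable G (lin a)" "(\<integral>g. lin a g \<partial>G) = 0"
  unfolding lin_def using component_mean by (auto simp: lin_def)

lemma lin_cov:
  "integrable G (\<lambda>g. lin a g * lin b g)" "(\<integral>g. lin a g * lin b g \<partial>G) = (\<Sum>i\<in>I. a i * b i)"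
proof -
  have e: "lin a g * lin b g = (\<Sum>i\<in>I. \<Sum>j\<in>I. (a i * b j) * (g i * g j))" for g
    unfolding lin_def by (simp add: sum_product algebra_simps)
  show "integrable G (\<lambda>g. lin a g * lin b g)"
    unfolding e by (intro Bochner_Integration.integrable_sum integrable_mult_right component_cov)
  have "(\<integral>g. lin a g * lin b g \<partial>G) = (\<Sum>i\<in>I. \<Sum>j\<in>I. (a i * b j) * (\<integral>g. g i * g j \<partial>G))"
    unfolding e using component_cov
    by (subst Bochner_Integration.integral_sum; (intro Bochner_Integration.integrable_sum integrable_mult_right)?; simp?)
  also have "\<dots> = (\<Sum>i\<in>I. \<Sum>j\<in>I. if i = j then a i * b j else 0)"
    by (intro sum.cong refl) (simp add: component_cov)
  also have "\<dots> = (\<Sum>i\<in>I. a i * b i)"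
    using fin by (simp add: sum.delta)
  finally show "(\<integral>g. lin a g * lin b g \<partial>G) = (\<Sum>i\<in>I. a i * b i)" .
qed

text \<open>An envelope for every \<open>lin a\<close> with coefficients bounded by 1; its moments
  control the expansion errors uniformly over configurations.\<close>

definition l1 :: "('i \<Rightarrow> real) \<Rightarrow> real" where
  "l1 g = (\<Sum>i\<in>I. \<bar>g i\<bar>)"

lemma obs_l1: "obs l1"
  unfolding obs_def l1_def[abs_def] by simp

lemma l1_nonneg: "0 \<le> l1 g"
  by (simp add: l1_def sum_nonneg)

lemma integrable_l1_power: "k \<le> 3 \<Longrightarrow> integrable G (\<lambda>g. l1 g ^ k)"
proof (rule Bochner_Integration.integrable_bound)
  have "integrable G (\<lambda>g. \<Prod>i\<in>I. exp \<bar>g i\<bar>)"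
    by (intro PiG.product_integrable_prod fin std_gaussian_exp_abs)
  then show "integrable G (\<lambda>g. 27 * exp (l1 g))"
    using fin by (simp add: l1_def exp_sum)
  show "(\<lambda>g. l1 g ^ k) \<in> borel_measurable G" using obs_measurable[OF obs_l1] by measurable
  show "AE g in G. norm (l1 g ^ k) \<le> norm (27 * exp (l1 g))" if "k \<le> 3"
    using power_le_exp[OF l1_nonneg that] l1_nonneg by (intro AE_I2) simp
qed

end

section \<open>First order expansion of tilted weights\<close>

lemma exp_upper_quad:
  fixes x :: real
  assumes "\<bar>x\<bar> \<le> 1"
  shows "exp x \<le> 1 + x + x\<^sup>2"
proof (cases "0 \<le> x")
  case True
  then show ?thesis using exp_bound[of x] assms by simp
next
  case False
  define y where "y = - x"
  have y: "0 \<le> y" "1 + y > 0" using False by (auto simp: y_def)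
  have "exp x = 1 / exp y" by (simp add: y_def exp_minus field_simps)
  also have "\<dots> \<le> 1 / (1 + y)" using y by (intro divide_left_mono) (auto intro: exp_ge_add_one_self)
  also have "\<dots> \<le> 1 - y + y\<^sup>2"
  proof -
    have "(1 - y + y\<^sup>2) * (1 + y) = 1 + y ^ 3" by (simp add: power2_eq_square power3_eq_cube algebra_simps)
    then show ?thesis using y by (simp add: pos_divide_le_eq)
  qed
  finally show ?thesis by (simp add: y_def)
qed

text \<open>Exponential tilting of a finite probability vector \<open>w\<close> by
  \<open>exp (a x)\<close>: \<open>D\<close> is the normaliser, \<open>P\<close> the tilted vector
  and \<open>l\<close> the linear part of \<open>P - w\<close> in \<open>a\<close>. Adding a small
  Gaussian vector to the disorder changes Gibbs weights in this way.\<close>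

locale tilt =
  fixes K :: "'a set" and w a :: "'a \<Rightarrow> real" and A :: real
  assumes finK: "finite K" and w: "\<And>x. x \<in> K \<Longrightarrow> 0 \<le> w x" and w1: "sum w K = 1"
    and a: "\<And>x. x \<in> K \<Longrightarrow> \<bar>a x\<bar> \<le> A"
begin

definition D where "D = (\<Sum>x\<in>K. w x * exp (a x))"
definition P where "P x = w x * exp (a x) / D"
definition l where "l x = w x * (a x - (\<Sum>y\<in>K. w y * a y))"

lemma K_nonempty: "K \<noteq> {}"
  using w1 by auto

lemma A_nonneg: "0 \<le> A"
  using K_nonempty a abs_ge_zero order_trans by blast

lemma w_le_1: "x \<in> K \<Longrightarrow> w x \<le> 1"
  using w1 finK w member_le_sum[of x K w] by simp

lemma mean_bound: "\<bar>\<Sum>y\<in>K. w y * a y\<bar> \<le> A"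
proof -
  have "\<bar>\<Sum>y\<in>K. w y * a y\<bar> \<le> (\<Sum>y\<in>K. w y * A)"
    using w a by (intro order_trans[OF sum_abs] sum_mono) (auto simp: abs_mult intro!: mult_left_mono)
  then show ?thesis using w1 by (simp flip: sum_distrib_right)
qed

lemma D_pos: "0 < D"
proof -
  have "exp (- A) = (\<Sum>x\<in>K. w x * exp (- A))" using w1 by (simp flip: sum_distrib_right)
  also have "\<dots> \<le> D" unfolding D_def
    using w a by (intro sum_mono mult_left_mono) (auto simp: abs_le_iff minus_le_iff)
  finally show ?thesis using exp_gt_zero[of "-A"] by linarith
qed

lemma P_nonneg: "x \<in> K \<Longrightarrow> 0 \<le> P x"
  unfolding P_def using D_pos w by simp

lemma sum_P: "sum P K = 1"
  unfolding P_def using D_pos by (simp add: sum_divide_distrib[symmetric] D_def[symmetric])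

lemma P_le_1: "x \<in> K \<Longrightarrow> P x \<le> 1"
  using sum_P finK P_nonneg member_le_sum[of x K P] by simp

lemma l_bound: assumes "x \<in> K" shows "\<bar>l x\<bar> \<le> 2 * A"
proof -
  have "\<bar>l x\<bar> = w x * \<bar>a x - (\<Sum>y\<in>K. w y * a y)\<bar>" using w assms by (simp add: l_def abs_mult)
  also have "\<dots> \<le> 1 * (2 * A)"
    using w_le_1[OF assms] w[OF assms] a[OF assms] mean_bound by (intro mult_mono) auto
  finally show ?thesis by simp
qed

text \<open>The bounds must hold for every \<open>A\<close>, since \<open>A\<close> will be an
  unbounded random variable. For \<open>A > 1/2\<close> they are trivial because weights lie in the
  unit interval; for \<open>A \<le> 1/2\<close> the normaliser is at least \<open>1/2\<close> and
  the exponential is expanded.\<close>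

lemma first_order:
  assumes x: "x \<in> K"
  shows "\<bar>P x - w x\<bar> \<le> 5 * A" "\<bar>P x - w x - l x\<bar> \<le> 8 * A\<^sup>2"
proof -
  note A0 = A_nonneg
  have "\<bar>P x - w x\<bar> \<le> 5 * A \<and> \<bar>P x - w x - l x\<bar> \<le> 8 * A\<^sup>2"
  proof (cases "A \<le> 1 / 2")
    case False
    have 1: "\<bar>P x - w x\<bar> \<le> 1"
      using P_le_1[OF x] P_nonneg[OF x] w_le_1[OF x] w[OF x] by linarith
    have "(2 * A) * (1 / 2) \<le> (2 * A) * A" using False by (intro mult_left_mono) auto
    then have A2: "A \<le> 2 * A\<^sup>2" by (simp add: power2_eq_square)
    show ?thesis using 1 False l_bound[OF x] A2 by linarith
  next
    case True
    define m where "m = (\<Sum>y\<in>K. w y * a y)"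
    define q where "q y = exp (a y) - 1 - a y" for y
    define r where "r = (\<Sum>y\<in>K. w y * q y)"
    have A2: "A\<^sup>2 \<le> A / 2" using True A0 mult_left_mono[of A "1/2" A] by (simp add: power2_eq_square)
    have q: "0 \<le> q y \<and> q y \<le> A\<^sup>2" if "y \<in> K" for y
    proof
      show "0 \<le> q y" using exp_ge_add_one_self[of "a y"] unfolding q_def by linarith
      have "\<bar>a y\<bar> \<le> 1" using a[OF that] True by simp
      then have "q y \<le> (a y)\<^sup>2" using exp_upper_quad[of "a y"] by (simp add: q_def)
      also have "\<dots> \<le> A\<^sup>2" using a[OF that] A0 by (simp add: abs_le_square_iff[symmetric])
      finally show "q y \<le> A\<^sup>2" .
    qed
    have r: "0 \<le> r" "r \<le> A\<^sup>2"
    proof -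
      show "0 \<le> r" unfolding r_def using q w by (intro sum_nonneg) auto
      have "r \<le> (\<Sum>y\<in>K. w y * A\<^sup>2)" unfolding r_def using q w by (intro sum_mono mult_left_mono) auto
      then show "r \<le> A\<^sup>2" using w1 by (simp flip: sum_distrib_right)
    qed
    have "D = (\<Sum>y\<in>K. w y + w y * a y + w y * q y)"
      unfolding D_def q_def by (intro sum.cong) (auto simp: algebra_simps)
    then have D: "D = 1 + m + r" by (simp add: sum.distrib w1 m_def r_def)
    have mA: "\<bar>m\<bar> \<le> A" using mean_bound by (simp add: m_def)
    have D2: "1 / 2 \<le> D" using D mA r True by linarith
    have am: "\<bar>a x - m\<bar> \<le> 2 * A" using a[OF x] mA by linarith
    have qr: "\<bar>q x - r\<bar> \<le> A\<^sup>2" using q[OF x] r by linarith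
    have e1: "P x - w x = w x * (a x - m + (q x - r)) / D"
      using D_pos unfolding P_def by (simp add: field_simps q_def) (simp add: D algebra_simps)
    have e2: "P x - w x - l x = w x * ((a x - m) * (1 - D) + (q x - r)) / D"
      unfolding e1 l_def m_def[symmetric] using D_pos by (simp add: field_simps)
    have dv: "\<bar>w x * t / D\<bar> \<le> 2 * c" if "\<bar>t\<bar> \<le> c" for t c
    proof -
      have "\<bar>w x * t / D\<bar> = w x * \<bar>t\<bar> / D" using w[OF x] D_pos by (simp add: abs_mult)
      also have "\<dots> \<le> 1 * \<bar>t\<bar> / (1 / 2)"
        using w[OF x] w_le_1[OF x] D2 by (intro frac_le mult_right_mono) auto
      finally show ?thesis using that by simp
    qed
    have "\<bar>a x - m + (q x - r)\<bar> \<le> 5 / 2 * A" using am qr A2 by linarith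
    from dv[OF this] have 1: "\<bar>P x - w x\<bar> \<le> 5 * A" unfolding e1 by simp
    have "\<bar>1 - D\<bar> \<le> 3 / 2 * A" using D mA r A2 by linarith
    then have "\<bar>(a x - m) * (1 - D)\<bar> \<le> (2 * A) * (3 / 2 * A)"
      unfolding abs_mult using am A0 by (intro mult_mono) auto
    then have "\<bar>(a x - m) * (1 - D) + (q x - r)\<bar> \<le> 4 * A\<^sup>2"
      using qr by (simp add: power2_eq_square)
    from dv[OF this] have 2: "\<bar>P x - w x - l x\<bar> \<le> 8 * A\<^sup>2" unfolding e2 by simp
    show ?thesis using 1 2 by simp
  qed
  then show "\<bar>P x - w x\<bar> \<le> 5 * A" "\<bar>P x - w x - l x\<bar> \<le> 8 * A\<^sup>2" by auto
qed

end

lemma prod_first_order: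
  fixes d l d' l' A :: real
  assumes "\<bar>d\<bar> \<le> 5 * A" "\<bar>d' - l'\<bar> \<le> 8 * A\<^sup>2" "\<bar>l\<bar> \<le> 2 * A" "\<bar>d - l\<bar> \<le> 8 * A\<^sup>2" "\<bar>d'\<bar> \<le> 5 * A" 
  shows "\<bar>d * d' - l * l'\<bar> \<le> 56 * A ^ 3"
proof -
  have "\<bar>d * d' - l * l'\<bar> = \<bar>(d - l) * d' + l * (d' - l')\<bar>" by (simp add: algebra_simps)
  also have "\<dots> \<le> \<bar>d - l\<bar> * \<bar>d'\<bar> + \<bar>l\<bar> * \<bar>d' - l'\<bar>" by (metis abs_mult abs_triangle_ineq)
  also have "\<dots> \<le> (8 * A\<^sup>2) * (5 * A) + (2 * A) * (8 * A\<^sup>2)"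
    using assms by (intro add_mono mult_mono) auto
  finally show ?thesis by (simp add: power2_eq_square power3_eq_cube)
qed

text \<open>Symmetrisation: \<open>exp (c * t)\<close> increases with \<open>t\<close>, so
  \<open>(?F x - ?F y) * (Q x - Q y)\<close> is nonnegative for every pair, and its weighted sum is
  twice the difference of the two sides.\<close>

lemma chebyshev_sum_exp:
  fixes W Q :: "'a \<Rightarrow> real"
  assumes fin: "finite J" and W: "\<And>x. x \<in> J \<Longrightarrow> 0 \<le> W x" and W1: "sum W J = 1" and c: "0 \<le> c"
  shows "(\<Sum>x\<in>J. W x * exp (c * Q x)) * (\<Sum>x\<in>J. W x * Q x) \<le> (\<Sum>x\<in>J. W x * exp (c * Q x) * Q x)"
proof -
  let ?F = "\<lambda>x. exp (c * Q x)"
  have "0 \<le> (\<Sum>x\<in>J. \<Sum>y\<in>J. W x * W y * ((?F x - ?F y) * (Q x - Q y)))"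
  proof (intro sum_nonneg)
    fix x y assume xy: "x \<in> J" "y \<in> J"
    have "0 \<le> (?F x - ?F y) * (Q x - Q y)"
    proof (cases "Q x \<le> Q y")
      case True
      then have "?F x \<le> ?F y" using c by (simp add: mult_left_mono)
      then show ?thesis using True by (intro mult_nonpos_nonpos) auto
    next
      case False
      then have "?F y \<le> ?F x" using c by (simp add: mult_left_mono)
      then show ?thesis using False by (intro mult_nonneg_nonneg) auto
    qed
    then show "0 \<le> W x * W y * ((?F x - ?F y) * (Q x - Q y))"
      using W xy by simp
  qed
  also have "\<dots> = (\<Sum>x\<in>J. \<Sum>y\<in>J. (W x * ?F x * Q x) * W y) + (\<Sum>x\<in>J. \<Sum>y\<in>J. W x * (W y * ?F y * Q y))
      - (\<Sum>x\<in>J. \<Sum>y\<in>J. (W x * ?F x) * (W y * Q y)) - (\<Sum>x\<in>J. \<Sum>y\<in>J. (W x * Q x) * (W y * ?F y))"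
    by (simp only: sum.distrib[symmetric] sum_subtractf[symmetric]) (simp add: algebra_simps)
  also have "\<dots> = 2 * (\<Sum>x\<in>J. W x * ?F x * Q x) - 2 * ((\<Sum>x\<in>J. W x * ?F x) * (\<Sum>x\<in>J. W x * Q x))"
    by (simp add: sum_product[symmetric] W1)
  finally show ?thesis by simp
qed

section \<open>Gibbs weights of a Gaussian field\<close>

text \<open>Nonnegative covariances, \<open>Q_nonneg'\<close>, make the interpolation one-sided:
  they fix the sign of the terms dropped in \<open>weighted_cov_bound\<close>. For the quadratic
  field the covariance is the square of a scalar product.\<close>

locale gibbs_field = gaussian_vector I for I :: "'i set" +
  fixes K :: "'a set" and s :: "'a \<Rightarrow> 'i \<Rightarrow> real" and b :: real
  assumes finK: "finite K" and K_ne: "K \<noteq> {}"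
    and s_bound: "\<And>x i. x \<in> K \<Longrightarrow> i \<in> I \<Longrightarrow> \<bar>s x i\<bar> \<le> 1"
    and b_nonneg: "0 \<le> b"
    and Q_nonneg': "\<And>x y. x \<in> K \<Longrightarrow> y \<in> K \<Longrightarrow> 0 \<le> (\<Sum>i\<in>I. s x i * s y i)"
begin

definition Q :: "'a \<Rightarrow> 'a \<Rightarrow> real" where
  "Q x y = (\<Sum>i\<in>I. s x i * s y i)"

definition p :: "'a \<Rightarrow> ('i \<Rightarrow> real) \<Rightarrow> real" where
  "p x g = exp (b * lin (s x) g) / (\<Sum>y\<in>K. exp (b * lin (s y) g))"

lemma Q_nonneg: "x \<in> K \<Longrightarrow> y \<in> K \<Longrightarrow> 0 \<le> Q x y"
  using Q_nonneg' by (simp add: Q_def)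

lemma Q_le: assumes "x \<in> K" "y \<in> K" shows "Q x y \<le> card I"
proof -
  have "Q x y \<le> (\<Sum>i\<in>I. 1)" unfolding Q_def
  proof (rule sum_mono)
    fix i assume "i \<in> I"
    then have "\<bar>s x i * s y i\<bar> \<le> 1 * 1" unfolding abs_mult using s_bound assms by (intro mult_mono) auto
    then show "s x i * s y i \<le> 1" by simp
  qed
  then show ?thesis by simp
qed

lemma Z_pos: "0 < (\<Sum>y\<in>K. exp (b * lin (s y) g))"
  using finK K_ne by (intro sum_pos) auto

lemma p_nonneg: "0 \<le> p x g"
  unfolding p_def using Z_pos[of g] by simp

lemma sum_p: "(\<Sum>x\<in>K. p x g) = 1"
  unfolding p_def using Z_pos[of g] by (simp add: sum_divide_distrib[symmetric])

lemma p_le_1: "x \<in> K \<Longrightarrow> p x g \<le> 1"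
  using member_le_sum[of x K "\<lambda>x. p x g"] finK p_nonneg sum_p[of g] by simp

lemma bobs_p: assumes "x \<in> K" shows "bobs (p x)"
proof -
  have "lin (s y) \<in> borel_measurable (\<Pi>\<^sub>M i\<in>I. borel)" "\<And>g. lin (s y) (restrict g I) = lin (s y) g" for y
    using obs_lin[of "s y"] by (auto simp: obs_def)
  note [measurable] = this(1) and [simp] = this(2)
  have "obs (p x)" unfolding obs_def p_def[abs_def] by simp
  moreover have "\<bar>p x g\<bar> \<le> 1" for g using p_nonneg p_le_1[OF assms] by simp
  ultimately show ?thesis unfolding bobs_def by blast
qed

lemma abs_lin_le: "x \<in> K \<Longrightarrow> \<bar>lin (s x) g\<bar> \<le> l1 g"
  unfolding lin_def l1_def
  by (intro order_trans[OF sum_abs] sum_mono) (use s_bound in \<open>auto simp: abs_mult intro!: mult_left_le_one_le\<close>)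

definition m2 :: real where "m2 = (\<integral>\<xi>. l1 \<xi> ^ 2 \<partial>G)"
definition m3 :: real where "m3 = (\<integral>\<xi>. l1 \<xi> ^ 3 \<partial>G)"

lemma m_nonneg: "0 \<le> m2" "0 \<le> m3"
  unfolding m2_def m3_def using l1_nonneg by (auto intro!: integral_nonneg_AE)

text \<open>\<open>b\<close> times this vector is the gradient of \<open>ln (p x)\<close> at
  \<open>u\<close>.\<close>

definition centred :: "'a \<Rightarrow> ('i \<Rightarrow> real) \<Rightarrow> 'i \<Rightarrow> real" where
  "centred x u i = s x i - (\<Sum>y\<in>K. p y u * s y i)"

lemma tilt_p:
  assumes e: "0 \<le> e"
  shows "tilt K (\<lambda>x. p x u) (\<lambda>x. e * b * lin (s x) \<xi>) (e * b * l1 \<xi>)"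
proof
  show "\<bar>e * b * lin (s x) \<xi>\<bar> \<le> e * b * l1 \<xi>" if "x \<in> K" for x
    using abs_lin_le[OF that, of \<xi>] e b_nonneg by (simp add: abs_mult mult_left_mono)
qed (use finK p_nonneg sum_p in auto)

lemma p_expansion:
  fixes u \<xi> :: "'i \<Rightarrow> real"
  assumes e: "0 \<le> e" and x: "x \<in> K"
  defines "A \<equiv> e * b * l1 \<xi>"
    and "l \<equiv> p x u * (e * b) * lin (centred x u) \<xi>"
    and "d \<equiv> p x (\<lambda>i. u i + e * \<xi> i) - p x u"
  shows "\<bar>d\<bar> \<le> 5 * A" "\<bar>d - l\<bar> \<le> 8 * A\<^sup>2" "\<bar>l\<bar> \<le> 2 * A"
proof -
  interpret t: tilt K "\<lambda>x. p x u" "\<lambda>x. e * b * lin (s x) \<xi>" A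
    unfolding A_def by (rule tilt_p[OF e])
  have lin_add: "lin (s y) (\<lambda>i. u i + e * \<xi> i) = lin (s y) u + e * lin (s y) \<xi>" for y
    using lin_combine[of "s y" 1 u e \<xi>] by simp
  let ?Z = "\<Sum>y\<in>K. exp (b * lin (s y) u)"
  have D: "t.D = (\<Sum>y\<in>K. exp (b * lin (s y) (\<lambda>i. u i + e * \<xi> i))) / ?Z"
    unfolding t.D_def unfolding p_def sum_divide_distrib
    by (intro sum.cong) (auto simp: lin_add exp_add[symmetric] algebra_simps)
  have P: "t.P x = p x (\<lambda>i. u i + e * \<xi> i)"
    unfolding t.P_def D p_def[of x] using Z_pos[of u]
    by (auto simp: lin_add exp_add[symmetric] algebra_simps)
  have "lin (centred x u) \<xi> = lin (s x) \<xi> - (\<Sum>y\<in>K. p y u * lin (s y) \<xi>)"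
    unfolding lin_def centred_def sum_distrib_left left_diff_distrib sum_subtractf sum_distrib_right
    by (subst sum.swap[of _ K I]) (simp add: mult.assoc)
  moreover have "(\<Sum>y\<in>K. p y u * (e * b * lin (s y) \<xi>)) = e * b * (\<Sum>y\<in>K. p y u * lin (s y) \<xi>)"
    by (simp add: sum_distrib_left mult_ac)
  ultimately have l: "t.l x = l"
    unfolding t.l_def l_def by (simp only:) (simp add: algebra_simps)
  show "\<bar>d\<bar> \<le> 5 * A" "\<bar>d - l\<bar> \<le> 8 * A\<^sup>2" "\<bar>l\<bar> \<le> 2 * A"
    using t.first_order[OF x] t.l_bound[OF x] unfolding P l d_def by auto
qed

lemma p_shift_integrable:
  assumes "x \<in> K"
  shows "integrable G (\<lambda>\<xi>. p x (\<lambda>i. u i + e * \<xi> i))"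
  by (rule bobs_integrable_shift[OF bobs_p[OF assms]])

text \<open>The linear term of the expansion has mean zero, so smoothing changes the weights only to
  second order in \<open>e\<close>.\<close>

lemma S_p_close:
  assumes e: "0 \<le> e" and x: "x \<in> K"
  shows "\<bar>S e (p x) u - p x u\<bar> \<le> 8 * (e * b)\<^sup>2 * m2"
proof -
  let ?l = "\<lambda>\<xi>. p x u * (e * b) * lin (centred x u) \<xi>"
  let ?d = "\<lambda>\<xi>. p x (\<lambda>i. u i + e * \<xi> i) - p x u"
  have il: "integrable G ?l" using lin_mean by simp
  have "S e (p x) u - p x u = (\<integral>\<xi>. ?d \<xi> \<partial>G)"
    using p_shift_integrable[OF x] by (simp add: S_def G.prob_space)
  also have "\<dots> = (\<integral>\<xi>. ?d \<xi> - ?l \<xi> \<partial>G)"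
    using p_shift_integrable[OF x] il lin_mean(2) by simp
  finally have "\<bar>S e (p x) u - p x u\<bar> \<le> (\<integral>\<xi>. \<bar>?d \<xi> - ?l \<xi>\<bar> \<partial>G)" by simp
  also have "\<dots> \<le> (\<integral>\<xi>. 8 * (e * b)\<^sup>2 * l1 \<xi> ^ 2 \<partial>G)"
  proof (intro integral_mono)
    show "\<bar>?d \<xi> - ?l \<xi>\<bar> \<le> 8 * (e * b)\<^sup>2 * l1 \<xi> ^ 2" for \<xi>
      using p_expansion(2)[OF e x, of u \<xi>] by (simp add: power_mult_distrib)
  qed (use p_shift_integrable[OF x] il integrable_l1_power[of 2] in auto)
  finally show ?thesis by (simp add: m2_def)
qed

lemma S_p_bounds: "x \<in> K \<Longrightarrow> 0 \<le> S e (p x) u" "x \<in> K \<Longrightarrow> S e (p x) u \<le> 1"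
proof -
  assume x: "x \<in> K"
  show "0 \<le> S e (p x) u" unfolding S_def using p_nonneg by (auto intro!: integral_nonneg_AE)
  have "S e (p x) u \<le> (\<integral>\<xi>. 1 \<partial>G)" unfolding S_def
    using p_le_1[OF x] p_shift_integrable[OF x] by (intro integral_mono) auto
  then show "S e (p x) u \<le> 1" by (simp add: G.prob_space)
qed

lemma p_prod_integrable:
  assumes "x \<in> K" "y \<in> K"
  shows "integrable G (\<lambda>\<xi>. p x (\<lambda>i. u i + e * \<xi> i) * p y (\<lambda>i. v i + e * \<xi> i))"
proof (rule Bochner_Integration.integrable_bound[OF p_shift_integrable[OF assms(1), of u e]])
  show "AE \<xi> in G. norm (p x (\<lambda>i. u i + e * \<xi> i) * p y (\<lambda>i. v i + e * \<xi> i)) \<le> norm (p x (\<lambda>i. u i + e * \<xi> i))"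
    using p_nonneg p_le_1[OF assms(2)] by (intro AE_I2) (auto simp: abs_mult intro!: mult_left_le)
qed (use p_shift_integrable assms in auto)

text \<open>The covariance of two weights driven by a common increment is, to leading order, that of
  their linear parts. The cubic error comes from \<open>prod_first_order\<close>; the product of the
  mean increments is of fourth order by \<open>S_p_close\<close>.\<close>

lemma p_cov_bound:
  assumes e: "0 \<le> e" and x: "x \<in> K" and y: "y \<in> K"
  shows "(\<integral>\<xi>. p x (\<lambda>i. u i + e * \<xi> i) * p y (\<lambda>i. v i + e * \<xi> i) \<partial>G)
    \<le> S e (p x) u * S e (p y) v + (e * b)\<^sup>2 * (p x u * p y v * (\<Sum>i\<in>I. centred x u i * centred y v i))
      + 56 * (e * b) ^ 3 * m3 + 64 * (e * b) ^ 4 * m2\<^sup>2"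
proof -
  let ?l = "\<lambda>\<xi>. p x u * (e * b) * lin (centred x u) \<xi>" and ?l' = "\<lambda>\<xi>. p y v * (e * b) * lin (centred y v) \<xi>"
  let ?P = "\<lambda>\<xi>. p x (\<lambda>i. u i + e * \<xi> i)" and ?P' = "\<lambda>\<xi>. p y (\<lambda>i. v i + e * \<xi> i)"
  let ?d = "\<lambda>\<xi>. ?P \<xi> - p x u" and ?d' = "\<lambda>\<xi>. ?P' \<xi> - p y v"
  note ints = p_shift_integrable[OF x, of u e] p_shift_integrable[OF y, of v e] p_prod_integrable[OF x y, of u e v]
  have dd: "?d \<xi> * ?d' \<xi> = ?P \<xi> * ?P' \<xi> - p y v * ?P \<xi> - p x u * ?P' \<xi> + p x u * p y v" for \<xi>
    by (simp add: algebra_simps)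
  have idd: "integrable G (\<lambda>\<xi>. ?d \<xi> * ?d' \<xi>)" unfolding dd using ints by simp
  have ll: "?l \<xi> * ?l' \<xi> = (e * b)\<^sup>2 * (p x u * p y v) * (lin (centred x u) \<xi> * lin (centred y v) \<xi>)" for \<xi>
    by (simp add: power2_eq_square)
  have ill: "integrable G (\<lambda>\<xi>. ?l \<xi> * ?l' \<xi>)" unfolding ll using lin_cov(1) by simp
  have Ell: "(\<integral>\<xi>. ?l \<xi> * ?l' \<xi> \<partial>G) = (e * b)\<^sup>2 * (p x u * p y v * (\<Sum>i\<in>I. centred x u i * centred y v i))"
    unfolding ll by (simp add: lin_cov(2))
  have "(\<integral>\<xi>. ?P \<xi> * ?P' \<xi> \<partial>G) - S e (p x) u * S e (p y) v
      = (\<integral>\<xi>. ?d \<xi> * ?d' \<xi> \<partial>G) - (S e (p x) u - p x u) * (S e (p y) v - p y v)"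
    unfolding dd using ints by (simp add: S_def G.prob_space algebra_simps)
  moreover have "(\<integral>\<xi>. ?d \<xi> * ?d' \<xi> \<partial>G) \<le> (\<integral>\<xi>. ?l \<xi> * ?l' \<xi> + 56 * (e * b) ^ 3 * l1 \<xi> ^ 3 \<partial>G)"
  proof (intro integral_mono idd)
    show "integrable G (\<lambda>\<xi>. ?l \<xi> * ?l' \<xi> + 56 * (e * b) ^ 3 * l1 \<xi> ^ 3)"
      using ill integrable_l1_power[of 3] by simp
    fix \<xi>
    have "\<bar>?d \<xi> * ?d' \<xi> - ?l \<xi> * ?l' \<xi>\<bar> \<le> 56 * (e * b * l1 \<xi>) ^ 3"
      by (rule prod_first_order) (use p_expansion[OF e x, of u \<xi>] p_expansion[OF e y, of v \<xi>] in auto)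
    then show "?d \<xi> * ?d' \<xi> \<le> ?l \<xi> * ?l' \<xi> + 56 * (e * b) ^ 3 * l1 \<xi> ^ 3"
      by (simp add: power_mult_distrib abs_le_iff)
  qed
  moreover have "(\<integral>\<xi>. ?l \<xi> * ?l' \<xi> + 56 * (e * b) ^ 3 * l1 \<xi> ^ 3 \<partial>G)
      = (e * b)\<^sup>2 * (p x u * p y v * (\<Sum>i\<in>I. centred x u i * centred y v i)) + 56 * (e * b) ^ 3 * m3"
    using ill integrable_l1_power[of 3] by (subst Bochner_Integration.integral_add) (simp_all add: Ell m3_def)
  moreover have "\<bar>(S e (p x) u - p x u) * (S e (p y) v - p y v)\<bar> \<le> (8 * (e * b)\<^sup>2 * m2) * (8 * (e * b)\<^sup>2 * m2)"
    unfolding abs_mult using S_p_close[OF e x, of u] S_p_close[OF e y, of v] m_nonneg by (intro mult_mono) auto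
  moreover have "(8 * (e * b)\<^sup>2 * m2) * (8 * (e * b)\<^sup>2 * m2) = 64 * (e * b) ^ 4 * m2\<^sup>2"
    by (simp add: power2_eq_square power4_eq_xxxx)
  ultimately show ?thesis by linarith
qed

text \<open>Expanding the centred directions gives four terms. The two negative ones are dropped, and Chebyshev's sum
  inequality bounds the remaining replica term by the diagonal one.\<close>

lemma weighted_cov_bound:
  assumes c: "0 \<le> c"
  shows "(\<Sum>z\<in>K \<times> K. exp (c * Q (fst z) (snd z)) * (p (fst z) u * p (snd z) v * (\<Sum>i\<in>I. centred (fst z) u i * centred (snd z) v i)))
    \<le> 2 * (\<Sum>z\<in>K \<times> K. exp (c * Q (fst z) (snd z)) * Q (fst z) (snd z) * (p (fst z) u * p (snd z) v))"
proof -
  let ?W = "\<lambda>z. p (fst z) u * p (snd z) v" and ?q = "\<lambda>z. Q (fst z) (snd z)"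
  let ?m = "\<Sum>z\<in>K \<times> K. ?W z * ?q z"
  have centred_le: "(\<Sum>i\<in>I. centred x u i * centred y v i) \<le> Q x y + ?m" if x: "x \<in> K" and y: "y \<in> K" for x y
  proof -
    have "(\<Sum>i\<in>I. centred x u i * centred y v i) = Q x y - (\<Sum>i\<in>I. s x i * (\<Sum>y'\<in>K. p y' v * s y' i))
        - (\<Sum>i\<in>I. (\<Sum>x'\<in>K. p x' u * s x' i) * s y i)
        + (\<Sum>i\<in>I. (\<Sum>x'\<in>K. p x' u * s x' i) * (\<Sum>y'\<in>K. p y' v * s y' i))"
      unfolding centred_def Q_def by (simp only: sum.distrib[symmetric] sum_subtractf[symmetric]) (simp add: algebra_simps)
    moreover have "(\<Sum>i\<in>I. s x i * (\<Sum>y'\<in>K. p y' v * s y' i)) = (\<Sum>y'\<in>K. p y' v * Q x y')"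
      unfolding Q_def sum_distrib_left by (subst sum.swap) (simp add: mult.left_commute)
    moreover have "(\<Sum>i\<in>I. (\<Sum>x'\<in>K. p x' u * s x' i) * s y i) = (\<Sum>x'\<in>K. p x' u * Q x' y)"
      unfolding Q_def sum_distrib_left sum_distrib_right by (subst sum.swap) (simp add: mult.assoc)
    moreover have "(\<Sum>i\<in>I. (\<Sum>x'\<in>K. p x' u * s x' i) * (\<Sum>y'\<in>K. p y' v * s y' i)) = ?m"
    proof -
      have "(\<Sum>i\<in>I. (\<Sum>x'\<in>K. p x' u * s x' i) * (\<Sum>y'\<in>K. p y' v * s y' i))
          = (\<Sum>i\<in>I. \<Sum>z\<in>K \<times> K. ?W z * (s (fst z) i * s (snd z) i))"
        unfolding sum_product sum.cartesian_product by (simp add: case_prod_beta algebra_simps)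
      also have "\<dots> = ?m" unfolding Q_def sum_distrib_left by (rule sum.swap)
      finally show ?thesis .
    qed
    moreover have "0 \<le> (\<Sum>y'\<in>K. p y' v * Q x y')" "0 \<le> (\<Sum>x'\<in>K. p x' u * Q x' y)"
      using p_nonneg Q_nonneg x y by (auto intro!: sum_nonneg)
    ultimately show ?thesis by linarith
  qed
  have W1: "sum ?W (K \<times> K) = 1"
    using sum_product[of "\<lambda>x. p x u" K "\<lambda>y. p y v" K] by (simp add: sum.cartesian_product case_prod_beta sum_p)
  have "(\<Sum>z\<in>K \<times> K. exp (c * ?q z) * (?W z * (\<Sum>i\<in>I. centred (fst z) u i * centred (snd z) v i)))
     \<le> (\<Sum>z\<in>K \<times> K. exp (c * ?q z) * (?W z * (?q z + ?m)))"
    using centred_le p_nonneg by (intro sum_mono mult_left_mono) auto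
  also have "\<dots> = (\<Sum>z\<in>K \<times> K. ?W z * exp (c * ?q z) * ?q z) + (\<Sum>z\<in>K \<times> K. ?W z * exp (c * ?q z)) * ?m"
    unfolding sum_distrib_right sum.distrib[symmetric] by (intro sum.cong refl) (simp only: algebra_simps)
  also have "\<dots> \<le> 2 * (\<Sum>z\<in>K \<times> K. ?W z * exp (c * ?q z) * ?q z)"
    using chebyshev_sum_exp[of "K \<times> K" ?W c ?q, OF _ _ W1 c] finK p_nonneg by simp
  finally show ?thesis by (simp add: mult_ac)
qed

text \<open>Compares sharing the increment \<open>\<xi>\<close> between the replicas with smoothing
  each one separately. By \<open>p_cov_bound\<close> and \<open>weighted_cov_bound\<close>, sharing
  adds to the weighted sum at most \<open>2 * (e * b)\<^sup>2 * Q\<close> per unit of weight to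
  leading order, and \<open>1 + x \<le> exp x\<close> moves this into the exponent. The error is
  uniform in \<open>u\<close>, \<open>v\<close> and in \<open>c\<close> up to \<Lambda>, as the
  iteration requires.\<close>

lemma local_step:
  assumes c: "0 \<le> c" "c \<le> \<Lambda>" and e: "0 \<le> e" "e \<le> 1"
  shows "(\<Sum>z\<in>K \<times> K. exp (c * Q (fst z) (snd z)) *
       (\<integral>\<xi>. p (fst z) (\<lambda>i. u i + e * \<xi> i) * p (snd z) (\<lambda>i. v i + e * \<xi> i) \<partial>G))
    \<le> (\<Sum>z\<in>K \<times> K. exp ((c + 2 * (e * b)\<^sup>2) * Q (fst z) (snd z)) * (S e (p (fst z)) u * S e (p (snd z)) v))
      + (real (card (K \<times> K)) * exp (\<Lambda> * card I) * (56 * b ^ 3 * m3 + 64 * b ^ 4 * m2\<^sup>2 + 32 * b ^ 4 * card I * m2)) * e ^ 3"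
proof -
  let ?q = "\<lambda>z. Q (fst z) (snd z)"
  let ?F = "\<lambda>z. exp (c * ?q z)"
  let ?S = "\<lambda>z. S e (p (fst z)) u * S e (p (snd z)) v"
  let ?W = "\<lambda>z. p (fst z) u * p (snd z) v"
  let ?r = "56 * (e * b) ^ 3 * m3 + 64 * (e * b) ^ 4 * m2\<^sup>2"
  have e4: "e ^ 4 \<le> e ^ 3" using e by (intro power_decreasing) auto
  have F_le: "?F z \<le> exp (\<Lambda> * card I)" if "z \<in> K \<times> K" for z
    using that c Q_le[of "fst z" "snd z"] Q_nonneg[of "fst z" "snd z"] by (auto intro!: mult_mono)
  \<comment> \<open>The conclusion carries smoothed weights throughout, so \<open>?W\<close> is
    traded for \<open>?S\<close>. The cost is of second order and gets multiplied by a further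
    \<open>(e * b)\<^sup>2\<close>.\<close>
  have W_le: "?W z \<le> ?S z + 16 * (e * b)\<^sup>2 * m2" if "z \<in> K \<times> K" for z
  proof -
    let ?a = "S e (p (fst z)) u" and ?a' = "S e (p (snd z)) v"
    have z: "fst z \<in> K" "snd z \<in> K" using that by auto
    have "?W z - ?S z = (p (fst z) u - ?a) * p (snd z) v + ?a * (p (snd z) v - ?a')"
      by (simp add: algebra_simps)
    also have "\<dots> \<le> \<bar>p (fst z) u - ?a\<bar> + \<bar>p (snd z) v - ?a'\<bar>"
    proof (rule add_mono)
      have le: "t * y \<le> \<bar>t\<bar>" if "0 \<le> y" "y \<le> 1" for t y :: real
        using that mult_left_le[of y "\<bar>t\<bar>"] abs_ge_self[of "t * y"] by (simp add: abs_mult)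
      show "(p (fst z) u - ?a) * p (snd z) v \<le> \<bar>p (fst z) u - ?a\<bar>"
        by (intro le p_nonneg p_le_1 z)
      show "?a * (p (snd z) v - ?a') \<le> \<bar>p (snd z) v - ?a'\<bar>"
        unfolding mult.commute[of ?a] by (intro le S_p_bounds z)
    qed
    also have "\<dots> \<le> 16 * (e * b)\<^sup>2 * m2"
      using S_p_close[OF e(1) z(1), of u] S_p_close[OF e(1) z(2), of v] by (simp add: abs_minus_commute)
    finally show ?thesis by simp
  qed
  have "(\<Sum>z\<in>K \<times> K. ?F z * (\<integral>\<xi>. p (fst z) (\<lambda>i. u i + e * \<xi> i) * p (snd z) (\<lambda>i. v i + e * \<xi> i) \<partial>G))
    \<le> (\<Sum>z\<in>K \<times> K. ?F z * (?S z + (e * b)\<^sup>2 * (?W z * (\<Sum>i\<in>I. centred (fst z) u i * centred (snd z) v i)) + ?r))"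
    using p_cov_bound[OF e(1)] by (intro sum_mono mult_left_mono) (auto simp: add.assoc)
  also have "\<dots> = (\<Sum>z\<in>K \<times> K. ?F z * ?S z)
      + (e * b)\<^sup>2 * (\<Sum>z\<in>K \<times> K. ?F z * (?W z * (\<Sum>i\<in>I. centred (fst z) u i * centred (snd z) v i)))
      + (\<Sum>z\<in>K \<times> K. ?F z * ?r)"
  proof -
    have "(\<Sum>z\<in>J. F z * (f z + k * h z + r)) = (\<Sum>z\<in>J. F z * f z) + k * (\<Sum>z\<in>J. F z * h z) + (\<Sum>z\<in>J. F z * r)"
      for J and F f h :: "'a \<times> 'a \<Rightarrow> real" and k r
      by (simp add: sum.distrib sum_distrib_left algebra_simps)
    then show ?thesis .
  qed
  also have "\<dots> \<le> (\<Sum>z\<in>K \<times> K. ?F z * ?S z) + (e * b)\<^sup>2 * (2 * (\<Sum>z\<in>K \<times> K. ?F z * ?q z * ?W z))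
      + (\<Sum>z\<in>K \<times> K. ?F z * ?r)"
    using weighted_cov_bound[OF c(1), of u v] by (intro add_mono mult_left_mono) auto
  also have "\<dots> \<le> (\<Sum>z\<in>K \<times> K. ?F z * ?S z) + (e * b)\<^sup>2 * (2 * (\<Sum>z\<in>K \<times> K. ?F z * ?q z * (?S z + 16 * (e * b)\<^sup>2 * m2)))
      + (\<Sum>z\<in>K \<times> K. ?F z * ?r)"
    using W_le Q_nonneg by (intro add_mono mult_left_mono sum_mono order_refl) auto
  also have "\<dots> = (\<Sum>z\<in>K \<times> K. ?F z * (1 + 2 * (e * b)\<^sup>2 * ?q z) * ?S z)
      + (\<Sum>z\<in>K \<times> K. ?F z * (?r + 32 * (e * b) ^ 4 * ?q z * m2))"
  proof -
    have "(\<Sum>z\<in>J. F z * f z) + k * (2 * (\<Sum>z\<in>J. F z * q z * (f z + 16 * k * m))) + (\<Sum>z\<in>J. F z * r)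
      = (\<Sum>z\<in>J. F z * (1 + 2 * k * q z) * f z) + (\<Sum>z\<in>J. F z * (r + 32 * k\<^sup>2 * q z * m))"
      for J and F f q :: "'a \<times> 'a \<Rightarrow> real" and k r m
      by (simp add: sum.distrib sum_distrib_left algebra_simps power2_eq_square)
    from this[of ?F ?S "K \<times> K" "(e * b)\<^sup>2" ?q m2 ?r] show ?thesis
      by (simp only: power2_eq_square power4_eq_xxxx mult.assoc)
  qed
  also have "\<dots> \<le> (\<Sum>z\<in>K \<times> K. exp ((c + 2 * (e * b)\<^sup>2) * ?q z) * ?S z)
      + (\<Sum>z\<in>K \<times> K. exp (\<Lambda> * card I) * ((56 * b ^ 3 * m3 + 64 * b ^ 4 * m2\<^sup>2 + 32 * b ^ 4 * card I * m2) * e ^ 3))"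
  proof (intro add_mono sum_mono)
    fix z assume z: "z \<in> K \<times> K"
    have "?F z * (1 + 2 * (e * b)\<^sup>2 * ?q z) \<le> ?F z * exp (2 * (e * b)\<^sup>2 * ?q z)"
      by (intro mult_left_mono exp_ge_add_one_self) auto
    also have "\<dots> = exp ((c + 2 * (e * b)\<^sup>2) * ?q z)" by (simp add: exp_add[symmetric] algebra_simps)
    finally show "?F z * (1 + 2 * (e * b)\<^sup>2 * ?q z) * ?S z \<le> exp ((c + 2 * (e * b)\<^sup>2) * ?q z) * ?S z"
      using S_p_bounds(1) z by (intro mult_right_mono mult_nonneg_nonneg) auto
    have q: "0 \<le> ?q z" "?q z \<le> card I" using Q_nonneg Q_le z by auto
    have "?r + 32 * (e * b) ^ 4 * ?q z * m2
        \<le> 56 * (b ^ 3 * e ^ 3) * m3 + 64 * (b ^ 4 * e ^ 3) * m2\<^sup>2 + 32 * (b ^ 4 * e ^ 3) * card I * m2"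
      using e4 q m_nonneg b_nonneg e
      by (intro add_mono mult_mono) (auto simp: power_mult_distrib mult.commute[of "b ^ 4"] intro!: mult_right_mono)
    also have "\<dots> = (56 * b ^ 3 * m3 + 64 * b ^ 4 * m2\<^sup>2 + 32 * b ^ 4 * card I * m2) * e ^ 3"
      by (simp add: algebra_simps)
    finally show "?F z * (?r + 32 * (e * b) ^ 4 * ?q z * m2)
      \<le> exp (\<Lambda> * card I) * ((56 * b ^ 3 * m3 + 64 * b ^ 4 * m2\<^sup>2 + 32 * b ^ 4 * card I * m2) * e ^ 3)"
      using F_le[OF z] e b_nonneg m_nonneg q by (intro mult_mono) auto
  qed
  finally show ?thesis by (simp add: mult_ac)
qed

end

section \<open>Replicas at correlated disorders: interpolation, squaring of the correlation, and
  mean energy\<close>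

context gaussian_vector
begin

text \<open>Puts the common and private variables of \<open>integral_T_split\<close> on one product
  space, over which the pointwise inequality \<open>local_step\<close> can be integrated.\<close>

lemma S_scaled_joint:
  assumes f: "bobs f" and h: "bobs h" and r: "0 \<le> r" and e: "0 \<le> e" and re: "r + e \<le> 1"
    and s: "s = sqrt (1 - r - e)"
  defines "U \<equiv> \<lambda>v i. sqrt r * fst v i + s * fst (snd v) i"
    and "V \<equiv> \<lambda>v i. sqrt r * fst v i + s * snd (snd v) i"
  shows "integrable (G \<Otimes>\<^sub>M (G \<Otimes>\<^sub>M G)) (\<lambda>v. \<integral>y. f (\<lambda>i. U v i + sqrt e * y i) * h (\<lambda>i. V v i + sqrt e * y i) \<partial>G)" (is ?I1)
    and "(\<integral>g. T (sqrt (r + e)) f g * T (sqrt (r + e)) h g \<partial>G) =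
      (\<integral>v. \<integral>y. f (\<lambda>i. U v i + sqrt e * y i) * h (\<lambda>i. V v i + sqrt e * y i) \<partial>G \<partial>(G \<Otimes>\<^sub>M (G \<Otimes>\<^sub>M G)))" (is ?E1)
    and "integrable (G \<Otimes>\<^sub>M (G \<Otimes>\<^sub>M G)) (\<lambda>v. S (sqrt e) f (U v) * S (sqrt e) h (V v))" (is ?I2)
    and "(\<integral>g. T (sqrt r) f g * T (sqrt r) h g \<partial>G) =
      (\<integral>v. S (sqrt e) f (U v) * S (sqrt e) h (V v) \<partial>(G \<Otimes>\<^sub>M (G \<Otimes>\<^sub>M G)))" (is ?E2)
proof -
  obtain A where A: "\<And>g. \<bar>f g\<bar> \<le> A" "A \<ge> 0" using f bobs_bound by blast
  obtain B where B: "\<And>g. \<bar>h g\<bar> \<le> B" "B \<ge> 0" using h bobs_bound by blast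
  have Sef: "bobs (S (sqrt e) f)" "bobs (S (sqrt e) h)" using f h by (auto intro: bobs_S)
  obtain A' where A': "\<And>g. \<bar>S (sqrt e) f g\<bar> \<le> A'" "A' \<ge> 0" using Sef bobs_bound by blast
  obtain B' where B': "\<And>g. \<bar>S (sqrt e) h g\<bar> \<le> B'" "B' \<ge> 0" using Sef bobs_bound by blast
  let ?F = "\<lambda>v y. f (\<lambda>i. U v i + sqrt e * y i) * h (\<lambda>i. V v i + sqrt e * y i)"
  have "(\<lambda>w. ?F (fst w) (snd w)) \<in> borel_measurable ((G \<Otimes>\<^sub>M (G \<Otimes>\<^sub>M G)) \<Otimes>\<^sub>M G)"
    unfolding U_def V_def
    by (intro borel_measurable_times obs_comp[OF bobs_obs[OF f]] obs_comp[OF bobs_obs[OF h]]) measurable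
  then have m: "(\<lambda>v. \<integral>y. ?F v y \<partial>G) \<in> borel_measurable (G \<Otimes>\<^sub>M (G \<Otimes>\<^sub>M G))"
    by (intro G.borel_measurable_lebesgue_integral) (simp add: case_prod_beta')
  have Fb: "norm (\<integral>y. ?F v y \<partial>G) \<le> A * B" for v
  proof -
    have Fvm: "?F v \<in> borel_measurable G"
      unfolding U_def V_def
      by (intro borel_measurable_times obs_comp[OF bobs_obs[OF f]] obs_comp[OF bobs_obs[OF h]]
        borel_measurable_add borel_measurable_const component_measurable)
    have b: "\<bar>?F v y\<bar> \<le> A * B" for y unfolding abs_mult using A B by (intro mult_mono) auto
    have i: "integrable G (?F v)" by (rule G.integrable_const_bound[of _ "A * B"]) (use b Fvm in auto)
    have "norm (\<integral>y. ?F v y \<partial>G) \<le> (\<integral>y. norm (?F v y) \<partial>G)" by simp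
    also have "\<dots> \<le> (\<integral>y. A * B \<partial>G)" using b i by (intro integral_mono integrable_norm) auto
    finally show ?thesis by (simp add: G.prob_space)
  qed
  show I1: ?I1 by (rule GGG.integrable_const_bound[of _ "A * B"]) (use m Fb in auto)
  have "(\<lambda>v. S (sqrt e) f (U v) * S (sqrt e) h (V v)) \<in> borel_measurable (G \<Otimes>\<^sub>M (G \<Otimes>\<^sub>M G))"
    unfolding U_def V_def
    by (intro borel_measurable_times obs_comp[OF bobs_obs[OF Sef(1)]] obs_comp[OF bobs_obs[OF Sef(2)]]) measurable
  moreover have "\<bar>S (sqrt e) f (U v) * S (sqrt e) h (V v)\<bar> \<le> A' * B'" for v
    unfolding abs_mult using A' B' by (intro mult_mono) auto
  ultimately show I2: ?I2 by (intro GGG.integrable_const_bound[of _ "A' * B'"]) auto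
  show ?E1
    using GGG.integral_fst'[OF I1] integral_T_split(1)[OF f h r e re s] by (simp add: U_def V_def)
  show ?E2
    using GGG.integral_fst'[OF I2] integral_T_split(2)[OF f h r e re s] by (simp add: U_def V_def)
qed

lemma T_sum:
  assumes "finite J" "\<And>j. j \<in> J \<Longrightarrow> bobs (f j)"
  shows "T k (\<lambda>g. \<Sum>j\<in>J. c j * f j g) g = (\<Sum>j\<in>J. c j * T k (f j) g)"
  unfolding T_def S_def
  using assms
  by (subst Bochner_Integration.integral_sum)
    (auto intro!: integrable_mult_right bobs_integrable_shift)

lemma bobs_sum:
  assumes "finite J" "\<And>j. j \<in> J \<Longrightarrow> bobs (f j)"
  shows "bobs (\<lambda>g. \<Sum>j\<in>J. c j * f j g)"
  using assms
proof (induction J rule: finite_induct)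
  case empty
  then show ?case by (auto simp: bobs_def obs_def)
next
  case (insert x J)
  have b: "bobs (f x)" "bobs (\<lambda>g. \<Sum>j\<in>J. c j * f j g)" using insert by auto
  obtain A where A: "\<And>g. \<bar>f x g\<bar> \<le> A" using b bobs_bound by blast
  obtain B where B: "\<And>g. \<bar>\<Sum>j\<in>J. c j * f j g\<bar> \<le> B" using b bobs_bound by blast
  have "\<bar>c x * f x g + (\<Sum>j\<in>J. c j * f j g)\<bar> \<le> \<bar>c x\<bar> * A + B" for g
    by (rule order_trans[OF abs_triangle_ineq add_mono]) (use A B in \<open>auto simp: abs_mult mult_left_mono\<close>)
  moreover have "obs (\<lambda>g. c x * f x g + (\<Sum>j\<in>J. c j * f j g))"
    using b[THEN bobs_obs] unfolding obs_def by auto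
  ultimately have "bobs (\<lambda>g. c x * f x g + (\<Sum>j\<in>J. c j * f j g))" unfolding bobs_def by blast
  then show ?case using insert by simp
qed

end

text \<open>The optimal parameter is \<open>sqrt y\<close>. It is not admissible for
  \<open>y = 0\<close>, where a positive \<open>x\<close> is refuted by taking \<open>x\<close>
  itself as the parameter.\<close>

lemma le_sqrt_of_amgm:
  fixes x y :: real
  assumes "\<And>\<theta>. 0 < \<theta> \<Longrightarrow> x \<le> (\<theta> + y / \<theta>) / 2" and "0 \<le> y"
  shows "x \<le> sqrt y"
proof (cases "y = 0")
  case False
  then have "0 < sqrt y" using assms(2) by simp
  from assms(1)[OF this] show ?thesis using assms(2) by (simp add: real_div_sqrt)
next
  case True
  have "x \<le> 0"
  proof (rule ccontr)
    assume "\<not> x \<le> 0"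
    then show False using assms(1)[of x] True by simp
  qed
  then show ?thesis using True by simp
qed

context gibbs_field
begin

text \<open>For \<open>0 \<le> r \<le> 1\<close> the integral is the probability of drawing the pair
  \<open>z\<close>, one configuration from the Gibbs measure of each of two disorders with
  correlation \<open>r\<close>. So this is the exponential moment of \<open>Q\<close> for two such
  replicas, and \<open>B\<close> below is the mean of \<open>Q\<close>.\<close>

definition \<psi> :: "real \<Rightarrow> real \<Rightarrow> real" where
  "\<psi> c r = (\<Sum>z\<in>K \<times> K. exp (c * Q (fst z) (snd z)) * (\<integral>g. T (sqrt r) (p (fst z)) g * T (sqrt r) (p (snd z)) g \<partial>G))"

definition B :: "real \<Rightarrow> real" where
  "B r = (\<Sum>z\<in>K \<times> K. Q (fst z) (snd z) * (\<integral>g. T (sqrt r) (p (fst z)) g * T (sqrt r) (p (snd z)) g \<partial>G))"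

lemma \<psi>_step:
  obtains C where "0 \<le> C" "\<And>c r h. 0 \<le> c \<Longrightarrow> c \<le> \<Lambda> \<Longrightarrow> 0 \<le> r \<Longrightarrow> 0 \<le> h \<Longrightarrow> r + h \<le> 1 \<Longrightarrow>
    \<psi> c (r + h) \<le> \<psi> (c + 2 * b\<^sup>2 * h) r + C * sqrt h ^ 3"
proof -
  define C where "C = real (card (K \<times> K)) * exp (\<Lambda> * card I) * (56 * b ^ 3 * m3 + 64 * b ^ 4 * m2\<^sup>2 + 32 * b ^ 4 * card I * m2)"
  have C0: "0 \<le> C" unfolding C_def using b_nonneg m_nonneg by simp
  have "\<psi> c (r + h) \<le> \<psi> (c + 2 * b\<^sup>2 * h) r + C * sqrt h ^ 3"
    if c: "0 \<le> c" "c \<le> \<Lambda>" and r: "0 \<le> r" and h: "0 \<le> h" and rh: "r + h \<le> 1" for c r h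
  proof -
    define s where "s = sqrt (1 - r - h)"
    let ?U = "\<lambda>v i. sqrt r * fst v i + s * fst (snd v) i"
    let ?V = "\<lambda>v i. sqrt r * fst v i + s * snd (snd v) i"
    let ?M = "G \<Otimes>\<^sub>M (G \<Otimes>\<^sub>M G)"
    let ?F = "\<lambda>z v. \<integral>y. p (fst z) (\<lambda>i. ?U v i + sqrt h * y i) * p (snd z) (\<lambda>i. ?V v i + sqrt h * y i) \<partial>G"
    let ?H = "\<lambda>z v. S (sqrt h) (p (fst z)) (?U v) * S (sqrt h) (p (snd z)) (?V v)"
    note J = S_scaled_joint[OF bobs_p bobs_p r h rh s_def]
    have e: "0 \<le> sqrt h" "sqrt h \<le> 1" using h r rh by auto
    have iF: "integrable ?M (?F z)" and iH: "integrable ?M (?H z)" if "z \<in> K \<times> K" for z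
      using J(1)[of "fst z" "snd z"] J(3)[of "fst z" "snd z"] that by auto
    have sq: "2 * (sqrt h * b)\<^sup>2 = 2 * b\<^sup>2 * h" using h by (simp add: power_mult_distrib)
    have "\<psi> c (r + h) = (\<Sum>z\<in>K \<times> K. exp (c * Q (fst z) (snd z)) * (\<integral>v. ?F z v \<partial>?M))"
      unfolding \<psi>_def by (intro sum.cong refl arg_cong2[where f = "(*)"] J(2)) auto
    also have "\<dots> = (\<integral>v. (\<Sum>z\<in>K \<times> K. exp (c * Q (fst z) (snd z)) * ?F z v) \<partial>?M)"
      using iF by (subst Bochner_Integration.integral_sum) auto
    also have "\<dots> \<le> (\<integral>v. (\<Sum>z\<in>K \<times> K. exp ((c + 2 * b\<^sup>2 * h) * Q (fst z) (snd z)) * ?H z v) + C * sqrt h ^ 3 \<partial>?M)"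
    proof (rule integral_mono)
      show "integrable ?M (\<lambda>v. \<Sum>z\<in>K \<times> K. exp (c * Q (fst z) (snd z)) * ?F z v)"
        using iF by (intro Bochner_Integration.integrable_sum integrable_mult_right) auto
      show "integrable ?M (\<lambda>v. (\<Sum>z\<in>K \<times> K. exp ((c + 2 * b\<^sup>2 * h) * Q (fst z) (snd z)) * ?H z v) + C * sqrt h ^ 3)"
        using iH by (intro Bochner_Integration.integrable_add Bochner_Integration.integrable_sum integrable_mult_right GGG.integrable_const) auto
      show "(\<Sum>z\<in>K \<times> K. exp (c * Q (fst z) (snd z)) * ?F z v)
        \<le> (\<Sum>z\<in>K \<times> K. exp ((c + 2 * b\<^sup>2 * h) * Q (fst z) (snd z)) * ?H z v) + C * sqrt h ^ 3" for v
        using local_step[OF c e, of "?U v" "?V v"] unfolding sq C_def .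
    qed
    also have "\<dots> = (\<Sum>z\<in>K \<times> K. exp ((c + 2 * b\<^sup>2 * h) * Q (fst z) (snd z)) * (\<integral>v. ?H z v \<partial>?M)) + C * sqrt h ^ 3"
    proof -
      have "integrable ?M (\<lambda>v. exp ((c + 2 * b\<^sup>2 * h) * Q (fst z) (snd z)) * ?H z v)" if "z \<in> K \<times> K" for z
        using iH[OF that] by (rule integrable_mult_right)
      then show ?thesis
        by (simp add: Bochner_Integration.integral_add[OF Bochner_Integration.integrable_sum GGG.integrable_const]
          Bochner_Integration.integral_sum GGG.prob_space)
    qed
    also have "\<dots> = \<psi> (c + 2 * b\<^sup>2 * h) r + C * sqrt h ^ 3"
      unfolding \<psi>_def by (intro arg_cong2[where f = "(+)"] sum.cong refl arg_cong2[where f = "(*)"] J(4)[symmetric]) auto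
    finally show ?thesis .
  qed
  with C0 that show ?thesis by blast
qed

text \<open>Split \<open>r\<close> into \<open>n\<close> equal steps. The exponents paid add up to
  \<open>2 * b\<^sup>2 * r\<close> whatever \<open>n\<close> is, while the errors, of order
  \<open>(r / n) powr (3/2)\<close> each, add up to a quantity vanishing as \<open>n\<close> grows.
  All intermediate exponents stay below \<open>c + 2 * b\<^sup>2 * r\<close>, so a single constant
  \<open>C\<close> serves for every step and every \<open>n\<close>.\<close>

lemma \<psi>_le_init:
  assumes c: "0 \<le> c" and r: "0 \<le> r" "r \<le> 1"
  shows "\<psi> c r \<le> \<psi> (c + 2 * b\<^sup>2 * r) 0"
proof -
  obtain C where C: "0 \<le> C" and step: "\<And>c' r' h. 0 \<le> c' \<Longrightarrow> c' \<le> c + 2 * b\<^sup>2 * r \<Longrightarrow> 0 \<le> r' \<Longrightarrow> 0 \<le> h \<Longrightarrow> r' + h \<le> 1 \<Longrightarrow>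
    \<psi> c' (r' + h) \<le> \<psi> (c' + 2 * b\<^sup>2 * h) r' + C * sqrt h ^ 3"
    using \<psi>_step[of "c + 2 * b\<^sup>2 * r"] by blast
  \<comment> \<open>Each step lowers the correlation and raises the exponent, hence the induction
    with \<open>c'\<close> arbitrary.\<close>
  have iter: "\<psi> c' (real j * h) \<le> \<psi> (c' + 2 * b\<^sup>2 * (real j * h)) 0 + real j * (C * sqrt h ^ 3)"
    if "0 \<le> c'" "0 \<le> h" "real j * h \<le> 1" "c' + 2 * b\<^sup>2 * (real j * h) \<le> c + 2 * b\<^sup>2 * r" for c' h j
    using that
  proof (induction j arbitrary: c')
    case (Suc j)
    have e: "real (Suc j) * h = real j * h + h" by (simp add: algebra_simps)
    have b2: "0 \<le> 2 * b\<^sup>2 * (real j * h)" "0 \<le> 2 * b\<^sup>2 * h" using Suc.prems by auto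
    have q: "c' + 2 * b\<^sup>2 * h + 2 * b\<^sup>2 * (real j * h) \<le> c + 2 * b\<^sup>2 * r" "real j * h + h \<le> 1" "0 \<le> real j * h"
      using Suc.prems by (simp_all add: e algebra_simps)
    have "\<psi> c' (real (Suc j) * h) \<le> \<psi> (c' + 2 * b\<^sup>2 * h) (real j * h) + C * sqrt h ^ 3"
      unfolding e by (intro step) (use Suc.prems(1,2) b2 q in linarith)+
    also have "\<psi> (c' + 2 * b\<^sup>2 * h) (real j * h)
      \<le> \<psi> (c' + 2 * b\<^sup>2 * h + 2 * b\<^sup>2 * (real j * h)) 0 + real j * (C * sqrt h ^ 3)"
      by (intro Suc.IH) (use Suc.prems(1,2) b2 q in linarith)+
    finally show ?case by (simp add: algebra_simps)
  qed simp
  have "\<psi> c r \<le> \<psi> (c + 2 * b\<^sup>2 * r) 0 + C * r * sqrt (r / real n)" if n: "n \<ge> 1" for n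
  proof -
    have nr: "real n * (r / real n) = r" using n by simp
    have "\<psi> c r \<le> \<psi> (c + 2 * b\<^sup>2 * r) 0 + real n * (C * sqrt (r / real n) ^ 3)"
      using iter[of c "r / real n" n] c r n by (simp add: nr)
    also have "real n * (C * sqrt (r / real n) ^ 3) = C * (real n * (r / real n)) * sqrt (r / real n)"
      using r by (simp add: power3_eq_cube)
    finally show ?thesis by (simp only: nr)
  qed
  moreover have "(\<lambda>n. \<psi> (c + 2 * b\<^sup>2 * r) 0 + C * r * sqrt (r / real n)) \<longlonglongrightarrow> \<psi> (c + 2 * b\<^sup>2 * r) 0 + C * r * sqrt 0"
    by (intro tendsto_intros lim_const_over_n)
  ultimately show ?thesis
    using LIMSEQ_le_const[of _ "\<psi> (c + 2 * b\<^sup>2 * r) 0 + C * r * sqrt 0" "\<psi> c r"] by fastforce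
qed

text \<open>At correlation 0 the disorders are independent, so each replica follows the averaged
  Gibbs measure, which the hypothesis makes uniform.\<close>

lemma \<psi>_init:
  assumes "\<And>x. x \<in> K \<Longrightarrow> (\<integral>g. p x g \<partial>G) = 1 / card K"
  shows "\<psi> c 0 = (\<Sum>z\<in>K \<times> K. exp (c * Q (fst z) (snd z))) / (card K)\<^sup>2"
proof -
  have "T 0 (p x) g = 1 / card K" if "x \<in> K" for x g
    using assms[OF that] by (simp add: T_def S_def)
  then have "\<psi> c 0 = (\<Sum>z\<in>K \<times> K. exp (c * Q (fst z) (snd z)) * (1 / card K * (1 / card K)))"
    unfolding \<psi>_def by (intro sum.cong refl) (auto simp: G.prob_space)
  then show ?thesis by (simp add: sum_divide_distrib power2_eq_square)
qed

lemma T_p_nonneg: "x \<in> K \<Longrightarrow> 0 \<le> T k (p x) g"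
  unfolding T_def by (rule S_p_bounds)

lemma sum_T_p: "(\<Sum>x\<in>K. T k (p x) g) = 1"
  using T_sum[of K p k "\<lambda>_. 1" g] finK bobs_p by (simp add: sum_p) (simp add: T_def S_def G.prob_space)

lemma B_le_\<psi>: "c * B r \<le> \<psi> c r"
  unfolding B_def \<psi>_def sum_distrib_left
proof (rule sum_mono)
  fix z assume z: "z \<in> K \<times> K"
  have "c * Q (fst z) (snd z) \<le> exp (c * Q (fst z) (snd z))"
    using exp_ge_add_one_self[of "c * Q (fst z) (snd z)"] by linarith
  moreover have "0 \<le> (\<integral>g. T (sqrt r) (p (fst z)) g * T (sqrt r) (p (snd z)) g \<partial>G)"
    using T_p_nonneg z by (intro integral_nonneg_AE AE_I2 mult_nonneg_nonneg) auto
  ultimately show "c * (Q (fst z) (snd z) * (\<integral>g. T (sqrt r) (p (fst z)) g * T (sqrt r) (p (snd z)) g \<partial>G))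
    \<le> exp (c * Q (fst z) (snd z)) * (\<integral>g. T (sqrt r) (p (fst z)) g * T (sqrt r) (p (snd z)) g \<partial>G)"
    by (simp add: mult_right_mono flip: mult.assoc)
qed

text \<open>The Gibbs mean of coordinate \<open>i\<close>; for the quadratic field and
  \<open>i = (k, l)\<close> this is the two-point function of the sites \<open>k\<close> and
  \<open>l\<close>.\<close>

definition mag :: "'i \<Rightarrow> ('i \<Rightarrow> real) \<Rightarrow> real" where
  "mag i g = (\<Sum>x\<in>K. s x i * p x g)"

lemma bobs_mag: "bobs (mag i)"
  unfolding mag_def[abs_def] by (intro bobs_sum finK bobs_p)

lemma mag_sq: assumes "i \<in> I" shows "(mag i g)\<^sup>2 \<le> 1"
proof -
  have "\<bar>mag i g\<bar> \<le> (\<Sum>x\<in>K. 1 * p x g)" unfolding mag_def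
    using s_bound assms p_nonneg by (intro order_trans[OF sum_abs] sum_mono) (auto simp: abs_mult intro!: mult_left_le_one_le)
  then show ?thesis by (simp add: sum_p abs_square_le_1)
qed

text \<open>Expanding \<open>Q\<close> over coordinates turns the replica quantity into a sum of
  autocorrelations of bounded functions, to which \<open>corr_le_sq\<close> applies.\<close>

lemma B_eq:
  assumes r: "0 \<le> r" "r \<le> 1"
  shows "B r = (\<Sum>i\<in>I. \<integral>g. mag i g * T r (mag i) g \<partial>G)"
proof -
  let ?t = "\<lambda>x. T (sqrt r) (p x)"
  have it: "integrable G (\<lambda>g. ?t x g * ?t y g)" if "x \<in> K" "y \<in> K" for x y
    using that by (intro bobs_integrable_G bobs_mult bobs_T bobs_p)
  have "(\<integral>g. mag i g * T r (mag i) g \<partial>G) = (\<Sum>z\<in>K \<times> K. s (fst z) i * s (snd z) i * (\<integral>g. ?t (fst z) g * ?t (snd z) g \<partial>G))" for i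
  proof -
    have "(\<integral>g. mag i g * T r (mag i) g \<partial>G) = (\<integral>g. T (sqrt r) (mag i) g * T (sqrt r) (mag i) g \<partial>G)"
      using integral_T_T[OF bobs_mag bobs_mag, of "sqrt r" i i] r by simp
    also have "\<dots> = (\<integral>g. (\<Sum>x\<in>K. s x i * ?t x g) * (\<Sum>x\<in>K. s x i * ?t x g) \<partial>G)"
      unfolding mag_def[abs_def] by (simp add: T_sum[OF finK bobs_p])
    also have "\<dots> = (\<integral>g. (\<Sum>z\<in>K \<times> K. s (fst z) i * s (snd z) i * (?t (fst z) g * ?t (snd z) g)) \<partial>G)"
      unfolding sum_product sum.cartesian_product by (simp add: case_prod_beta mult_ac)
    also have "\<dots> = (\<Sum>z\<in>K \<times> K. s (fst z) i * s (snd z) i * (\<integral>g. ?t (fst z) g * ?t (snd z) g \<partial>G))"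
      using it by (subst Bochner_Integration.integral_sum) auto
    finally show ?thesis .
  qed
  then have "(\<Sum>i\<in>I. \<integral>g. mag i g * T r (mag i) g \<partial>G)
      = (\<Sum>z\<in>K \<times> K. \<Sum>i\<in>I. s (fst z) i * s (snd z) i * (\<integral>g. ?t (fst z) g * ?t (snd z) g \<partial>G))"
    by (simp add: sum.swap[of _ I])
  also have "\<dots> = B r"
    unfolding B_def Q_def by (simp add: sum_distrib_right)
  finally show ?thesis ..
qed

lemma B_nonneg: "0 \<le> B r"
  unfolding B_def using Q_nonneg T_p_nonneg
  by (intro sum_nonneg mult_nonneg_nonneg integral_nonneg_AE AE_I2) auto

text \<open>Cauchy-Schwarz in each coordinate with one common parameter, \<open>mag\<close> being at
  most 1 in absolute value. After division by \<open>card I\<close> the constant disappears, so the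
  inequality can be iterated without loss.\<close>

lemma B_le_sqrt:
  assumes r: "0 \<le> r" "r \<le> 1"
  shows "(B r)\<^sup>2 \<le> card I * B (r\<^sup>2)"
proof -
  have r2: "r\<^sup>2 \<le> 1" using r by (simp add: power_le_one)
  have "B r \<le> sqrt (card I * B (r\<^sup>2))"
  proof (cases "I = {}")
    case True
    then show ?thesis using B_eq[OF r] by simp
  next
    case False
    then have cI: "0 < card I" using fin by (simp add: card_gt_0_iff)
    show ?thesis
    proof (rule le_sqrt_of_amgm)
      fix \<theta> :: real assume \<theta>: "0 < \<theta>"
      define t where "t = \<theta> / card I"
      have t: "0 < t" using \<theta> cI by (simp add: t_def)
      have sq: "(\<integral>g. (mag i g)\<^sup>2 \<partial>G) \<le> 1" if "i \<in> I" for i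
      proof -
        have "(\<integral>g. (mag i g)\<^sup>2 \<partial>G) \<le> (\<integral>g. 1 \<partial>G)"
          using mag_sq[OF that] bobs_integrable_G[OF bobs_mult[OF bobs_mag bobs_mag]]
          by (intro integral_mono) (auto simp: power2_eq_square)
        then show ?thesis by (simp add: G.prob_space)
      qed
      have "B r \<le> (\<Sum>i\<in>I. (t * (\<integral>g. (mag i g)\<^sup>2 \<partial>G) + (\<integral>g. mag i g * T (r\<^sup>2) (mag i) g \<partial>G) / t) / 2)"
        unfolding B_eq[OF r] by (intro sum_mono corr_le_sq bobs_mag r t)
      also have "\<dots> \<le> (\<Sum>i\<in>I. (t * 1 + (\<integral>g. mag i g * T (r\<^sup>2) (mag i) g \<partial>G) / t) / 2)"
        using sq t by (intro sum_mono divide_right_mono add_mono mult_left_mono) auto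
      also have "\<dots> = (card I * t + B (r\<^sup>2) / t) / 2"
        unfolding B_eq[OF zero_le_power2 r2] by (simp add: sum_divide_distrib[symmetric] sum.distrib)
      also have "\<dots> = (\<theta> + card I * B (r\<^sup>2) / \<theta>) / 2" using cI by (simp add: t_def)
      finally show "B r \<le> (\<theta> + card I * B (r\<^sup>2) / \<theta>) / 2" .
    qed (simp add: B_nonneg)
  qed
  then show ?thesis using power_mono[OF _ B_nonneg, of r "sqrt (card I * B (r\<^sup>2))" 2] B_nonneg by simp
qed

lemma B_iterate:
  assumes r: "0 \<le> r" "r \<le> 1" and I: "I \<noteq> {}"
  shows "(B r / card I) ^ (2 ^ m) \<le> B (r ^ (2 ^ m)) / card I"
  using r
proof (induction m arbitrary: r)
  case (Suc m)
  have cI: "0 < card I" using I fin by (simp add: card_gt_0_iff)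
  have "(B r / card I) ^ (2 ^ Suc m) = ((B r / card I)\<^sup>2) ^ (2 ^ m)" by (simp add: power_mult)
  also have "\<dots> \<le> (B (r\<^sup>2) / card I) ^ (2 ^ m)"
  proof (intro power_mono)
    show "(B r / card I)\<^sup>2 \<le> B (r\<^sup>2) / card I"
      using B_le_sqrt[OF Suc.prems] cI by (simp add: power_divide power2_eq_square field_simps)
  qed simp
  also have "\<dots> \<le> B ((r\<^sup>2) ^ (2 ^ m)) / card I" using Suc.prems by (intro Suc.IH) (auto simp: power_le_one)
  finally show ?case by (simp add: power_mult)
qed simp

text \<open>Entropy bound. The maximiser contributes 1 to \<open>Z\<close>, so
  \<open>d x = - ln (p x g) - ln Z\<close> is at most \<open>- ln (p x g)\<close>; hence the mean of
  \<open>d\<close> is at most the entropy of the Gibbs weights, which is at most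
  \<open>ln (card K)\<close>.\<close>

lemma gibbs_energy:
  assumes b: "0 < b" and m: "m \<in> K" "\<And>x. x \<in> K \<Longrightarrow> lin (s x) g \<le> lin (s m) g"
  shows "lin (s m) g - (\<Sum>x\<in>K. p x g * lin (s x) g) \<le> ln (card K) / b"
proof -
  define d where "d x = b * (lin (s m) g - lin (s x) g)" for x
  define Z where "Z = (\<Sum>x\<in>K. exp (- d x))"
  have n0: "0 < card K" using finK K_ne by (simp add: card_gt_0_iff)
  have "exp (- d m) \<le> Z" unfolding Z_def using m finK by (intro member_le_sum) auto
  then have Z1: "1 \<le> Z" by (simp add: d_def)
  have "(\<Sum>y\<in>K. exp (b * lin (s y) g)) = exp (b * lin (s m) g) * Z"
    unfolding Z_def sum_distrib_left d_def by (simp add: exp_add[symmetric] algebra_simps)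
  then have p: "p x g = exp (- d x) / Z" for x
    unfolding p_def using Z1 by (simp add: d_def exp_diff exp_minus field_simps)
  \<comment> \<open>Entropy compared with the uniform weights pointwise, through
    \<open>ln y \<le> y - 1\<close>; the last bracket sums to 0 over \<open>K\<close>.\<close>
  have key: "p x g * d x \<le> p x g * ln (card K) + (1 / card K - p x g)" for x
  proof -
    have pp: "0 < p x g" unfolding p using Z1 by simp
    have "ln (1 / (card K * p x g)) \<le> 1 / (card K * p x g) - 1"
      using n0 pp by (intro ln_le_minus_one) simp
    moreover have "ln (1 / (card K * p x g)) = - ln (card K) + (d x + ln Z)"
      using n0 pp Z1 by (simp add: ln_div ln_mult p)
    moreover have "0 \<le> ln Z" using Z1 by simp
    ultimately have "d x \<le> ln (card K) + (1 / (card K * p x g) - 1)" by linarith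
    then have "p x g * d x \<le> p x g * (ln (card K) + (1 / (card K * p x g) - 1))"
      using pp by (intro mult_left_mono) auto
    also have "\<dots> = p x g * ln (card K) + (1 / card K - p x g)" using pp by (simp add: field_simps)
    finally show ?thesis .
  qed
  have "b * (lin (s m) g - (\<Sum>x\<in>K. p x g * lin (s x) g)) = (\<Sum>x\<in>K. p x g) * (b * lin (s m) g) - b * (\<Sum>x\<in>K. p x g * lin (s x) g)"
    by (simp add: sum_p algebra_simps)
  also have "\<dots> = (\<Sum>x\<in>K. p x g * d x)"
    by (simp add: d_def sum_distrib_left sum_distrib_right sum_subtractf algebra_simps)
  also have "\<dots> \<le> (\<Sum>x\<in>K. p x g * ln (card K) + (1 / card K - p x g))" by (intro sum_mono key)
  also have "\<dots> = ln (card K)"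
    using n0 by (simp add: sum.distrib sum_subtractf sum_p flip: sum_distrib_right)
  finally show ?thesis using b by (simp add: field_simps)
qed

end

section \<open>Sampling from a product of weights\<close>

lemma sum_PiE_weights:
  fixes \<mu> :: "'a \<Rightarrow> real"
  assumes "finite K" "finite J"
  shows "(\<Sum>f\<in>J \<rightarrow>\<^sub>E K. (\<Prod>l\<in>J. \<mu> (f l)) * (\<Prod>l\<in>J. h l (f l))) = (\<Prod>l\<in>J. \<Sum>x\<in>K. \<mu> x * h l x)"
  using assms by (subst prod_sum_PiE) (auto simp: prod.distrib)

text \<open>First moment method: \<open>k\<close> independent draws from \<mu> have mean total cost
  below 1, so some outcome has cost below 1. All costs are nonnegative, so each single cost is then
  below 1 as well.\<close>

lemma exists_low_cost:
  fixes \<mu> v :: "'a \<Rightarrow> real" and h :: "'a \<Rightarrow> 'a \<Rightarrow> real"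
  assumes K: "finite K" and \<mu>0: "\<And>x. x \<in> K \<Longrightarrow> 0 \<le> \<mu> x" and \<mu>1: "sum \<mu> K = 1"
    and h0: "\<And>x y. x \<in> K \<Longrightarrow> y \<in> K \<Longrightarrow> 0 \<le> h x y" and v0: "\<And>x. x \<in> K \<Longrightarrow> 0 \<le> v x"
    and small: "(real k)\<^sup>2 * (\<Sum>z\<in>K \<times> K. \<mu> (fst z) * \<mu> (snd z) * h (fst z) (snd z)) + real k * (\<Sum>x\<in>K. \<mu> x * v x) < 1"
  obtains f where "f \<in> {..<k} \<rightarrow>\<^sub>E K" "\<And>i j. i < k \<Longrightarrow> j < k \<Longrightarrow> i \<noteq> j \<Longrightarrow> h (f i) (f j) < 1" "\<And>i. i < k \<Longrightarrow> v (f i) < 1"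
proof -
  let ?J = "{..<k}"
  let ?P = "?J \<rightarrow>\<^sub>E K"
  let ?w = "\<lambda>f. \<Prod>l\<in>?J. \<mu> (f l)"
  let ?q = "\<Sum>z\<in>K \<times> K. \<mu> (fst z) * \<mu> (snd z) * h (fst z) (snd z)" and ?u = "\<Sum>x\<in>K. \<mu> x * v x"
  let ?cost = "\<lambda>f. (\<Sum>z\<in>?J \<times> ?J. if fst z = snd z then 0 else h (f (fst z)) (f (snd z))) + (\<Sum>i\<in>?J. v (f i))"
  have finP: "finite ?P" using K by (intro finite_PiE) auto
  have w1: "(\<Sum>f\<in>?P. ?w f) = 1"
    using sum_PiE_weights[OF K, of ?J \<mu> "\<lambda>_ _. 1"] \<mu>1 by simp
  have w0: "0 \<le> ?w f" if "f \<in> ?P" for f using that \<mu>0 by (intro prod_nonneg) auto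
  have q0: "0 \<le> ?q" using \<mu>0 h0 by (intro sum_nonneg mult_nonneg_nonneg) auto
  have single: "(\<Sum>f\<in>?P. ?w f * v (f i)) = ?u" if i: "i \<in> ?J" for i
  proof -
    have "(\<Sum>f\<in>?P. ?w f * v (f i)) = (\<Sum>f\<in>?P. ?w f * (\<Prod>l\<in>?J. if l = i then v (f l) else 1))"
      using i by (intro sum.cong refl) (simp add: prod.delta)
    also have "\<dots> = (\<Prod>l\<in>?J. \<Sum>x\<in>K. \<mu> x * (if l = i then v x else 1))"
      by (rule sum_PiE_weights[OF K]) simp
    also have "\<dots> = (\<Prod>l\<in>?J. if l = i then ?u else 1)"
      using \<mu>1 by (intro prod.cong) auto
    also have "\<dots> = ?u" using i by (simp add: prod.delta)
    finally show ?thesis .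
  qed
  have pair: "(\<Sum>f\<in>?P. ?w f * h (f i) (f j)) = ?q" if i: "i \<in> ?J" and j: "j \<in> ?J" and ij: "i \<noteq> j" for i j
  proof -
    \<comment> \<open>\<open>h\<close> does not factor over the draws. Summing over the possible
      values of the pair introduces indicators that do.\<close>
    have "(\<Sum>f\<in>?P. ?w f * h (f i) (f j))
      = (\<Sum>f\<in>?P. \<Sum>z\<in>K \<times> K. h (fst z) (snd z) * (?w f * (of_bool (f i = fst z) * of_bool (f j = snd z))))"
    proof (intro sum.cong refl)
      fix f assume f: "f \<in> ?P"
      have "(\<Sum>z\<in>K \<times> K. h (fst z) (snd z) * (?w f * (of_bool (f i = fst z) * of_bool (f j = snd z))))
        = (\<Sum>z\<in>K \<times> K. if z = (f i, f j) then ?w f * h (f i) (f j) else 0)"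
        by (intro sum.cong) auto
      also have "\<dots> = ?w f * h (f i) (f j)" using f i j K by (subst sum.delta) (auto simp: PiE_def Pi_def)
      finally show "?w f * h (f i) (f j) = (\<Sum>z\<in>K \<times> K. h (fst z) (snd z) * (?w f * (of_bool (f i = fst z) * of_bool (f j = snd z))))" ..
    qed
    also have "\<dots> = (\<Sum>z\<in>K \<times> K. h (fst z) (snd z) * (\<Sum>f\<in>?P. ?w f * (of_bool (f i = fst z) * of_bool (f j = snd z))))"
      by (subst sum.swap) (simp add: sum_distrib_left)
    also have "\<dots> = (\<Sum>z\<in>K \<times> K. h (fst z) (snd z) * (\<mu> (fst z) * \<mu> (snd z)))"
    proof (intro sum.cong refl arg_cong2[where f = "(*)"])
      fix z assume z: "z \<in> K \<times> K"
      let ?g = "\<lambda>l x. (if l = i then of_bool (x = fst z) else 1) * (if l = j then of_bool (x = snd z) else (1::real))"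
      have "(\<Sum>f\<in>?P. ?w f * (of_bool (f i = fst z) * of_bool (f j = snd z))) = (\<Sum>f\<in>?P. ?w f * (\<Prod>l\<in>?J. ?g l (f l)))"
        using i j by (intro sum.cong refl) (simp add: prod.distrib prod.delta)
      also have "\<dots> = (\<Prod>l\<in>?J. \<Sum>x\<in>K. \<mu> x * ?g l x)"
        by (rule sum_PiE_weights[OF K]) simp
      also have "\<dots> = (\<Prod>l\<in>?J. (if l = i then \<mu> (fst z) else 1) * (if l = j then \<mu> (snd z) else 1))"
      proof (intro prod.cong refl)
        fix l
        have d: "(\<Sum>x\<in>K. \<mu> x * of_bool (x = a)) = \<mu> a" if "a \<in> K" for a
          using that K by (simp add: of_bool_def if_distrib[of "(*) _"] cong: if_cong)
        show "(\<Sum>x\<in>K. \<mu> x * ?g l x) = (if l = i then \<mu> (fst z) else 1) * (if l = j then \<mu> (snd z) else 1)"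
          using z ij \<mu>1 d by (cases "l = i"; cases "l = j") auto
      qed
      also have "\<dots> = \<mu> (fst z) * \<mu> (snd z)" using i j by (simp add: prod.distrib prod.delta)
      finally show "(\<Sum>f\<in>?P. ?w f * (of_bool (f i = fst z) * of_bool (f j = snd z))) = \<mu> (fst z) * \<mu> (snd z)" .
    qed
    finally show ?thesis by (simp add: mult_ac)
  qed
  have "(\<Sum>f\<in>?P. ?w f * ?cost f) = (\<Sum>z\<in>?J \<times> ?J. \<Sum>f\<in>?P. if fst z = snd z then 0 else ?w f * h (f (fst z)) (f (snd z)))
      + (\<Sum>i\<in>?J. \<Sum>f\<in>?P. ?w f * v (f i))"
    by (simp add: distrib_left sum.distrib sum_distrib_left sum.swap[of _ ?P] if_distrib[of "(*) _"] cong: if_cong)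
  also have "\<dots> \<le> (\<Sum>z\<in>?J \<times> ?J. ?q) + (\<Sum>i\<in>?J. ?u)"
  proof (intro add_mono sum_mono)
    fix z assume z: "z \<in> ?J \<times> ?J"
    show "(\<Sum>f\<in>?P. if fst z = snd z then 0 else ?w f * h (f (fst z)) (f (snd z))) \<le> ?q"
      using z q0 pair[of "fst z" "snd z"] by (cases "fst z = snd z") auto
  qed (simp add: single)
  also have "\<dots> < 1" using small by (simp add: power2_eq_square)
  finally have "(\<Sum>f\<in>?P. ?w f * ?cost f) < (\<Sum>f\<in>?P. ?w f * 1)" using w1 by simp
  then have "\<exists>f\<in>?P. ?w f * ?cost f < ?w f * 1"
    using sum_mono[of ?P "\<lambda>f. ?w f * 1" "\<lambda>f. ?w f * ?cost f"] by (meson not_le)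
  then obtain f where f: "f \<in> ?P" and lt: "?w f * ?cost f < ?w f * 1" by blast
  have c1: "?cost f < 1"
  proof (rule ccontr)
    assume "\<not> ?cost f < 1"
    then have "?w f * 1 \<le> ?w f * ?cost f" using w0[OF f] by (intro mult_left_mono) auto
    then show False using lt by linarith
  qed
  have fK: "f i \<in> K" if "i < k" for i using f that by auto
  have n1: "0 \<le> (\<Sum>i\<in>?J. v (f i))" using v0 fK by (intro sum_nonneg) auto
  have n2: "0 \<le> (\<Sum>z\<in>?J \<times> ?J. if fst z = snd z then 0 else h (f (fst z)) (f (snd z)))"
    using h0 fK by (intro sum_nonneg) auto
  have "h (f i) (f j) < 1" if "i < k" "j < k" "i \<noteq> j" for i j
  proof -
    have "h (f i) (f j) \<le> (\<Sum>z\<in>?J \<times> ?J. if fst z = snd z then 0 else h (f (fst z)) (f (snd z)))"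
      using member_le_sum[of "(i, j)" "?J \<times> ?J" "\<lambda>z. if fst z = snd z then 0 else h (f (fst z)) (f (snd z))"] that h0 fK by auto
    then show ?thesis using c1 n1 by linarith
  qed
  moreover have "v (f i) < 1" if "i < k" for i
  proof -
    have "v (f i) \<le> (\<Sum>i\<in>?J. v (f i))" using that v0 fK by (intro member_le_sum) auto
    then show ?thesis using c1 n2 by linarith
  qed
  ultimately show ?thesis using that f by blast
qed

section \<open>Configurations\<close>

lemma cube_sq: "\<sigma> \<in> cube N \<Longrightarrow> i \<in> {1..N} \<Longrightarrow> \<sigma> i * \<sigma> i = 1"
  unfolding cube_def by (auto dest!: PiE_mem)

lemma cube_abs: "\<sigma> \<in> cube N \<Longrightarrow> i \<in> {1..N} \<Longrightarrow> \<bar>\<sigma> i\<bar> = 1"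
  unfolding cube_def by (auto dest!: PiE_mem)

lemma card_cube: "card (cube N) = 2 ^ N"
  unfolding cube_def by (subst card_PiE) (auto simp: numeral_2_eq_2)

text \<open>The group law of the cube, restricted to the sites so that products stay extensional; it
  carries the gauge symmetry used in \<open>integral_p\<close>.\<close>

definition cmul :: "nat \<Rightarrow> (nat \<Rightarrow> real) \<Rightarrow> (nat \<Rightarrow> real) \<Rightarrow> nat \<Rightarrow> real" where
  "cmul N \<rho> \<sigma> = (\<lambda>i\<in>{1..N}. \<rho> i * \<sigma> i)"

lemma cmul_in:
  assumes "\<rho> \<in> cube N" "\<sigma> \<in> cube N"
  shows "cmul N \<rho> \<sigma> \<in> cube N"
  unfolding cube_def cmul_def
proof (rule restrict_PiE_iff[THEN iffD2], rule ballI)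
  fix i assume i: "i \<in> {1..N}"
  have "\<rho> i \<in> {-1, 1}" "\<sigma> i \<in> {-1, 1}" using assms i unfolding cube_def by (auto dest!: PiE_mem)
  then show "\<rho> i * \<sigma> i \<in> {-1, 1}" by auto
qed

lemma cmul_cmul: "\<rho> \<in> cube N \<Longrightarrow> \<sigma> \<in> cube N \<Longrightarrow> cmul N \<rho> (cmul N \<rho> \<sigma>) = \<sigma>"
  using cube_sq[of \<rho> N] unfolding cmul_def
  by (auto simp: fun_eq_iff cube_def PiE_iff extensional_def restrict_def simp flip: mult.assoc)

lemma cmul_comm: "cmul N \<rho> \<sigma> = cmul N \<sigma> \<rho>"
  unfolding cmul_def by (auto simp: mult.commute)

lemma bij_cmul: "\<rho> \<in> cube N \<Longrightarrow> bij_betw (cmul N \<rho>) (cube N) (cube N)"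
  by (rule bij_betw_byWitness[where f' = "cmul N \<rho>"]) (auto simp: cmul_cmul cmul_in)

lemma exp_plus_exp_minus_le: "exp x + exp (- x) \<le> 2 * exp (x\<^sup>2 / 2)" for x :: real
proof -
  have *: "exp y + exp (- y) \<le> 2 * exp (y\<^sup>2 / 2)" if y: "0 \<le> y" for y :: real
  proof -
    have pos: "0 < 1 + 1 / 2 * (exp (2 * y) - 1)" 
      using add_pos_pos[OF zero_less_one exp_gt_zero[of "2 * y"]] by (simp add: field_simps)
    \<comment> \<open>Hoeffding's lemma for a fair sign taking the values \<open>- y\<close> and
      \<open>y\<close>: width \<open>2 * y\<close>, probability \<open>1 / 2\<close>.\<close>
    have "- (2 * y) * (1 / 2) + ln (1 + 1 / 2 * (exp (2 * y) - 1)) \<le> (2 * y)\<^sup>2 / 8"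
      using y by (intro Hoeffdings_lemma_aux) auto
    then have "exp (ln (1 + 1 / 2 * (exp (2 * y) - 1))) \<le> exp (y + y\<^sup>2 / 2)"
      by (simp add: power_mult_distrib)
    then have "1 + 1 / 2 * (exp (2 * y) - 1) \<le> exp y * exp (y\<^sup>2 / 2)"
      using pos by (simp add: exp_add)
    then have "1 + exp (2 * y) \<le> 2 * (exp y * exp (y\<^sup>2 / 2))" by (simp add: field_simps)
    then have "(1 + exp (2 * y)) * exp (- y) \<le> 2 * (exp y * exp (y\<^sup>2 / 2)) * exp (- y)"
      by (intro mult_right_mono) auto
    moreover have "(1 + exp (2 * y)) * exp (- y) = exp y + exp (- y)"
      by (simp add: distrib_right exp_add[symmetric])
    moreover have "2 * (exp y * exp (y\<^sup>2 / 2)) * exp (- y) = 2 * exp (y\<^sup>2 / 2)"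
      by (simp add: exp_add[symmetric] mult.assoc)
    ultimately show ?thesis by simp
  qed
  show ?thesis using *[of x] *[of "- x"] by (cases "0 \<le> x") auto
qed

text \<open>Gaussian linearisation of the square: \<open>exp (c * S\<^sup>2)\<close> is the mean of
  \<open>exp (sqrt (2 * c) * S * x)\<close> over a standard Gaussian \<open>x\<close>. The sum over
  the cube then factorises over sites, and the threshold \<open>1 / 4\<close> leaves the integrable
  \<open>exp (x\<^sup>2 / 4)\<close>.\<close>

lemma sum_exp_overlap_sq:
  assumes \<sigma>: "\<sigma> \<in> cube N" and c: "0 \<le> c" "c * N \<le> 1 / 4"
  shows "(\<Sum>\<tau>\<in>cube N. exp (c * (\<Sum>i=1..N. \<sigma> i * \<tau> i)\<^sup>2)) \<le> sqrt 2 * 2 ^ N"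
proof -
  define a where "a = sqrt (2 * c)"
  have a2: "a\<^sup>2 = 2 * c" using c by (simp add: a_def)
  let ?S = "\<lambda>\<tau>. \<Sum>i=1..N. \<sigma> i * \<tau> i"
  have "(\<Sum>\<tau>\<in>cube N. exp (c * (?S \<tau>)\<^sup>2)) = (\<Sum>\<tau>\<in>cube N. \<integral>x. exp ((a * ?S \<tau>) * x) \<partial>std_gaussian)"
    by (simp add: std_gaussian_mgf power_mult_distrib a2)
  also have "\<dots> = (\<integral>x. (\<Sum>\<tau>\<in>cube N. exp ((a * ?S \<tau>) * x)) \<partial>std_gaussian)"
    by (subst Bochner_Integration.integral_sum) (auto simp: std_gaussian_mgf)
  also have "\<dots> \<le> (\<integral>x. 2 ^ N * exp (x\<^sup>2 / 4) \<partial>std_gaussian)"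
  proof (rule integral_mono)
    show "integrable std_gaussian (\<lambda>x. \<Sum>\<tau>\<in>cube N. exp ((a * ?S \<tau>) * x))"
      by (intro Bochner_Integration.integrable_sum std_gaussian_mgf)
    show "integrable std_gaussian (\<lambda>x. 2 ^ N * exp (x\<^sup>2 / 4) :: real)"
      using std_gaussian_exp_sq by simp
    fix x :: real
    have "(\<Sum>\<tau>\<in>cube N. exp ((a * ?S \<tau>) * x)) = (\<Sum>\<tau>\<in>cube N. \<Prod>i=1..N. exp (a * \<sigma> i * x * \<tau> i))"
      by (simp add: sum_distrib_left sum_distrib_right mult_ac flip: exp_sum)
    also have "\<dots> = (\<Prod>i=1..N. \<Sum>t\<in>{-1, 1}. exp (a * \<sigma> i * x * t))"
      unfolding cube_def by (subst prod_sum_PiE) auto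
    also have "\<dots> \<le> (\<Prod>i=1..N. 2 * exp ((a * x)\<^sup>2 / 2))"
    proof (intro prod_mono conjI)
      fix i assume i: "i \<in> {1..N}"
      have "exp (a * \<sigma> i * x) + exp (- (a * \<sigma> i * x)) \<le> 2 * exp ((a * \<sigma> i * x)\<^sup>2 / 2)"
        by (rule exp_plus_exp_minus_le)
      also have "(a * \<sigma> i * x)\<^sup>2 = (a * x)\<^sup>2 * (\<sigma> i * \<sigma> i)" by (simp add: power2_eq_square)
      finally show "(\<Sum>t\<in>{-1, 1}. exp (a * \<sigma> i * x * t)) \<le> 2 * exp ((a * x)\<^sup>2 / 2)"
        using cube_sq[OF \<sigma> i] by simp
    qed (auto intro: sum_nonneg)
    also have "\<dots> = 2 ^ N * exp (real N * (c * x\<^sup>2))"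
      by (simp add: power_mult_distrib a2 flip: exp_of_nat_mult)
    also have "\<dots> \<le> 2 ^ N * exp (x\<^sup>2 / 4)"
      using mult_right_mono[OF c(2), of "x\<^sup>2"] by (simp add: mult_ac)
    finally show "(\<Sum>\<tau>\<in>cube N. exp ((a * ?S \<tau>) * x)) \<le> 2 ^ N * exp (x\<^sup>2 / 4)" .
  qed
  also have "\<dots> = sqrt 2 * 2 ^ N" by (simp add: std_gaussian_exp_sq)
  finally show ?thesis .
qed

section \<open>The quadratic field on the cube\<close>

text \<open>The rank one tensor of \<sigma>: the field is linear in the disorder with these
  coefficients, and scalar products of such tensors are squares.\<close>

definition sp :: "(nat \<Rightarrow> real) \<Rightarrow> nat \<times> nat \<Rightarrow> real" where
  "sp \<sigma> e = \<sigma> (fst e) * \<sigma> (snd e)"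

lemma sum_sp: "(\<Sum>e\<in>{1..N} \<times> {1..N}. sp \<sigma> e * sp \<tau> e) = (\<Sum>i=1..N. \<sigma> i * \<tau> i)\<^sup>2"
  unfolding sp_def power2_eq_square sum_product sum.cartesian_product
  by (intro sum.cong) (auto simp: mult_ac)

declare One_nat_def [simp del]

locale sk =
  fixes N :: nat and b :: real
  assumes N_pos: "1 \<le> N" and b_pos: "0 < b"
begin

sublocale gibbs_field "{1..N} \<times> {1..N}" "cube N" sp b
proof
  fix x y :: "nat \<Rightarrow> real" and i
  assume x: "x \<in> cube N"
  show "\<bar>sp x i\<bar> \<le> 1" if "i \<in> {1..N} \<times> {1..N}"
    using cube_abs[OF x, of "fst i"] cube_abs[OF x, of "snd i"] that by (auto simp: sp_def abs_mult)
  show "0 \<le> (\<Sum>i\<in>{1..N} \<times> {1..N}. sp x i * sp y i)" by (simp only: sum_sp zero_le_power2)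
qed (use b_pos finite_cube cube_nonempty in auto)

lemma G_eq: "gaussian_disorder N = G"
  by (simp add: gaussian_disorder_def)

lemma X_eq: "X N g \<sigma> = lin (sp \<sigma>) g"
  unfolding X_def lin_def sp_def sum.cartesian_product by (intro sum.cong) (auto simp: mult_ac)

lemma Q_eq: "Q \<sigma> \<tau> = (\<Sum>i=1..N. \<sigma> i * \<tau> i)\<^sup>2"
  unfolding Q_def by (rule sum_sp)

lemma overlap_sq: "(overlap N \<sigma> \<tau>)\<^sup>2 = Q \<sigma> \<tau> / (real N)\<^sup>2"
  unfolding overlap_def Q_eq by (simp add: power_divide)

lemma sum_sp_sq: "\<sigma> \<in> cube N \<Longrightarrow> (\<Sum>e\<in>{1..N} \<times> {1..N}. (sp \<sigma> e)\<^sup>2) = (real N)\<^sup>2"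
  using sum_sp[of \<sigma> \<sigma> N] cube_sq[of \<sigma> N] by (simp add: power2_eq_square)

text \<open>Gauge symmetry: multiplying the disorder at \<open>(i, j)\<close> by
  \<open>\<rho> i * \<rho> j\<close> preserves its law and maps the weight of \<sigma> to that of
  the product of \<rho> and \<sigma>. The action on the cube is transitive, so all mean weights
  agree, and they sum to 1.\<close>

lemma integral_p:
  assumes "x \<in> cube N"
  shows "(\<integral>g. p x g \<partial>G) = 1 / card (cube N)"
proof -
  have flip: "(\<integral>g. p (cmul N \<rho> \<sigma>) g \<partial>G) = (\<integral>g. p \<sigma> g \<partial>G)" if \<rho>: "\<rho> \<in> cube N" and \<sigma>: "\<sigma> \<in> cube N" for \<rho> \<sigma>
  proof -
    have l: "lin (sp \<tau>) (\<lambda>e. sp \<rho> e * g e) = lin (sp (cmul N \<rho> \<tau>)) g" for g \<tau>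
      unfolding lin_def by (intro sum.cong) (auto simp: sp_def cmul_def)
    have "(\<Sum>y\<in>cube N. exp (b * lin (sp (cmul N \<rho> y)) g)) = (\<Sum>y\<in>cube N. exp (b * lin (sp y) g))" for g
      using sum.reindex_bij_betw[OF bij_cmul[OF \<rho>], of "\<lambda>y. exp (b * lin (sp y) g)"] .
    then have "p \<sigma> (\<lambda>e. sp \<rho> e * g e) = p (cmul N \<rho> \<sigma>) g" for g
      unfolding p_def l by simp
    moreover have "(\<integral>g. p \<sigma> (\<lambda>e. sp \<rho> e * g e) \<partial>G) = (\<integral>g. p \<sigma> g \<partial>G)"
    proof (rule integral_flip)
      fix e assume "e \<in> {1..N} \<times> {1..N}"
      then have "\<bar>sp \<rho> e\<bar> = 1"
        using cube_abs[OF \<rho>, of "fst e"] cube_abs[OF \<rho>, of "snd e"] by (auto simp: sp_def abs_mult)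
      then show "sp \<rho> e = 1 \<or> sp \<rho> e = - 1" by linarith
    qed (rule bobs_obs[OF bobs_p[OF \<sigma>]])
    ultimately show ?thesis by simp
  qed
  have eq: "(\<integral>g. p y g \<partial>G) = (\<integral>g. p x g \<partial>G)" if y: "y \<in> cube N" for y
  proof -
    have "cmul N (cmul N x y) x = y" by (subst cmul_comm) (rule cmul_cmul[OF assms y])
    then show ?thesis using flip[OF cmul_in[OF assms y] assms] by simp
  qed
  have "1 = (\<integral>g. (\<Sum>y\<in>cube N. p y g) \<partial>G)" by (simp add: sum_p G.prob_space)
  also have "\<dots> = (\<Sum>y\<in>cube N. \<integral>g. p y g \<partial>G)"
    by (intro Bochner_Integration.integral_sum bobs_integrable_G bobs_p)
  also have "\<dots> = card (cube N) * (\<integral>g. p x g \<partial>G)" using eq by simp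
  finally show ?thesis using finK K_ne by (simp add: field_simps)
qed

lemma sum_exp_Q:
  fixes c :: real
  assumes c: "0 \<le> c" "c * N \<le> 1 / 4"
  shows "(\<Sum>z\<in>cube N \<times> cube N. exp (c * Q (fst z) (snd z))) / (card (cube N))\<^sup>2 \<le> sqrt 2"
proof -
  have "(\<Sum>z\<in>cube N \<times> cube N. exp (c * Q (fst z) (snd z))) = (\<Sum>\<sigma>\<in>cube N. \<Sum>\<tau>\<in>cube N. exp (c * Q \<sigma> \<tau>))"
    by (simp add: sum.cartesian_product case_prod_beta)
  also have "\<dots> \<le> (\<Sum>\<sigma>\<in>cube N. sqrt 2 * 2 ^ N)"
    unfolding Q_eq by (intro sum_mono sum_exp_overlap_sq c)
  also have "\<dots> = sqrt 2 * (card (cube N))\<^sup>2" by (simp add: card_cube power2_eq_square)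
  finally show ?thesis using finK K_ne by (simp add: field_simps)
qed

lemma sqrt2_le: "sqrt 2 \<le> 3 / 2"
  by (rule real_le_lsqrt) (auto simp: power2_eq_square)

lemma B_high_temperature:
  assumes r: "0 \<le> r" "r \<le> 1" and small: "b\<^sup>2 * N * r \<le> 1 / 16"
  shows "B r \<le> 12 * real N"
proof -
  \<comment> \<open>Half of the admissible exponent \<open>1 / (4 * N)\<close> of
    \<open>sum_exp_Q\<close>; the other half is left for \<open>2 * b\<^sup>2 * r\<close>, whence
    the \<open>1 / 16\<close> in the hypothesis.\<close>
  define c where "c = 1 / (8 * real N)"
  have c: "0 < c" "c * N = 1 / 8" using N_pos by (auto simp: c_def)
  have "c * B r \<le> \<psi> c r" by (rule B_le_\<psi>)
  also have "\<dots> \<le> \<psi> (c + 2 * b\<^sup>2 * r) 0" using c r by (intro \<psi>_le_init) auto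
  also have "\<dots> = (\<Sum>z\<in>cube N \<times> cube N. exp ((c + 2 * b\<^sup>2 * r) * Q (fst z) (snd z))) / (card (cube N))\<^sup>2"
    by (rule \<psi>_init) (rule integral_p)
  also have "\<dots> \<le> sqrt 2"
  proof (rule sum_exp_Q)
    show "0 \<le> c + 2 * b\<^sup>2 * r" using c r by simp
    show "(c + 2 * b\<^sup>2 * r) * N \<le> 1 / 4" using c(2) small by (simp add: algebra_simps)
  qed
  finally have "c * B r \<le> 3 / 2" using sqrt2_le by linarith
  then show ?thesis using N_pos by (simp add: c_def field_simps)
qed

lemma max_X_attained:
  obtains m where "m \<in> cube N" "max_X N g = X N g m" "\<And>x. x \<in> cube N \<Longrightarrow> X N g x \<le> X N g m"
proof -
  have "max_X N g \<in> X N g ` cube N"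
    unfolding max_X_def using finite_cube cube_nonempty by (intro Max_in) auto
  moreover have "X N g x \<le> max_X N g" if "x \<in> cube N" for x
    unfolding max_X_def using finite_cube that by (intro Max_ge) auto
  ultimately show ?thesis using that by auto
qed

lemma X_le_max: "x \<in> cube N \<Longrightarrow> X N g x \<le> max_X N g"
  unfolding max_X_def using finite_cube by (intro Max_ge) auto

lemma max_X_integrable: "integrable G (max_X N)"
proof (rule Bochner_Integration.integrable_bound)
  show "integrable G l1" using integrable_l1_power[of 1] by simp
  show "max_X N \<in> borel_measurable G" using measurable_max_X by measurable
  show "AE g in G. norm (max_X N g) \<le> norm (l1 g)"
  proof (rule AE_I2)
    fix g
    obtain m where "m \<in> cube N" "max_X N g = X N g m" using max_X_attained[of g] by metis
    then show "norm (max_X N g) \<le> norm (l1 g)" using abs_lin_le[of m g] l1_nonneg[of g] by (simp add: X_eq)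
  qed
qed

section \<open>Moments of the partition function and size of the maximum\<close>

lemma lin_exp_mgf:
  assumes "\<sigma> \<in> cube N"
  shows "integrable G (\<lambda>g. exp (c * X N g \<sigma>))" "(\<integral>g. exp (c * X N g \<sigma>) \<partial>G) = exp (c\<^sup>2 * (real N)\<^sup>2 / 2)"
proof -
  have e: "c * X N g \<sigma> = lin (\<lambda>e. c * sp \<sigma> e) g" for g
    unfolding X_eq lin_def by (simp add: sum_distrib_left mult.assoc)
  show "integrable G (\<lambda>g. exp (c * X N g \<sigma>))" unfolding e by (rule lin_mgf)
  show "(\<integral>g. exp (c * X N g \<sigma>) \<partial>G) = exp (c\<^sup>2 * (real N)\<^sup>2 / 2)"
    unfolding e using sum_sp_sq[OF assms] by (simp add: lin_mgf power_mult_distrib flip: sum_distrib_left)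
qed

lemma lin_exp_mgf2:
  assumes "\<sigma> \<in> cube N" "\<tau> \<in> cube N"
  shows "integrable G (\<lambda>g. exp (c * X N g \<sigma>) * exp (c * X N g \<tau>))"
    "(\<integral>g. exp (c * X N g \<sigma>) * exp (c * X N g \<tau>) \<partial>G) = (exp (c\<^sup>2 * (real N)\<^sup>2 / 2))\<^sup>2 * exp (c\<^sup>2 * Q \<sigma> \<tau>)"
proof -
  have e: "exp (c * X N g \<sigma>) * exp (c * X N g \<tau>) = exp (lin (\<lambda>e. c * (sp \<sigma> e + sp \<tau> e)) g)" for g
    unfolding X_eq lin_def by (simp add: sum_distrib_left sum.distrib algebra_simps flip: exp_add)
  show "integrable G (\<lambda>g. exp (c * X N g \<sigma>) * exp (c * X N g \<tau>))" unfolding e by (rule lin_mgf)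
  have "(\<Sum>e\<in>{1..N} \<times> {1..N}. (c * (sp \<sigma> e + sp \<tau> e))\<^sup>2)
      = c\<^sup>2 * ((\<Sum>e\<in>{1..N} \<times> {1..N}. (sp \<sigma> e)\<^sup>2) + (\<Sum>e\<in>{1..N} \<times> {1..N}. (sp \<tau> e)\<^sup>2) + 2 * Q \<sigma> \<tau>)"
    unfolding Q_def sum_distrib_left sum.distrib[symmetric]
    by (intro sum.cong refl) (simp add: power2_eq_square algebra_simps)
  also have "\<dots> = c\<^sup>2 * (2 * (real N)\<^sup>2 + 2 * Q \<sigma> \<tau>)" by (simp add: sum_sp_sq assms)
  finally show "(\<integral>g. exp (c * X N g \<sigma>) * exp (c * X N g \<tau>) \<partial>G) = (exp (c\<^sup>2 * (real N)\<^sup>2 / 2))\<^sup>2 * exp (c\<^sup>2 * Q \<sigma> \<tau>)"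
    unfolding e by (simp add: lin_mgf algebra_simps power2_eq_square flip: exp_add)
qed

text \<open>The maximum is at most \<open>ln (Y g) / c\<close>. The tangent of the logarithm at the
  mean \<open>a\<close> of \<open>Y\<close> takes the place of Jensen's inequality, and
  \<open>c = 1 / sqrt N\<close> makes \<open>N * ln 2 / c\<close> and
  \<open>c * N\<^sup>2 / 2\<close> of the same order.\<close>

lemma expectation_max_X_le: "(\<integral>g. max_X N g \<partial>G) \<le> 2 * (N * sqrt N)"
proof -
  define c where "c = 1 / sqrt N"
  have c: "0 < c" using N_pos by (simp add: c_def)
  define Y where "Y g = (\<Sum>\<sigma>\<in>cube N. exp (c * X N g \<sigma>))" for g
  define a where "a = 2 ^ N * exp (c\<^sup>2 * (real N)\<^sup>2 / 2)"
  have a: "0 < a" by (simp add: a_def)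
  have iY: "integrable G Y" unfolding Y_def[abs_def] by (intro Bochner_Integration.integrable_sum lin_exp_mgf)
  have EY: "(\<integral>g. Y g \<partial>G) = a"
    unfolding Y_def a_def by (subst Bochner_Integration.integral_sum) (auto simp: lin_exp_mgf card_cube)
  have le: "max_X N g \<le> (ln a + Y g / a - 1) / c" for g
  proof -
    obtain m where m: "m \<in> cube N" "max_X N g = X N g m" using max_X_attained[of g] by metis
    have Yp: "exp (c * max_X N g) \<le> Y g" unfolding Y_def m(2) using m(1) finite_cube by (intro member_le_sum) auto
    then have Y0: "0 < Y g" using exp_gt_zero[of "c * max_X N g"] by linarith
    have "c * max_X N g \<le> ln (Y g)" using Yp Y0 by (metis exp_le_cancel_iff exp_ln)
    also have "\<dots> = ln a + ln (Y g / a)" using a Y0 by (simp add: ln_div)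
    also have "\<dots> \<le> ln a + (Y g / a - 1)" using a Y0 by (intro add_left_mono ln_le_minus_one) auto
    finally show ?thesis using c by (simp add: pos_le_divide_eq mult.commute)
  qed
  have "(\<integral>g. max_X N g \<partial>G) \<le> (\<integral>g. (ln a + Y g / a - 1) / c \<partial>G)"
    using le iY max_X_integrable by (intro integral_mono) auto
  also have "\<dots> = ln a / c" using iY a by (simp add: EY G.prob_space)
  also have "\<dots> = (N * ln 2 + N / 2) * sqrt N"
    using N_pos by (simp add: a_def c_def ln_mult ln_realpow power_divide power2_eq_square real_sqrt_mult_self)
  also have "\<dots> \<le> 2 * (N * sqrt N)"
    using ln_2_less_1 N_pos mult_right_mono[of "ln 2 + 1 / 2" 2 "N * sqrt N"] by (simp add: algebra_simps)
  finally show ?thesis .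
qed

lemma gibbs_mean_ge: "max_X N g - N * ln 2 / b \<le> (\<Sum>x\<in>cube N. p x g * X N g x)"
proof -
  obtain m where m: "m \<in> cube N" "max_X N g = X N g m" "\<And>x. x \<in> cube N \<Longrightarrow> X N g x \<le> X N g m"
    using max_X_attained[of g] by metis
  have "X N g m - (\<Sum>x\<in>cube N. p x g * X N g x) \<le> ln (card (cube N)) / b"
    unfolding X_eq by (rule gibbs_energy[OF b_pos m(1)]) (use m(3) in \<open>simp add: X_eq\<close>)
  then show ?thesis by (simp add: m(2) card_cube ln_realpow)
qed


text \<open>Relative squared deviation of the partition function at inverse temperature
  \<open>a\<close> from its mean. This temperature is independent of \<open>b\<close> and serves
  only to bound the maximum from below.\<close>

definition D :: "real \<Rightarrow> (nat \<times> nat \<Rightarrow> real) \<Rightarrow> real" where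
  "D a g = ((\<Sum>\<sigma>\<in>cube N. exp (a * X N g \<sigma>)) / (2 ^ N * exp (a\<^sup>2 * (real N)\<^sup>2 / 2)) - 1)\<^sup>2"

text \<open>Second moment method: the ratio of the second moment of the partition function to its squared mean is
  the mean of \<open>exp (a\<^sup>2 Q)\<close> over independent uniform configurations, which tends to 1 with \<open>a\<^sup>2 N\<close>.\<close>

lemma expectation_D:
  fixes a :: real
  assumes a: "a\<^sup>2 * N \<le> 1 / 4"
  shows "integrable G (D a)" "(\<integral>g. D a g \<partial>G) \<le> 2 * (a\<^sup>2 * N)"
proof -
  define z where "z = exp (a\<^sup>2 * (real N)\<^sup>2 / 2)"
  define n where "n = (2::real) ^ N"
  have n: "0 < n" "real (card (cube N)) = n" by (auto simp: n_def card_cube)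
  have z: "0 < z" by (simp add: z_def)
  let ?Y = "\<lambda>g. \<Sum>\<sigma>\<in>cube N. exp (a * X N g \<sigma>)"
  let ?YY = "\<lambda>g. \<Sum>w\<in>cube N \<times> cube N. exp (a * X N g (fst w)) * exp (a * X N g (snd w))"
  have D: "D a g = ?YY g / (n * z)\<^sup>2 - 2 * (?Y g / (n * z)) + 1" for g
  proof -
    have "?YY g = (?Y g)\<^sup>2"
      unfolding power2_eq_square sum_product sum.cartesian_product by (simp add: case_prod_beta)
    then show ?thesis unfolding D_def n_def z_def by (simp add: power2_diff power_divide)
  qed
  have iY: "integrable G ?Y" by (intro Bochner_Integration.integrable_sum lin_exp_mgf)
  have iYY: "integrable G ?YY" by (intro Bochner_Integration.integrable_sum lin_exp_mgf2) auto
  show "integrable G (D a)" unfolding D using iY iYY by simp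
  have EY: "(\<integral>g. ?Y g \<partial>G) = n * z"
    by (subst Bochner_Integration.integral_sum) (auto simp: lin_exp_mgf z_def n)
  have EYY: "(\<integral>g. ?YY g \<partial>G) = z\<^sup>2 * (\<Sum>w\<in>cube N \<times> cube N. exp (a\<^sup>2 * Q (fst w) (snd w)))"
    by (subst Bochner_Integration.integral_sum) (auto simp: lin_exp_mgf2 mem_Times_iff z_def sum_distrib_left)
  have "(\<integral>g. D a g \<partial>G) = (\<integral>g. ?YY g \<partial>G) / (n * z)\<^sup>2 - 2 * ((\<integral>g. ?Y g \<partial>G) / (n * z)) + 1"
    unfolding D using iY iYY by (simp add: G.prob_space)
  also have "\<dots> = (\<Sum>w\<in>cube N \<times> cube N. exp (a\<^sup>2 * Q (fst w) (snd w))) / n\<^sup>2 - 1"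
    unfolding EY EYY using n z by (simp add: power_mult_distrib)
  also have "\<dots> \<le> 2 * (a\<^sup>2 * N)"
  proof -
    \<comment> \<open>\<open>sum_exp_Q\<close> alone gives only a constant. Convexity of the
      exponential interpolates between the exponents 0 and \<open>1 / (4 * N)\<close>, with sums 1
      and at most \<open>3 / 2\<close>, and yields the linear bound
      \<open>\<theta> / 2\<close>.\<close>
    define \<theta> where "\<theta> = 4 * (a\<^sup>2 * N)"
    have \<theta>: "0 \<le> \<theta>" "\<theta> \<le> 1" using a by (auto simp: \<theta>_def)
    have cv: "exp (\<theta> * y) \<le> (1 - \<theta>) + \<theta> * exp y" for y :: real
      using convex_onD[OF convex_on_exp[of 1] \<theta>, of 0 y] by simp
    have "(\<Sum>w\<in>cube N \<times> cube N. exp (a\<^sup>2 * Q (fst w) (snd w)))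
      \<le> (\<Sum>w\<in>cube N \<times> cube N. (1 - \<theta>) + \<theta> * exp (1 / (4 * real N) * Q (fst w) (snd w)))"
    proof (rule sum_mono)
      fix w
      have "a\<^sup>2 * Q (fst w) (snd w) = \<theta> * (1 / (4 * real N) * Q (fst w) (snd w))"
        using N_pos by (simp add: \<theta>_def)
      then show "exp (a\<^sup>2 * Q (fst w) (snd w)) \<le> (1 - \<theta>) + \<theta> * exp (1 / (4 * real N) * Q (fst w) (snd w))"
        using cv[of "1 / (4 * real N) * Q (fst w) (snd w)"] by (simp only:)
    qed
    also have "\<dots> = n\<^sup>2 * (1 - \<theta>) + \<theta> * (\<Sum>w\<in>cube N \<times> cube N. exp (1 / (4 * real N) * Q (fst w) (snd w)))"
      by (simp only: sum.distrib sum_distrib_left sum_constant card_cartesian_product of_nat_mult n power2_eq_square)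
    finally have "(\<Sum>w\<in>cube N \<times> cube N. exp (a\<^sup>2 * Q (fst w) (snd w))) / n\<^sup>2
      \<le> (n\<^sup>2 * (1 - \<theta>) + \<theta> * (\<Sum>w\<in>cube N \<times> cube N. exp (1 / (4 * real N) * Q (fst w) (snd w)))) / n\<^sup>2"
      by (rule divide_right_mono) simp
    also have "\<dots> = (1 - \<theta>) + \<theta> * ((\<Sum>w\<in>cube N \<times> cube N. exp (1 / (4 * real N) * Q (fst w) (snd w))) / n\<^sup>2)"
      using n by (simp add: add_divide_distrib)
    also have "\<dots> \<le> (1 - \<theta>) + \<theta> * (3 / 2)"
    proof (intro add_left_mono mult_left_mono \<theta>)
      have "(\<Sum>w\<in>cube N \<times> cube N. exp (1 / (4 * real N) * Q (fst w) (snd w))) / n\<^sup>2 \<le> sqrt 2"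
        using sum_exp_Q[of "1 / (4 * real N)"] N_pos n by simp
      then show "(\<Sum>w\<in>cube N \<times> cube N. exp (1 / (4 * real N) * Q (fst w) (snd w))) / n\<^sup>2 \<le> 3 / 2"
        using sqrt2_le by linarith
    qed
    finally show ?thesis unfolding \<theta>_def by linarith
  qed
  finally show "(\<integral>g. D a g \<partial>G) \<le> 2 * (a\<^sup>2 * N)" .
qed

text \<open>Below this threshold even \<open>2 ^ N\<close> terms of maximal size give at most half
  of the mean partition function, a relative deviation of at least \<open>1 / 2\<close>.\<close>

lemma D_ge_of_max_small:
  fixes a :: real
  assumes a: "0 < a" and M: "max_X N g < a * (real N)\<^sup>2 / 2 - ln 2 / a"
  shows "1 \<le> 4 * D a g"
proof -
  define w where "w = 2 ^ N * exp (a\<^sup>2 * (real N)\<^sup>2 / 2)"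
  have w: "0 < w" by (simp add: w_def)
  have "a * max_X N g \<le> a\<^sup>2 * (real N)\<^sup>2 / 2 - ln 2"
    using mult_strict_left_mono[OF M a] a by (simp add: right_diff_distrib power2_eq_square mult.assoc)
  then have e: "exp (a * max_X N g) \<le> exp (a\<^sup>2 * (real N)\<^sup>2 / 2) / 2"
    by (metis exp_diff exp_le_cancel_iff exp_ln zero_less_numeral)
  have "(\<Sum>\<sigma>\<in>cube N. exp (a * X N g \<sigma>)) \<le> (\<Sum>\<sigma>\<in>cube N. exp (a * max_X N g))"
    using X_le_max a by (intro sum_mono) auto
  also have "\<dots> = 2 ^ N * exp (a * max_X N g)" by (simp add: card_cube)
  also have "\<dots> \<le> w / 2" using e by (simp add: w_def)
  finally have "(\<Sum>\<sigma>\<in>cube N. exp (a * X N g \<sigma>)) / w \<le> 1 / 2"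
    using w by (simp add: field_simps)
  then have "(1 / 2)\<^sup>2 \<le> (1 - (\<Sum>\<sigma>\<in>cube N. exp (a * X N g \<sigma>)) / w)\<^sup>2"
    by (intro power_mono) auto
  then show ?thesis unfolding D_def w_def[symmetric] by (simp add: power2_eq_square algebra_simps)
qed

text \<open>Mean energy deficit of one draw from the smoothed weights; \<open>V\<close> below is the
  mean squared overlap of two independent draws. They become the two costs in
  \<open>exists_low_cost\<close>.\<close>

definition W :: "real \<Rightarrow> (nat \<times> nat \<Rightarrow> real) \<Rightarrow> real" where
  "W k g = (\<Sum>x\<in>cube N. T k (p x) g * (max_X N g - X N g x))"

definition V :: "real \<Rightarrow> (nat \<times> nat \<Rightarrow> real) \<Rightarrow> real" where
  "V k g = (\<Sum>z\<in>cube N \<times> cube N. T k (p (fst z)) g * T k (p (snd z)) g * (overlap N (fst z) (snd z))\<^sup>2)"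

lemma T_p_integrable:
  assumes x: "x \<in> cube N" and h: "integrable G h"
  shows "integrable G (\<lambda>g. T k (p x) g * h g)"
proof (rule Bochner_Integration.integrable_bound[OF h])
  show "AE g in G. norm (T k (p x) g * h g) \<le> norm (h g)"
    using T_p_nonneg[OF x] S_p_bounds(2)[OF x] by (intro AE_I2) (auto simp: T_def abs_mult intro!: mult_left_le_one_le)
  show "(\<lambda>g. T k (p x) g * h g) \<in> borel_measurable G"
    using h bobs_integrable_G[OF bobs_T[OF bobs_p[OF x]]] by measurable
qed

lemma expectation_W:
  assumes k: "0 \<le> k" "k \<le> 1"
  shows "integrable G (W k)" "(\<integral>g. W k g \<partial>G) \<le> (1 - k) * (2 * (N * sqrt N)) + N * ln 2 / b"
proof -
  have iX: "integrable G (\<lambda>g. X N g x)" for x unfolding X_eq by (rule lin_mean)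
  \<comment> \<open>\<open>T 1\<close> is the identity, so this is the case
    \<open>k = 1\<close>.\<close>
  have ip: "integrable G (\<lambda>g. p x g * X N g x)" if "x \<in> cube N" for x
    using T_p_integrable[OF that iX, of 1 x] by (simp add: T_def S_def G.prob_space)
  note iTX = T_p_integrable[OF _ iX]
  have W: "W k g = max_X N g - (\<Sum>x\<in>cube N. T k (p x) g * X N g x)" for g
    unfolding W_def by (simp add: right_diff_distrib sum_subtractf sum_T_p flip: sum_distrib_right)
  have iS: "integrable G (\<lambda>g. \<Sum>x\<in>cube N. T k (p x) g * X N g x)"
    by (intro Bochner_Integration.integrable_sum iTX)
  have iP: "integrable G (\<lambda>g. \<Sum>x\<in>cube N. p x g * X N g x)"
    by (intro Bochner_Integration.integrable_sum ip)
  show "integrable G (W k)" unfolding W using iS max_X_integrable by simp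
  have "(\<integral>g. (\<Sum>x\<in>cube N. T k (p x) g * X N g x) \<partial>G) = (\<Sum>x\<in>cube N. \<integral>g. lin (sp x) g * T k (p x) g \<partial>G)"
    using iTX by (subst Bochner_Integration.integral_sum) (auto simp: X_eq mult.commute)
  also have "\<dots> = (\<Sum>x\<in>cube N. k * (\<integral>g. lin (sp x) g * p x g \<partial>G))"
    by (intro sum.cong refl integral_linear_T bobs_p obs_lin lin_mean lin_combine k)
  also have "\<dots> = k * (\<integral>g. (\<Sum>x\<in>cube N. p x g * X N g x) \<partial>G)"
    using ip by (subst Bochner_Integration.integral_sum) (auto simp: X_eq mult.commute sum_distrib_left)
  finally have E: "(\<integral>g. W k g \<partial>G) = (\<integral>g. max_X N g \<partial>G) - k * (\<integral>g. (\<Sum>x\<in>cube N. p x g * X N g x) \<partial>G)"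
    unfolding W using iS max_X_integrable by simp
  have "(\<integral>g. max_X N g - N * ln 2 / b \<partial>G) \<le> (\<integral>g. (\<Sum>x\<in>cube N. p x g * X N g x) \<partial>G)"
    using gibbs_mean_ge iP max_X_integrable by (intro integral_mono) auto
  then have "(\<integral>g. max_X N g \<partial>G) - N * ln 2 / b \<le> (\<integral>g. (\<Sum>x\<in>cube N. p x g * X N g x) \<partial>G)"
    using max_X_integrable by (simp add: G.prob_space)
  from mult_left_mono[OF this k(1)]
  have "(\<integral>g. W k g \<partial>G) \<le> (1 - k) * (\<integral>g. max_X N g \<partial>G) + k * (N * ln 2 / b)"
    unfolding E by (simp add: algebra_simps)
  also have "\<dots> \<le> (1 - k) * (2 * (N * sqrt N)) + 1 * (N * ln 2 / b)"
    using k b_pos expectation_max_X_le by (intro add_mono mult_left_mono mult_right_mono) auto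
  finally show "(\<integral>g. W k g \<partial>G) \<le> (1 - k) * (2 * (N * sqrt N)) + N * ln 2 / b" by simp
qed

lemma expectation_V:
  shows "integrable G (V (sqrt r))" "(\<integral>g. V (sqrt r) g \<partial>G) = B r / (real N)\<^sup>2"
proof -
  have i: "integrable G (\<lambda>g. T (sqrt r) (p (fst z)) g * T (sqrt r) (p (snd z)) g)" if "z \<in> cube N \<times> cube N" for z
    using that by (intro bobs_integrable_G bobs_mult bobs_T bobs_p) auto
  show "integrable G (V (sqrt r))"
    unfolding V_def[abs_def] using i by (intro Bochner_Integration.integrable_sum integrable_mult_left)
  show "(\<integral>g. V (sqrt r) g \<partial>G) = B r / (real N)\<^sup>2"
    unfolding V_def B_def using i
    by (subst Bochner_Integration.integral_sum) (auto simp: overlap_sq sum_divide_distrib mult.commute)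
qed

text \<open>Costs are divided by \<epsilon> and by \<open>\<delta> * m0\<close>, so that a cost
  below 1 is exactly the wanted bound, with the deterministic \<open>m0\<close> in place of the
  random maximum. Since \<open>\<epsilon> < 1\<close>, a repeated configuration, of overlap 1, is
  excluded, and the \<open>n\<close> draws give \<open>n\<close> distinct points.\<close>

lemma multiple_peaks_of_small:
  assumes \<epsilon>: "0 < \<epsilon>" "\<epsilon> < 1" and \<delta>: "0 < \<delta>" and m0: "0 < m0" "m0 \<le> max_X N g" and R: "R \<le> real n"
    and small: "(real n)\<^sup>2 * (V k g / \<epsilon>) + real n * (W k g / (\<delta> * m0)) < 1"
  shows "multiple_peaks N R \<epsilon> \<delta> g"
proof -
  let ?h = "\<lambda>x y. (overlap N x y)\<^sup>2 / \<epsilon>" and ?v = "\<lambda>x. (max_X N g - X N g x) / (\<delta> * m0)"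
  have "(real n)\<^sup>2 * (\<Sum>z\<in>cube N \<times> cube N. T k (p (fst z)) g * T k (p (snd z)) g * ?h (fst z) (snd z))
      + real n * (\<Sum>x\<in>cube N. T k (p x) g * ?v x) < 1"
    using small by (simp add: V_def W_def sum_divide_distrib)
  then obtain f where f: "f \<in> {..<n} \<rightarrow>\<^sub>E cube N"
    and h: "\<And>i j. i < n \<Longrightarrow> j < n \<Longrightarrow> i \<noteq> j \<Longrightarrow> ?h (f i) (f j) < 1"
    and v: "\<And>i. i < n \<Longrightarrow> ?v (f i) < 1"
    by (rule exists_low_cost[of "cube N" "\<lambda>x. T k (p x) g" ?h ?v n, rotated 5])
      (use finite_cube T_p_nonneg sum_T_p X_le_max \<epsilon> \<delta> m0 in \<open>auto intro!: divide_nonneg_pos\<close>)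
  have fc: "f i \<in> cube N" if "i < n" for i using f that by auto
  have inj: "inj_on f {..<n}"
  proof (rule inj_onI, rule ccontr)
    fix i j assume ij: "i \<in> {..<n}" "j \<in> {..<n}" "f i = f j" "i \<noteq> j"
    have "(\<Sum>l=1..N. f j l * f j l) = real N" using fc[of j] ij cube_sq[of "f j" N] by simp
    then have "(overlap N (f i) (f j))\<^sup>2 = 1" using ij N_pos by (simp add: overlap_def)
    then show False using h[of i j] ij \<epsilon> by (simp add: field_simps)
  qed
  have card: "card (f ` {..<n}) = n" using card_image[OF inj] by simp
  have "(overlap N (f i) (f j))\<^sup>2 \<le> \<epsilon>" if "i < n" "j < n" "f i \<noteq> f j" for i j
    using h[of i j] that \<epsilon> by (cases "i = j") (auto simp: field_simps)
  moreover have "(1 - \<delta>) * max_X N g \<le> X N g (f i)" if "i < n" for i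
  proof -
    have "max_X N g - X N g (f i) < \<delta> * m0" using v[OF that] \<delta> m0 by (simp add: field_simps)
    also have "\<dots> \<le> \<delta> * max_X N g" using \<delta> m0 by simp
    finally show ?thesis by (simp add: algebra_simps)
  qed
  ultimately show ?thesis
    unfolding multiple_peaks_def using fc card R by (intro exI[of _ "f ` {..<n}"]) auto
qed

text \<open>One application of Markov's inequality to \<open>u\<close>, the sum of the three costs:
  failure means either a small maximum, where \<open>4 * D\<close> is at least 1, or that the other
  two costs are too large for the sampling argument.\<close>

lemma multiple_peaks_prob:
  fixes a r \<delta> \<epsilon> m0 v R :: real
  assumes r: "0 \<le> r" "r \<le> 1" and \<epsilon>: "0 < \<epsilon>" "\<epsilon> < 1" and \<delta>: "0 < \<delta>" and R: "R \<le> real n"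
    and a: "0 < a" "a\<^sup>2 * N \<le> 1 / 4"
    and m0: "m0 \<le> a * (real N)\<^sup>2 / 2 - ln 2 / a" "0 < m0"
    and v: "B r / (real N)\<^sup>2 \<le> v"
  shows "measure (gaussian_disorder N) {g \<in> space (gaussian_disorder N). multiple_peaks N R \<epsilon> \<delta> g}
    \<ge> 1 - (8 * (a\<^sup>2 * N) + (real n)\<^sup>2 * (v / \<epsilon>)
        + real n * (((1 - sqrt r) * (2 * (N * sqrt N)) + N * ln 2 / b) / (\<delta> * m0)))"
proof -
  define u where "u g = 4 * D a g + (real n)\<^sup>2 * (V (sqrt r) g / \<epsilon>) + real n * (W (sqrt r) g / (\<delta> * m0))" for g
  let ?E = "{g \<in> space G. multiple_peaks N R \<epsilon> \<delta> g}"
  have sr: "0 \<le> sqrt r" "sqrt r \<le> 1" using r by auto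
  note i = expectation_D[OF a(2)] expectation_V[of r] expectation_W[OF sr]
  have pos: "0 \<le> D a g" "0 \<le> V (sqrt r) g" "0 \<le> W (sqrt r) g" for g
    unfolding D_def V_def W_def using T_p_nonneg X_le_max by (auto intro!: sum_nonneg mult_nonneg_nonneg)
  have u0: "0 \<le> u g" for g unfolding u_def using pos \<epsilon> \<delta> m0 by (auto intro!: add_nonneg_nonneg)
  have iu: "integrable G u" unfolding u_def[abs_def] using i by simp
  have bad: "1 \<le> u g" if "\<not> multiple_peaks N R \<epsilon> \<delta> g" for g
  proof (cases "max_X N g < m0")
    case True
    then have "1 \<le> 4 * D a g" using m0 by (intro D_ge_of_max_small[OF a(1)]) simp
    moreover have "0 \<le> (real n)\<^sup>2 * (V (sqrt r) g / \<epsilon>)" "0 \<le> real n * (W (sqrt r) g / (\<delta> * m0))"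
      using pos \<epsilon> \<delta> m0 by auto
    ultimately show ?thesis unfolding u_def by linarith
  next
    case False
    then have "\<not> (real n)\<^sup>2 * (V (sqrt r) g / \<epsilon>) + real n * (W (sqrt r) g / (\<delta> * m0)) < 1"
      using multiple_peaks_of_small[OF \<epsilon> \<delta> m0(2) _ R] that by (meson not_less)
    then show ?thesis unfolding u_def using pos(1)[of g] by linarith
  qed
  have "Measurable.pred G (multiple_peaks N R \<epsilon> \<delta>)" using measurable_multiple_peaks by measurable
  then have E: "?E \<in> sets G" by measurable
  have "1 - measure G ?E = measure G (space G - ?E)" using E by (simp add: G.prob_compl)
  also have "\<dots> \<le> measure G {g \<in> space G. 1 \<le> u g}"
    using iu bad by (intro G.finite_measure_mono) auto
  also have "\<dots> \<le> (\<integral>g. u g \<partial>G) / 1"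
    using u0 by (intro integral_Markov_inequality_measure[OF iu, where A = "{}"]) auto
  also have "\<dots> = 4 * (\<integral>g. D a g \<partial>G) + (real n)\<^sup>2 * ((\<integral>g. V (sqrt r) g \<partial>G) / \<epsilon>) + real n * ((\<integral>g. W (sqrt r) g \<partial>G) / (\<delta> * m0))"
    unfolding u_def using i by simp
  also have "\<dots> \<le> 4 * (2 * (a\<^sup>2 * N)) + (real n)\<^sup>2 * (v / \<epsilon>)
      + real n * (((1 - sqrt r) * (2 * (N * sqrt N)) + N * ln 2 / b) / (\<delta> * m0))"
    using i v \<epsilon> \<delta> m0 by (intro add_mono mult_left_mono divide_right_mono) auto
  finally show ?thesis unfolding G_eq by linarith
qed

end

section \<open>Choice of parameters\<close>

text \<open>The correlation can only be squared, so the order of the root in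
  \<open>B_iterate\<close> is a power of 2.\<close>

lemma dyadic_between:
  fixes x :: real
  assumes "1 \<le> x"
  obtains m :: nat where "x \<le> 2 ^ m" "2 ^ m \<le> 2 * x"
proof -
  define m where "m = nat \<lceil>log 2 x\<rceil>"
  have l0: "0 \<le> log 2 x" using assms by simp
  then have m: "log 2 x \<le> real m" "real m \<le> log 2 x + 1" unfolding m_def by linarith+
  have x: "2 powr (log 2 x) = x" using assms by simp
  have "x \<le> 2 powr real m" using m(1) x by (metis powr_mono one_le_numeral)
  moreover have "2 powr real m \<le> 2 powr (log 2 x + 1)" using m(2) by (intro powr_mono) auto
  moreover have "2 powr (log 2 x + 1) = 2 * x" using x by (simp add: powr_add)
  ultimately show ?thesis by (intro that[of m]) (simp_all add: powr_realpow)
qed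

text \<open>With \<open>L = ln N\<close>: the first line serves sign conditions and the range of
  \<open>expectation_D\<close>; the second makes \<open>ln 2 / a\<close> at most half of
  \<open>a * N\<^sup>2 / 2\<close>; the last two bound the energy cost, of order
  \<open>L powr (-5/24)\<close>, and the overlap cost, which decays faster than any power of
  \<open>L\<close>.\<close>

lemma eventually_parameters:
  "\<forall>\<^sub>F L in at_top. (3::real) \<le> L \<and> ln 12 \<le> L \<and> L powr (-1/12) \<le> 1 / 4
     \<and> 4 * ln 2 * L powr (1/24) \<le> exp L * L powr (-1/24)
     \<and> 2 * L powr (1/8) * ((ln (16 * L) * L powr (-3/4) + ln 2 * L powr (-1/2)) * (4 * L powr (1/8) * L powr (1/24))) \<le> L powr (-1/12)
     \<and> (2 * L powr (1/8))\<^sup>2 * (exp ((ln 12 - L) / (2 * L powr (3/4))) / exp (- (L powr (1/8)))) \<le> L powr (-1/12)"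
  by (intro eventually_conj; real_asymp)

lemma eventually_multiple_peaks_prob:
  "\<forall>\<^sub>F N in sequentially. measure (gaussian_disorder N) {g \<in> space (gaussian_disorder N).
      multiple_peaks N (ln (real N) powr (1/8)) (exp (- (ln (real N) powr (1/8)))) (ln (real N) powr (- 1/8)) g}
    \<ge> 1 - 10 * ln (real N) powr (- 1/12)"
proof -
  have "filterlim (\<lambda>N. ln (real N)) at_top sequentially"
    by (rule filterlim_compose[OF ln_at_top filterlim_real_sequentially])
  from eventually_compose_filterlim[OF eventually_parameters this]
  show ?thesis using eventually_ge_at_top[of 1]
  proof eventually_elim
    case (elim N)
    define L where "L = ln (real N)"
    have N: "1 \<le> N" "0 < real N" using elim by auto
    have expL: "exp L = real N" using N by (simp add: L_def)
    have L: "3 \<le> L" "ln 12 \<le> L" "L powr (-1/12) \<le> 1 / 4"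
      "4 * ln 2 * L powr (1/24) \<le> real N * L powr (-1/24)"
      "2 * L powr (1/8) * ((ln (16 * L) * L powr (-3/4) + ln 2 * L powr (-1/2)) * (4 * L powr (1/8) * L powr (1/24))) \<le> L powr (-1/12)"
      "(2 * L powr (1/8))\<^sup>2 * (exp ((ln 12 - L) / (2 * L powr (3/4))) / exp (- (L powr (1/8)))) \<le> L powr (-1/12)"
      using elim expL by (auto simp: L_def)
    \<comment> \<open>The number of draws; rounding up at most doubles it because
      \<open>L powr (1/8)\<close> is at least 1.\<close>
    define n where "n = nat \<lceil>L powr (1/8)\<rceil>"
    have L8: "1 \<le> L powr (1/8)" and L34: "1 \<le> L powr (3/4)" using L by (auto intro!: ge_one_powr_ge_zero)
    have n: "L powr (1/8) \<le> real n" "real n \<le> 2 * L powr (1/8)"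
      using L8 unfolding n_def by linarith+
    obtain m where m: "L powr (3/4) \<le> 2 ^ m" "2 ^ m \<le> 2 * L powr (3/4)"
      using dyadic_between[OF L34] by blast
    define q where "q = (2::real) ^ m"
    have q: "L powr (3/4) \<le> q" "q \<le> 2 * L powr (3/4)" "0 < q" using m by (auto simp: q_def)
    \<comment> \<open>Chosen so that after \<open>m\<close> squarings the correlation is
      \<open>1 / (16 * L)\<close>, which with \<open>b\<^sup>2 * N = L\<close> meets the condition
      of \<open>B_high_temperature\<close> with equality.\<close>
    define r where "r = exp (- ln (16 * L) / q)"
    have l16: "0 < ln (16 * L)" using L by (intro ln_gt_zero) simp
    have r: "0 \<le> r" "r \<le> 1" using l16 q by (auto simp: r_def)
    have "r ^ (2 ^ m) = exp (real (2 ^ m) * (- ln (16 * L) / q))" unfolding r_def by (rule exp_of_nat_mult[symmetric])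
    also have "real (2 ^ m) * (- ln (16 * L) / q) = - ln (16 * L)" using q by (simp add: q_def)
    finally have rq: "r ^ (2 ^ m) = 1 / (16 * L)" using L by (simp add: exp_minus field_simps)
    define b where "b = sqrt L / sqrt N"
    have b: "0 < b" "b\<^sup>2 * N = L" using L N by (auto simp: b_def power_divide)
    interpret sk N b by standard (use N b in auto)
    have cE: "real (card ({1..N} \<times> {1..N})) = (real N)\<^sup>2" by (simp add: power2_eq_square)
    \<comment> \<open>The root of order \<open>q\<close> of \<open>12 / N\<close>, the normalised
      bound at the end of the iteration.\<close>
    define v where "v = exp ((ln 12 - L) / q)"
    have vq: "v ^ (2 ^ m) = 12 / real N"
    proof -
      have "v ^ (2 ^ m) = exp (real (2 ^ m) * ((ln 12 - L) / q))" unfolding v_def by (rule exp_of_nat_mult[symmetric])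
      also have "real (2 ^ m) * ((ln 12 - L) / q) = ln 12 - L" using q by (simp add: q_def)
      finally show ?thesis by (simp add: exp_diff expL)
    qed
    have Bv: "B r / (real N)\<^sup>2 \<le> v"
    proof (rule ccontr)
      assume "\<not> B r / (real N)\<^sup>2 \<le> v"
      then have "v ^ (2 ^ m) < (B r / (real N)\<^sup>2) ^ (2 ^ m)"
        by (intro power_strict_mono) (auto simp: v_def)
      also have "\<dots> \<le> B (r ^ (2 ^ m)) / (real N)\<^sup>2"
        using B_iterate[OF r, of m] N unfolding cE by auto
      also have "\<dots> \<le> 12 * real N / (real N)\<^sup>2"
      proof (rule divide_right_mono)
        have "b\<^sup>2 * N * r ^ (2 ^ m) = 1 / 16" unfolding b(2) rq using L by simp
        then show "B (r ^ (2 ^ m)) \<le> 12 * real N"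
          using r B_high_temperature[of "r ^ (2 ^ m)"] by (simp add: power_le_one)
      qed simp
      also have "\<dots> = 12 / real N" using N by (simp add: power2_eq_square)
      finally show False using vq by simp
    qed
    have v_le: "v \<le> exp ((ln 12 - L) / (2 * L powr (3/4)))"
    proof -
      have "(L - ln 12) / (2 * L powr (3/4)) \<le> (L - ln 12) / q"
        using L q by (intro divide_left_mono mult_pos_pos) auto
      then show ?thesis unfolding v_def by (simp add: diff_divide_distrib)
    qed
    have sr: "1 - sqrt r \<le> ln (16 * L) * L powr (-3/4) / 2"
    proof -
      have "sqrt r = exp (- ln (16 * L) / (2 * q))"
        by (rule real_sqrt_unique) (auto simp: r_def simp flip: exp_double)
      then have "1 - sqrt r \<le> ln (16 * L) / (2 * q)"
        using exp_ge_add_one_self[of "- ln (16 * L) / (2 * q)"] by simp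
      also have "\<dots> \<le> ln (16 * L) / (2 * L powr (3/4))"
        using l16 q L34 by (intro divide_left_mono mult_pos_pos) auto
      also have "\<dots> = ln (16 * L) * L powr (-3/4) / 2"
        using L by (simp add: powr_minus_divide)
      finally show ?thesis .
    qed
    \<comment> \<open>The second moment bound contributes
      \<open>8 * a\<^sup>2 * N = 8 * L powr (-1/12)\<close> to the failure probability, the target
      order.\<close>
    define a where "a = L powr (-1/24) / sqrt N"
    have a: "0 < a" "a\<^sup>2 * N = L powr (-1/12)"
    proof -
      have "(L powr (-1/24))\<^sup>2 = L powr (-1/12)" by (simp add: power2_eq_square flip: powr_add)
      then show "0 < a" "a\<^sup>2 * N = L powr (-1/12)" using L N by (auto simp: a_def power_divide)
    qed
    define h where "h = real N * sqrt N"
    have h: "0 < h" using N by (simp add: h_def)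
    \<comment> \<open>Half of the leading term \<open>a * N\<^sup>2 / 2\<close> of the threshold;
      the other half absorbs \<open>ln 2 / a\<close>.\<close>
    define m0 where "m0 = h * (L powr (-1/24) / 4)"
    have m0: "0 < m0" using h L by (simp add: m0_def)
    have inv: "L powr (-1/24) * L powr (1/24) = 1" using L by (simp flip: powr_add)
    have m0_le: "m0 \<le> a * (real N)\<^sup>2 / 2 - ln 2 / a"
    proof -
      have s: "sqrt N * sqrt N = real N" by simp
      have 1: "a * (real N)\<^sup>2 = h * L powr (-1/24)"
        using N by (simp add: a_def h_def power2_eq_square field_simps)
      have "ln 2 / a = ln 2 * L powr (1/24) * sqrt N"
        using inv N L by (simp add: a_def field_simps)
      also have "\<dots> \<le> (real N * L powr (-1/24) / 4) * sqrt N"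
        using L(4) by (intro mult_right_mono) auto
      also have "\<dots> = m0" by (simp add: m0_def h_def)
      finally have 2: "ln 2 / a \<le> m0" .
      have "h * L powr (-1/24) / 2 = m0 + m0" by (simp add: m0_def)
      then show ?thesis unfolding 1 using 2 by linarith
    qed
    define \<epsilon> where "\<epsilon> = exp (- (L powr (1/8)))"
    define \<delta> where "\<delta> = L powr (-1/8)"
    have \<epsilon>: "0 < \<epsilon>" "\<epsilon> < 1" using L8 by (auto simp: \<epsilon>_def)
    have \<delta>: "0 < \<delta>" using L by (simp add: \<delta>_def)
    have main: "measure (gaussian_disorder N) {g \<in> space (gaussian_disorder N). multiple_peaks N (L powr (1/8)) \<epsilon> \<delta> g}
      \<ge> 1 - (8 * (a\<^sup>2 * N) + (real n)\<^sup>2 * (v / \<epsilon>)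
        + real n * (((1 - sqrt r) * (2 * (N * sqrt N)) + N * ln 2 / b) / (\<delta> * m0)))"
      using a L(3) by (intro multiple_peaks_prob r \<epsilon> \<delta> n m0 m0_le Bv) auto
    have second: "(real n)\<^sup>2 * (v / \<epsilon>) \<le> L powr (-1/12)"
    proof -
      have "(real n)\<^sup>2 * (v / \<epsilon>) \<le> (2 * L powr (1/8))\<^sup>2 * (exp ((ln 12 - L) / (2 * L powr (3/4))) / \<epsilon>)"
        using n v_le \<epsilon> by (intro mult_mono divide_right_mono power_mono) (auto simp: v_def)
      then show ?thesis using L(6) by (simp add: \<epsilon>_def)
    qed
    have third: "real n * (((1 - sqrt r) * (2 * (N * sqrt N)) + N * ln 2 / b) / (\<delta> * m0)) \<le> L powr (-1/12)"
    proof -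
      have "N * ln 2 / b = h * (ln 2 * L powr (-1/2))"
        using L N by (simp add: b_def h_def powr_minus_divide powr_half_sqrt)
      moreover have "(1 - sqrt r) * (2 * (N * sqrt N)) \<le> h * (ln (16 * L) * L powr (-3/4))"
        using mult_right_mono[OF sr, of "2 * h"] h by (simp add: h_def mult_ac)
      ultimately have "(1 - sqrt r) * (2 * (N * sqrt N)) + N * ln 2 / b
        \<le> h * (ln (16 * L) * L powr (-3/4) + ln 2 * L powr (-1/2))" by (simp add: distrib_left)
      then have "((1 - sqrt r) * (2 * (N * sqrt N)) + N * ln 2 / b) / (\<delta> * m0)
        \<le> h * (ln (16 * L) * L powr (-3/4) + ln 2 * L powr (-1/2)) / (\<delta> * m0)"
        using \<delta> m0 by (intro divide_right_mono) auto
      also have "\<dots> = (ln (16 * L) * L powr (-3/4) + ln 2 * L powr (-1/2)) * (4 / (\<delta> * L powr (-1/24)))"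
      proof -
        have "h * x / (\<delta> * (h * (y / 4))) = x * (4 / (\<delta> * y))" for x y
          using h \<delta> by (cases "y = 0") (simp_all add: field_simps)
        then show ?thesis by (simp only: m0_def)
      qed
      also have "4 / (\<delta> * L powr (-1/24)) = 4 * L powr (1/8) * L powr (1/24)"
        unfolding \<delta>_def using L by (simp add: powr_minus_divide)
      finally have le: "((1 - sqrt r) * (2 * (N * sqrt N)) + N * ln 2 / b) / (\<delta> * m0)
        \<le> (ln (16 * L) * L powr (-3/4) + ln 2 * L powr (-1/2)) * (4 * L powr (1/8) * L powr (1/24))" .
      have nn: "0 \<le> (ln (16 * L) * L powr (-3/4) + ln 2 * L powr (-1/2)) * (4 * L powr (1/8) * L powr (1/24))"
        using l16 by simp
      have "real n * (((1 - sqrt r) * (2 * (N * sqrt N)) + N * ln 2 / b) / (\<delta> * m0))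
        \<le> real n * ((ln (16 * L) * L powr (-3/4) + ln 2 * L powr (-1/2)) * (4 * L powr (1/8) * L powr (1/24)))"
        using le by (intro mult_left_mono) auto
      also have "\<dots> \<le> 2 * L powr (1/8) * ((ln (16 * L) * L powr (-3/4) + ln 2 * L powr (-1/2)) * (4 * L powr (1/8) * L powr (1/24)))"
        using n nn by (intro mult_right_mono)
      also have "\<dots> \<le> L powr (-1/12)" by (rule L(5))
      finally show ?thesis .
    qed
    show ?case
      \<comment> \<open>The constant is \<open>10 = 8 + 1 + 1\<close>, from the maximum, the
        overlaps and the energies.\<close>
      using main second third a(2) unfolding \<epsilon>_def \<delta>_def L_def by linarith
  qed
qed

theorem theorem1p1:
  shows "(\<exists>r \<gamma> \<epsilon> \<delta> :: nat \<Rightarrow> real.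
            filterlim r at_top sequentially \<and>
            \<gamma> \<longlonglongrightarrow> 0 \<and> \<epsilon> \<longlonglongrightarrow> 0 \<and> \<delta> \<longlonglongrightarrow> 0 \<and>
            (\<forall>N\<ge>2. measure (gaussian_disorder N)
               {g \<in> space (gaussian_disorder N). multiple_peaks N (r N) (\<epsilon> N) (\<delta> N) g}
               \<ge> 1 - \<gamma> N))
       \<and> (\<exists>C :: real. \<forall>N\<ge>2. measure (gaussian_disorder N)
            {g \<in> space (gaussian_disorder N).
               multiple_peaks N
                 (ln (real N) powr (1/8))
                 (exp (- (ln (real N) powr (1/8))))
                 (ln (real N) powr (- 1/8)) g}
            \<ge> 1 - C * ln (real N) powr (- 1/12))"
proof -
  let ?P = "\<lambda>N. measure (gaussian_disorder N)
            {g \<in> space (gaussian_disorder N).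
               multiple_peaks N
                 (ln (real N) powr (1/8))
                 (exp (- (ln (real N) powr (1/8))))
                 (ln (real N) powr (- 1/8)) g}"
  obtain N0 where N0: "\<And>N. N \<ge> N0 \<Longrightarrow> ?P N \<ge> 1 - 10 * ln (real N) powr (- 1/12)"
    using eventually_multiple_peaks_prob unfolding eventually_sequentially by blast
  \<comment> \<open>The second entry makes the lower bound nonpositive, hence trivial, for the
    finitely many \<open>N\<close> below \<open>N0\<close>; \<open>ln N\<close> is positive there
    since \<open>N \<ge> 2\<close>.\<close>
  define C where "C = max 10 (ln (real (max 2 N0)) powr (1/12))"
  have C: "?P N \<ge> 1 - C * ln (real N) powr (- 1/12)" if N: "N \<ge> 2" for N
  proof (cases "N \<ge> N0")
    case True
    have "10 * ln (real N) powr (- 1/12) \<le> C * ln (real N) powr (- 1/12)"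
      by (intro mult_right_mono) (auto simp: C_def)
    then show ?thesis using N0[OF True] by linarith
  next
    case False
    have l: "0 < ln (real N)" using N by simp
    have "1 = ln (real N) powr (1/12) * ln (real N) powr (- 1/12)"
      using l by (simp flip: powr_add)
    also have "\<dots> \<le> C * ln (real N) powr (- 1/12)"
    proof (rule mult_right_mono)
      have "ln (real N) powr (1/12) \<le> ln (real (max 2 N0)) powr (1/12)"
        using l N False by (intro powr_mono2) auto
      then show "ln (real N) powr (1/12) \<le> C" by (simp add: C_def)
    qed simp
    finally have "1 - C * ln (real N) powr (- 1/12) \<le> 0" by simp
    also have "0 \<le> ?P N" by (rule measure_nonneg)
    finally show ?thesis .
  qed
  have lim: "filterlim (\<lambda>N. ln (real N) powr (1/8)) at_top sequentially"
    "(\<lambda>N. C * ln (real N) powr (- 1/12)) \<longlonglongrightarrow> 0"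
    "(\<lambda>N. exp (- (ln (real N) powr (1/8)))) \<longlonglongrightarrow> 0"
    "(\<lambda>N. ln (real N) powr (- 1/8)) \<longlonglongrightarrow> 0"
    by real_asymp+
  show ?thesis
  proof (rule conjI)
    show "\<exists>r \<gamma> \<epsilon> \<delta> :: nat \<Rightarrow> real.
            filterlim r at_top sequentially \<and>
            \<gamma> \<longlonglongrightarrow> 0 \<and> \<epsilon> \<longlonglongrightarrow> 0 \<and> \<delta> \<longlonglongrightarrow> 0 \<and>
            (\<forall>N\<ge>2. measure (gaussian_disorder N)
               {g \<in> space (gaussian_disorder N). multiple_peaks N (r N) (\<epsilon> N) (\<delta> N) g}
               \<ge> 1 - \<gamma> N)"
      by (rule exI[of _ "\<lambda>N. ln (real N) powr (1/8)"], rule exI[of _ "\<lambda>N. C * ln (real N) powr (- 1/12)"],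
          rule exI[of _ "\<lambda>N. exp (- (ln (real N) powr (1/8)))"], rule exI[of _ "\<lambda>N. ln (real N) powr (- 1/8)"])
        (use lim C in blast)
  qed (use C in blast)
qed

end
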